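(* (1) For all integers $n\ge 1$ and $2\le k\le n+1$, the number of spheres in the wedge of $(n-k+1)$-dimensional spheres to which $D_k(\Delta^n)$ is homotopy equivalent is $$\beta_{k,n}=\sum_{i=0}^{k}(-1)^{i+k+1}\binom{k}{i+1}\, i^{\,n+1};$$ that is, $D_k(\Delta^n)$ is homotopy equivalent to a wedge of exactly $\beta_{k,n}$ spheres of dimension $n-k+1$. (2) The Euler characteristic $\chi_{k,n}$ of $D_k(\Delta^n)$ has the two-variable exponential generating function $$\sum_{k\ge 0}\sum_{n\ge 0}\chi_{k,n-1}\,\frac{x^k}{k!}\,\frac{y^n}{n!}=e^{x+y-xe^{-y}}.$$
   Context: $\Delta^n$ is the $n$-dimensional simplex, i.e. the full simplicial complex on the vertex set $[n+1]=\{1,\dots,n+1\}$. The discretized configuration space $D_k(\Delta^n)$ is the largest cell complex (subcomplex of the product cell complex $(\Delta^n)^k$) that is contained in $(\Delta^n)^k$ minus the diagonal $\{(x_1,\dots,x_k)\in(\Delta^n)^k : x_i=x_j \text{ for some } i\neq j\}$. Explicitly, $D_k(\Delta^n)=\bigcup \sigma_1\times\cdots\times\sigma_k\subset(\Delta^n)^k$, where the union is over all $k$-tuples $(\sigma_1,\dots,\sigma_k)$ of open cells (interiors of nonempty faces) of $\Delta^n$ whose closures $\bar\sigma_1,\dots,\bar\sigma_k$ are pairwise disjoint. A wedge of $m$ spheres of dimension $0$ is a discrete space with $m+1$ points. $\chi_{k,n}$ denotes the (unreduced) Euler characteristic of $D_k(\Delta^n)$. In the generating function the degenerate conventions are: $\chi_{k,n-1}=0$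 when $k>n$ (the space is empty), and $D_0(\Delta^{n-1})$ is a single point for every $n\ge 0$ (including $n=0$, with $\Delta^{-1}$ the empty simplex), so $\chi_{0,n-1}=1$. *)

theory Defs
  imports "HOL-Analysis.Analysis" "HOL-Computational_Algebra.Formal_Power_Series"
begin

section \<open>Discretized configuration spaces of a simplex\<close>

text \<open>
  The full simplex on a finite vertex set \<open>V\<close> is realised in barycentric coordinates: a point is a
  function \<^typ>\<open>nat \<Rightarrow> real\<close> vanishing outside \<open>V\<close>.  Its nonempty faces correspond to the nonempty
  subsets of \<open>V\<close>.  The \<open>n\<close>-simplex has \<open>V = {1..n+1}\<close>; the empty simplex has \<open>V = {}\<close>.
\<close>

definition faces :: "nat set \<Rightarrow> nat set set" where
  "faces V = {S. S \<subseteq> V \<and> S \<noteq> {}}"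

definition open_face :: "nat set \<Rightarrow> (nat \<Rightarrow> real) set" where
  "open_face S = {x. (\<forall>v\<in>S. 0 < x v) \<and> (\<forall>v. v \<notin> S \<longrightarrow> x v = 0) \<and> (\<Sum>v\<in>S. x v) = 1}"

definition closed_face :: "nat set \<Rightarrow> (nat \<Rightarrow> real) set" where
  "closed_face S = {x. (\<forall>v\<in>S. 0 \<le> x v) \<and> (\<forall>v. v \<notin> S \<longrightarrow> x v = 0) \<and> (\<Sum>v\<in>S. x v) = 1}"

text \<open>
  The cells of the discretized configuration space are the products of open faces with pairwise
  disjoint closures.  Tuples are extensional functions on \<open>{1..k}\<close>, so for \<open>k = 0\<close> there is exactly
  one (empty) tuple, giving a one-point space.
\<close>

definition conf_cells :: "nat \<Rightarrow> nat set \<Rightarrow> (nat \<Rightarrow> nat set) set" where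
  "conf_cells k V =
     {\<sigma> \<in> {1..k} \<rightarrow>\<^sub>E faces V. pairwise (\<lambda>i j. disjnt (closed_face (\<sigma> i)) (closed_face (\<sigma> j))) {1..k}}"

definition open_cell :: "nat \<Rightarrow> (nat \<Rightarrow> nat set) \<Rightarrow> (nat \<Rightarrow> nat \<Rightarrow> real) set" where
  "open_cell k \<sigma> = (\<Pi>\<^sub>E i\<in>{1..k}. open_face (\<sigma> i))"

definition cell_dim :: "nat \<Rightarrow> (nat \<Rightarrow> nat set) \<Rightarrow> nat" where
  "cell_dim k \<sigma> = (\<Sum>i\<in>{1..k}. card (\<sigma> i) - 1)"

definition disc_conf_space :: "nat \<Rightarrow> nat set \<Rightarrow> (nat \<Rightarrow> nat \<Rightarrow> real) topology" where
  "disc_conf_space k V =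
     subtopology (product_topology (\<lambda>_. powertop_real UNIV) {1..k})
       (\<Union>\<sigma>\<in>conf_cells k V. open_cell k \<sigma>)"

text \<open>
  The unreduced Euler characteristic of this finite cell complex: the alternating sum of the numbers
  of its cells.  The empty complex gives \<open>0\<close>.
\<close>

definition conf_euler_char :: "nat \<Rightarrow> nat set \<Rightarrow> int" where
  "conf_euler_char k V = (\<Sum>\<sigma>\<in>conf_cells k V. (- 1) ^ cell_dim k \<sigma>)"

lemma finite_conf_cells: "finite V \<Longrightarrow> finite (conf_cells k V)"
  unfolding conf_cells_def faces_def by (simp add: finite_PiE)

lemma disjnt_closed_face_iff:
  assumes "finite S" "finite T"
  shows "disjnt (closed_face S) (closed_face T) \<longleftrightarrow> disjnt S T"
proof
  assume dis: "disjnt (closed_face S) (closed_face T)"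
  show "disjnt S T"
  proof (rule ccontr)
    assume "\<not> disjnt S T"
    then obtain v where v: "v \<in> S" "v \<in> T"
      by (auto simp: disjnt_iff)
    define x :: "nat \<Rightarrow> real" where "x = (\<lambda>u. if u = v then 1 else 0)"
    have "x \<in> closed_face S" "x \<in> closed_face T"
      using v assms by (auto simp: closed_face_def x_def)
    with dis show False
      by (auto simp: disjnt_iff)
  qed
next
  assume dis: "disjnt S T"
  show "disjnt (closed_face S) (closed_face T)"
    unfolding disjnt_iff
  proof (intro allI notI)
    fix x assume x: "x \<in> closed_face S \<and> x \<in> closed_face T"
    then have "x v = 0" if "v \<in> S" for v
      using dis that by (auto simp: closed_face_def disjnt_iff)
    then have "(\<Sum>v\<in>S. x v) = 0" by simp
    with x show False by (simp add: closed_face_def)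
  qed
qed


section \<open>Wedges of spheres\<close>

text \<open>
  The wedge of the pointed spaces \<open>(X i, b i)\<close>, \<open>i \<in> I\<close>, carries the quotient topology of the disjoint
  union: \<^term>\<open>None\<close> is the common base point and \<open>Some (i, x)\<close> is the point \<open>x \<noteq> b i\<close> of the \<open>i\<close>-th
  summand.  The empty wedge is a point.
\<close>

definition wedge_map :: "('i \<Rightarrow> 'a) \<Rightarrow> 'i \<times> 'a \<Rightarrow> ('i \<times> 'a) option" where
  "wedge_map b = (\<lambda>(i, x). if x = b i then None else Some (i, x))"

definition wedge_topology ::
    "('i \<Rightarrow> 'a topology) \<Rightarrow> ('i \<Rightarrow> 'a) \<Rightarrow> 'i set \<Rightarrow> ('i \<times> 'a) option topology" where
  "wedge_topology X b I =
     topology (\<lambda>U. U \<subseteq> insert None (wedge_map b ` (SIGMA i:I. topspace (X i))) \<and>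
       (\<forall>i\<in>I. openin (X i) {x \<in> topspace (X i). wedge_map b (i, x) \<in> U}))"

lemma istopology_wedge:
  "istopology (\<lambda>U. U \<subseteq> insert None (wedge_map b ` (SIGMA i:I. topspace (X i))) \<and>
       (\<forall>i\<in>I. openin (X i) {x \<in> topspace (X i). wedge_map b (i, x) \<in> U}))"
proof -
  have 1: "{x \<in> topspace (X i). wedge_map b (i, x) \<in> S \<inter> T} =
        {x \<in> topspace (X i). wedge_map b (i, x) \<in> S} \<inter> {x \<in> topspace (X i). wedge_map b (i, x) \<in> T}"
    for i S T by auto
  have 2: "{x \<in> topspace (X i). wedge_map b (i, x) \<in> \<Union>K} =
        (\<Union>S\<in>K. {x \<in> topspace (X i). wedge_map b (i, x) \<in> S})" for i K by auto
  show ?thesis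
    unfolding istopology_def 1 2 by (intro conjI allI impI; blast)
qed

lemma openin_wedge_topology:
  "openin (wedge_topology X b I) U \<longleftrightarrow>
     U \<subseteq> insert None (wedge_map b ` (SIGMA i:I. topspace (X i))) \<and>
     (\<forall>i\<in>I. openin (X i) {x \<in> topspace (X i). wedge_map b (i, x) \<in> U})"
  unfolding wedge_topology_def by (simp add: istopology_wedge topology_inverse')

lemma topspace_wedge_topology:
  "topspace (wedge_topology X b I) = insert None (wedge_map b ` (SIGMA i:I. topspace (X i)))"
proof (rule antisym)
  show "topspace (wedge_topology X b I) \<subseteq> insert None (wedge_map b ` (SIGMA i:I. topspace (X i)))"
    using openin_topspace[of "wedge_topology X b I"] unfolding openin_wedge_topology by (rule conjunct1)
  have "{x \<in> topspace (X i). wedge_map b (i, x) \<in> insert None (wedge_map b ` (SIGMA i:I. topspace (X i)))}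
      = topspace (X i)" if "i \<in> I" for i
    using that by force
  then have "openin (wedge_topology X b I) (insert None (wedge_map b ` (SIGMA i:I. topspace (X i))))"
    by (simp add: openin_wedge_topology)
  then show "insert None (wedge_map b ` (SIGMA i:I. topspace (X i))) \<subseteq> topspace (wedge_topology X b I)"
    by (rule openin_subset)
qed

lemma quotient_map_wedge:
  assumes "I \<noteq> {}" "\<And>i. i \<in> I \<Longrightarrow> b i \<in> topspace (X i)"
  shows "quotient_map (sum_topology X I) (wedge_topology X b I) (wedge_map b)"
proof -
  obtain j where j: "j \<in> I" using assms by blast
  then have "(j, b j) \<in> (SIGMA i:I. topspace (X i))" using assms by auto
  moreover have "wedge_map b (j, b j) = None" by (simp add: wedge_map_def)
  ultimately have None: "None \<in> wedge_map b ` (SIGMA i:I. topspace (X i))"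
    by (metis imageI)
  have fib: "{x. i \<in> I \<and> x \<in> topspace (X i) \<and> wedge_map b (i, x) \<in> U} =
      {x \<in> topspace (X i). wedge_map b (i, x) \<in> U}" if "i \<in> I" for i U
    using that by auto
  show ?thesis
    unfolding quotient_map_def topspace_wedge_topology openin_wedge_topology openin_sum_topology
    using None by (auto simp: fib insert_absorb o_def)
qed

definition wedge_of_spheres :: "nat \<Rightarrow> nat \<Rightarrow> (nat \<times> (nat \<Rightarrow> real)) option topology" where
  "wedge_of_spheres m d =
     wedge_topology (\<lambda>_. nsphere d) (\<lambda>_ i. if i = 0 then 1 else 0) {..<m}"


section \<open>Formal power series in two variables\<close>

text \<open>
  A series in \<open>x, y\<close> is a series in \<open>x\<close> whose coefficients are series in \<open>y\<close>.  The exponential of a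
  bivariate series is the coefficientwise limit of \<open>\<Sum>j. F ^ j / j!\<close>; for \<open>F\<close> without constant term
  each coefficient is a finite sum.
\<close>

definition fps2_x :: "real fps fps" where "fps2_x = fps_X"

definition fps2_y :: "real fps fps" where "fps2_y = fps_const fps_X"

definition fps2_exp :: "real fps fps \<Rightarrow> real fps fps" where
  "fps2_exp F = Abs_fps (\<lambda>k. Abs_fps (\<lambda>n. \<Sum>j. fps_nth (fps_nth (F ^ j) k) n / fact j))"

lemma fps2_exp_nth:
  assumes "fps_nth (fps_nth F 0) 0 = 0"
  shows "fps_nth (fps_nth (fps2_exp F) k) n = (\<Sum>j\<le>k+n. fps_nth (fps_nth (F ^ j) k) n / fact j)"
proof -
  have zero: "k + n < j \<Longrightarrow> fps_nth (fps_nth (F ^ j) k) n = 0" for j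
  proof (induction j arbitrary: k n)
    case (Suc j)
    have "fps_nth (fps_nth F a * fps_nth (F ^ j) (k - a)) n = 0" if "a \<le> k" for a
    proof -
      have "fps_nth (fps_nth F a) c * fps_nth (fps_nth (F ^ j) (k - a)) (n - c) = 0" if "c \<le> n" for c
      proof (cases "a = 0 \<and> c = 0")
        case True
        then show ?thesis using assms by simp
      next
        case False
        then have "(k - a) + (n - c) < j" using Suc.prems \<open>a \<le> k\<close> \<open>c \<le> n\<close> by linarith
        then show ?thesis using Suc.IH by simp
      qed
      then show ?thesis unfolding fps_mult_nth by (intro sum.neutral) simp
    qed
    then show ?case by (simp add: fps_mult_nth[of F] fps_sum_nth)
  qed simp
  have "fps_nth (fps_nth (fps2_exp F) k) n = (\<Sum>j. fps_nth (fps_nth (F ^ j) k) n / fact j)"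
    by (simp add: fps2_exp_def)
  also have "\<dots> = (\<Sum>j\<le>k+n. fps_nth (fps_nth (F ^ j) k) n / fact j)"
    by (rule suminf_finite) (auto simp: zero)
  finally show ?thesis .
qed

end

theory Submission
  imports Defs
begin

text \<open>
  Cells are tuples of disjoint nonempty vertex sets.  Adding a vertex \<open>v\<close> that is not used by a chosen
  base vertex writes the complex for \<open>k\<close> colours on \<open>W \<union> {v}\<close> as the complex on \<open>W\<close> glued, for every
  colour \<open>i\<close>, to the mapping cylinder of the projection that forgets colour \<open>i\<close>.  By induction, the
  complex without some cells \<open>R\<close> of top dimension (all of which use all vertices) is built from a
  single vertex by elementary expansions, hence contractible.  The projections miss the cells of \<open>R\<close>,
  which is what makes the induction work.  A contraction of this subcomplex extends to a homotopy of
  the whole space (radially on the cells of \<open>R\<close>), so that the space is homotopy equivalent to its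
  quotient by the subcomplex, a wedge of one sphere for each cell of \<open>R\<close>.  Expansions do not change the
  Euler characteristic, which therefore gives the number of these cells; it satisfies a recursion
  from the same decomposition.
\<close>


section \<open>Cells and elementary expansions\<close>

text \<open>All homotopy equivalences come from explicit deformations, so dimensions 0 and 1 need no
  separate argument. Forgetting a colour \<open>i\<close> leads to the complex for
  \<open>K - {i}\<close>, so the induction on vertices runs over all finite colour sets at once,
  with one base tuple \<open>a\<close> restricted to each of them; expansions compare cells in
  \<open>cells K UNIV\<close>, so they survive enlarging the vertex set. Three things follow from
  the omitted cells using all vertices. The proper faces of an omitted cell are not full and so lie
  in the subcomplex. All omitted cells have dimension \<open>card V - card K\<close>. When a vertex
  is added, each old omitted cell is absorbed as a free face of its cylinder for one fixed colour;
  its cylinders for the other colours become omitted, as do the copies of cells omitted for one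
  colour fewer. The induction stops when no vertex is off the base tuple: then every cell is a point
  and uses all vertices.\<close>

definition cells :: "nat set \<Rightarrow> nat set \<Rightarrow> (nat \<Rightarrow> nat set) set" where
  "cells K V = {\<sigma> \<in> K \<rightarrow>\<^sub>E faces V. pairwise (\<lambda>i j. disjnt (\<sigma> i) (\<sigma> j)) K}"

lemma conf_cells_eq: "finite V \<Longrightarrow> conf_cells k V = cells {1..k} V"
proof -
  assume V: "finite V"
  have "disjnt (closed_face (\<sigma> i)) (closed_face (\<sigma> j)) \<longleftrightarrow> disjnt (\<sigma> i) (\<sigma> j)"
    if "\<sigma> \<in> {1..k} \<rightarrow>\<^sub>E faces V" "i \<in> {1..k}" "j \<in> {1..k}" for \<sigma> i j
  proof -
    have "\<sigma> i \<in> faces V" "\<sigma> j \<in> faces V" using that by auto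
    then have "finite (\<sigma> i)" "finite (\<sigma> j)"
      using V by (auto simp: faces_def intro: finite_subset)
    then show ?thesis by (rule disjnt_closed_face_iff)
  qed
  then show ?thesis
    unfolding conf_cells_def cells_def pairwise_def by blast
qed

lemma cells_iff: "\<sigma> \<in> cells K V \<longleftrightarrow>
    (\<forall>i\<in>K. \<sigma> i \<subseteq> V \<and> \<sigma> i \<noteq> {}) \<and> (\<forall>i. i \<notin> K \<longrightarrow> \<sigma> i = undefined) \<and>
    (\<forall>i\<in>K. \<forall>j\<in>K. i \<noteq> j \<longrightarrow> \<sigma> i \<inter> \<sigma> j = {})"
  by (auto simp: cells_def faces_def PiE_iff extensional_def pairwise_def disjnt_def)

lemma finite_cells: "finite K \<Longrightarrow> finite V \<Longrightarrow> finite (cells K V)"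
  unfolding cells_def faces_def by (simp add: finite_PiE)

lemma cells_mono: "V \<subseteq> W \<Longrightarrow> cells K V \<subseteq> cells K W"
  by (fastforce simp: cells_iff)

text \<open>Outside \<open>K\<close> every cell has the value \<open>undefined\<close>, so there an
  update that yields a cell cannot add a vertex. This supplies \<open>j \<in> K\<close> for the
  pairs of \<open>expands\<close>, whose rule does not ask for it.\<close>

lemma added_vertex_factor:
  assumes "\<alpha> \<in> cells K V" "\<alpha>(j := insert w (\<alpha> j)) \<in> cells K W" "w \<notin> \<alpha> j"
  shows "j \<in> K"
proof (rule ccontr)
  assume "j \<notin> K"
  then have "insert w (\<alpha> j) = \<alpha> j" using assms(1,2) by (metis cells_iff fun_upd_same)
  then show False using assms(3) by blast
qed

text \<open>The order on cells is the pointwise inclusion of the factors.\<close>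

inductive expands :: "nat set \<Rightarrow> (nat \<Rightarrow> nat set) set \<Rightarrow> (nat \<Rightarrow> nat set) set \<Rightarrow> bool"
  for K S where
  start: "expands K S S"
| expand: "\<lbrakk>expands K S L; \<alpha> \<in> cells K UNIV; \<beta> \<in> cells K UNIV; \<alpha> \<notin> L; \<beta> \<notin> L;
    w \<notin> \<alpha> j; \<beta> = \<alpha>(j := insert w (\<alpha> j));
    \<And>\<gamma>. \<gamma> \<in> cells K UNIV \<Longrightarrow> \<gamma> \<le> \<beta> \<Longrightarrow> \<gamma> \<noteq> \<alpha> \<Longrightarrow> \<gamma> \<noteq> \<beta> \<Longrightarrow> \<gamma> \<in> L\<rbrakk>
    \<Longrightarrow> expands K S (insert \<alpha> (insert \<beta> L))"

lemma expands_trans: "expands K T L \<Longrightarrow> expands K S T \<Longrightarrow> expands K S L"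
  by (induction rule: expands.induct) (auto intro: expands.expand)

lemma expands_superset: "expands K S L \<Longrightarrow> S \<subseteq> L"
  by (induction rule: expands.induct) auto

text \<open>The other faces of every pair lie in \<open>S\<close> already, so no pair waits for
  another and they can be attached in any order.\<close>

lemma expands_family:
  assumes "finite J"
    and "\<And>i. i \<in> J \<Longrightarrow> \<alpha> i \<in> cells K UNIV" "\<And>i. i \<in> J \<Longrightarrow> \<beta> i \<in> cells K UNIV"
    and "\<And>i. i \<in> J \<Longrightarrow> \<alpha> i \<notin> S" "\<And>i. i \<in> J \<Longrightarrow> \<beta> i \<notin> S"
    and "inj_on \<alpha> J" "inj_on \<beta> J" "\<alpha> ` J \<inter> \<beta> ` J = {}"
    and "\<And>i. i \<in> J \<Longrightarrow> \<exists>j w. w \<notin> \<alpha> i j \<and> \<beta> i = (\<alpha> i)(j := insert w (\<alpha> i j))"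
    and "\<And>i \<gamma>. i \<in> J \<Longrightarrow> \<gamma> \<in> cells K UNIV \<Longrightarrow> \<gamma> \<le> \<beta> i \<Longrightarrow> \<gamma> \<noteq> \<alpha> i \<Longrightarrow> \<gamma> \<noteq> \<beta> i \<Longrightarrow> \<gamma> \<in> S"
  shows "expands K S (S \<union> \<alpha> ` J \<union> \<beta> ` J)"
  using assms
proof (induction J rule: finite_induct)
  case empty
  then show ?case by (simp add: expands.start)
next
  case (insert i J)
  have IH: "expands K S (S \<union> \<alpha> ` J \<union> \<beta> ` J)"
  proof (rule insert.IH)
    show "\<gamma> \<in> S" if "l \<in> J" "\<gamma> \<in> cells K UNIV" "\<gamma> \<le> \<beta> l" "\<gamma> \<noteq> \<alpha> l" "\<gamma> \<noteq> \<beta> l" for l \<gamma>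
      by (rule insert.prems(9)[of l]) (use that in auto)
  qed (use insert.prems(1-8) in auto)
  obtain j w where jw: "w \<notin> \<alpha> i j" "\<beta> i = (\<alpha> i)(j := insert w (\<alpha> i j))"
    using insert.prems(8) by blast
  have "expands K S (insert (\<alpha> i) (insert (\<beta> i) (S \<union> \<alpha> ` J \<union> \<beta> ` J)))"
    by (rule expands.expand[OF IH _ _ _ _ jw])
       (use insert.prems(1-7) insert.hyps insert.prems(9)[of i] in \<open>auto simp: inj_on_def\<close>)
  moreover have "insert (\<alpha> i) (insert (\<beta> i) (S \<union> \<alpha> ` J \<union> \<beta> ` J))
      = S \<union> \<alpha> ` insert i J \<union> \<beta> ` insert i J" by auto
  ultimately show ?case by simp
qed

section \<open>Cells created by a new vertex: mapping cylinders of the projections\<close>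

definition put_vertex :: "nat \<Rightarrow> nat \<Rightarrow> (nat \<Rightarrow> nat set) \<Rightarrow> nat \<Rightarrow> nat set" where
  "put_vertex v i \<rho> = \<rho>(i := {v})"

lemma put_vertex_eq_iff:
  assumes "\<rho> \<in> cells (K - {i}) (- {v})" "\<rho>' \<in> cells (K - {j}) (- {v})" "i \<in> K" "j \<in> K"
  shows "put_vertex v i \<rho> = put_vertex v j \<rho>' \<longleftrightarrow> i = j \<and> \<rho> = \<rho>'"
proof
  assume eq: "put_vertex v i \<rho> = put_vertex v j \<rho>'"
  have ij: "i = j"
  proof (rule ccontr)
    assume "i \<noteq> j"
    then have "{v} = \<rho>' i"
      using fun_cong[OF eq, of i] by (simp add: put_vertex_def)
    moreover have "v \<notin> \<rho>' i" using assms(2,3) \<open>i \<noteq> j\<close> by (auto simp: cells_iff)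
    ultimately show False by blast
  qed
  have "\<rho> l = \<rho>' l" for l
  proof (cases "l = i")
    case True
    then show ?thesis using assms ij by (simp add: cells_iff)
  next
    case False
    then show ?thesis using fun_cong[OF eq, of l] ij by (simp add: put_vertex_def)
  qed
  then show "i = j \<and> \<rho> = \<rho>'" using ij by auto
qed auto

lemma put_vertex_in_cells:
  assumes "\<rho> \<in> cells (K - {i}) (V - {v})" "i \<in> K" "v \<in> V"
  shows "put_vertex v i \<rho> \<in> cells K V"
proof -
  have "\<rho> l \<subseteq> V" "v \<notin> \<rho> l" "\<rho> l \<noteq> {}" if "l \<in> K" "l \<noteq> i" for l
    using assms(1) that by (auto simp: cells_iff)
  moreover have "\<rho> l \<inter> \<rho> m = {}" if "l \<in> K" "m \<in> K" "l \<noteq> m" "l \<noteq> i" "m \<noteq> i" for l m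
    using assms(1) that by (auto simp: cells_iff)
  moreover have "\<rho> l = undefined" if "l \<notin> K" for l
    using assms(1) that by (auto simp: cells_iff)
  ultimately show ?thesis using assms(2,3) by (simp add: put_vertex_def cells_iff)
qed

lemma put_vertex_remove:
  assumes "\<sigma> \<in> cells K V" "i \<in> K"
  shows "\<sigma>(i := undefined) \<in> cells (K - {i}) (V - \<sigma> i)"
    and "put_vertex v i (\<sigma>(i := undefined)) = put_vertex v i \<sigma>"
proof -
  have "\<sigma> l \<subseteq> V" "\<sigma> l \<noteq> {}" if "l \<in> K" for l
    using assms(1) that by (auto simp: cells_iff)
  moreover have "\<sigma> l \<inter> \<sigma> m = {}" if "l \<in> K" "m \<in> K" "l \<noteq> m" for l m
    using assms(1) that by (auto simp: cells_iff)
  moreover have "\<sigma> l = undefined" if "l \<notin> K" for l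
    using assms(1) that by (auto simp: cells_iff)
  ultimately show "\<sigma>(i := undefined) \<in> cells (K - {i}) (V - \<sigma> i)"
    using assms(2) unfolding cells_iff by (simp, blast)
qed (simp add: put_vertex_def)

text \<open>In the mapping cylinder of the projection forgetting factor \<open>i\<close>,
  \<open>\<sigma>\<close> is a cell of the source end, \<open>put_vertex v i \<sigma>\<close> its
  image in the target end, and \<open>add_vertex v i \<sigma>\<close> the cylinder cell between
  them.\<close>

definition add_vertex :: "nat \<Rightarrow> nat \<Rightarrow> (nat \<Rightarrow> nat set) \<Rightarrow> nat \<Rightarrow> nat set" where
  "add_vertex v i \<sigma> = \<sigma>(i := insert v (\<sigma> i))"

lemma add_vertex_eq_iff:
  assumes "\<sigma> \<in> cells K (- {v})" "\<tau> \<in> cells K (- {v})" "i \<in> K" "j \<in> K"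
  shows "add_vertex v i \<sigma> = add_vertex v j \<tau> \<longleftrightarrow> i = j \<and> \<sigma> = \<tau>"
proof
  assume eq: "add_vertex v i \<sigma> = add_vertex v j \<tau>"
  have ij: "i = j"
  proof (rule ccontr)
    assume "i \<noteq> j"
    then have "insert v (\<sigma> i) = \<tau> i"
      using fun_cong[OF eq, of i] by (simp add: add_vertex_def)
    then show False using assms by (auto simp: cells_iff)
  qed
  have "\<sigma> l = \<tau> l" for l
  proof (cases "l = i")
    case True
    have "insert v (\<sigma> i) = insert v (\<tau> i)"
      using fun_cong[OF eq, of i] ij by (simp add: add_vertex_def)
    moreover have "v \<notin> \<sigma> i" "v \<notin> \<tau> i" using assms by (auto simp: cells_iff)
    ultimately show ?thesis using True by (simp add: insert_ident)
  next
    case False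
    then show ?thesis using fun_cong[OF eq, of l] ij by (simp add: add_vertex_def)
  qed
  then show "i = j \<and> \<sigma> = \<tau>" using ij by auto
qed auto

lemma add_vertex_in_cells:
  assumes "\<sigma> \<in> cells K (V - {v})" "i \<in> K" "v \<in> V"
  shows "add_vertex v i \<sigma> \<in> cells K V"
proof -
  have "\<sigma> l \<subseteq> V" "v \<notin> \<sigma> l" "\<sigma> l \<noteq> {}" if "l \<in> K" for l
    using assms(1) that by (auto simp: cells_iff)
  moreover have "\<sigma> l \<inter> \<sigma> m = {}" if "l \<in> K" "m \<in> K" "l \<noteq> m" for l m
    using assms(1) that by (auto simp: cells_iff)
  moreover have "\<sigma> l = undefined" if "l \<notin> K" for l
    using assms(1) that by (auto simp: cells_iff)
  ultimately show ?thesis using assms(2,3) by (simp add: add_vertex_def cells_iff)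
qed

lemma add_vertex_neq_put_vertex:
  assumes "\<tau> \<in> cells K (- {v})" "\<rho> \<in> cells (K - {j}) (- {v})" "i \<in> K" "j \<in> K"
  shows "add_vertex v i \<tau> \<noteq> put_vertex v j \<rho>"
proof
  assume eq: "add_vertex v i \<tau> = put_vertex v j \<rho>"
  have *: "v \<notin> \<tau> j" "\<tau> j \<noteq> {}" using assms by (auto simp: cells_iff)
  have "add_vertex v i \<tau> j = {v}" by (simp add: eq put_vertex_def)
  then show False using * by (auto simp: add_vertex_def split: if_splits)
qed

lemma add_vertex_notin: "i \<in> K \<Longrightarrow> add_vertex v i \<tau> \<notin> cells K (- {v})"
  by (auto simp: cells_iff add_vertex_def intro!: bexI[of _ i])

lemma put_vertex_notin: "i \<in> K \<Longrightarrow> put_vertex v i \<rho> \<notin> cells K (- {v})"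
  by (auto simp: cells_iff put_vertex_def intro!: bexI[of _ i])

lemma cells_face:
  assumes "\<tau> \<in> cells K V" "\<gamma> \<le> \<tau>" "\<And>l. l \<in> K \<Longrightarrow> \<gamma> l \<noteq> {}" "\<And>l. l \<notin> K \<Longrightarrow> \<gamma> l = undefined"
  shows "\<gamma> \<in> cells K V"
proof -
  have le: "\<gamma> l \<subseteq> \<tau> l" for l using le_funD[OF assms(2), of l] by simp
  have "\<gamma> l \<subseteq> V" if "l \<in> K" for l
    using le[of l] assms(1) that by (auto simp: cells_iff)
  moreover have "\<gamma> l \<inter> \<gamma> m = {}" if "l \<in> K" "m \<in> K" "l \<noteq> m" for l m
  proof -
    have "\<tau> l \<inter> \<tau> m = {}" using assms(1) that by (auto simp: cells_iff)
    then show ?thesis using le[of l] le[of m] by blast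
  qed
  ultimately show ?thesis using assms(3,4) by (simp add: cells_iff)
qed

text \<open>The factors of \<open>\<tau>\<close> are disjoint, so a vertex dropped from one of them
  cannot reappear in another.\<close>

lemma proper_face_not_full:
  assumes "\<tau> \<in> cells K V" "\<gamma> \<in> cells K UNIV" "\<gamma> \<le> \<tau>" "\<gamma> \<noteq> \<tau>"
  shows "(\<Union>i\<in>K. \<gamma> i) \<noteq> V"
proof -
  have le: "\<gamma> l \<subseteq> \<tau> l" for l using le_funD[OF assms(3), of l] by simp
  obtain l where l: "\<gamma> l \<noteq> \<tau> l" using assms(4) by blast
  have lK: "l \<in> K" using l assms(1,2) by (auto simp: cells_iff)
  obtain x where x: "x \<in> \<tau> l" "x \<notin> \<gamma> l" using l le by blast
  have "x \<notin> \<gamma> m" if "m \<in> K" for m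
  proof (cases "m = l")
    case False
    then have "\<tau> l \<inter> \<tau> m = {}" using assms(1) that lK by (auto simp: cells_iff)
    then show ?thesis using x le[of m] by blast
  qed (use x in simp)
  moreover have "x \<in> V" using x lK assms(1) by (auto simp: cells_iff)
  ultimately show ?thesis by blast
qed

text \<open>The faces of a cylinder cell lie in the source end, in the target end, or are cylinders
  over faces, according as \<open>\<gamma> i\<close> avoids \<open>v\<close>, equals
  \<open>{v}\<close>, or contains \<open>v\<close> and something else.\<close>

lemma face_of_add_vertex:
  assumes "\<tau> \<in> cells K V" "i \<in> K" "\<gamma> \<in> cells K UNIV" "\<gamma> \<le> add_vertex v i \<tau>"
  obtains (old) "\<gamma> \<le> \<tau>"
    | (put) \<gamma>' where "\<gamma>' \<in> cells K UNIV" "\<gamma>' \<le> \<tau>" "\<gamma> = put_vertex v i \<gamma>'"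
    | (add) \<gamma>' where "\<gamma>' \<in> cells K UNIV" "\<gamma>' \<le> \<tau>" "\<gamma> = add_vertex v i \<gamma>'"
proof -
  have le: "\<gamma> l \<subseteq> \<tau> l" if "l \<noteq> i" for l
    using le_funD[OF assms(4), of l] that by (simp add: add_vertex_def)
  have lei: "\<gamma> i \<subseteq> insert v (\<tau> i)"
    using le_funD[OF assms(4), of i] by (simp add: add_vertex_def)
  have \<tau>U: "\<tau> \<in> cells K UNIV" using assms(1) cells_mono by blast
  have ne: "\<gamma> l \<noteq> {}" "\<tau> l \<noteq> {}" if "l \<in> K" for l
    using assms(1,3) that by (auto simp: cells_iff)
  have und: "\<gamma> l = undefined" if "l \<notin> K" for l
    using assms(3) that by (auto simp: cells_iff)
  consider "v \<notin> \<gamma> i" | "\<gamma> i = {v}" | "v \<in> \<gamma> i" "\<gamma> i - {v} \<noteq> {}" by blast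
  then show thesis
  proof cases
    case 1
    then have "\<gamma> l \<subseteq> \<tau> l" for l using le[of l] lei by (cases "l = i") auto
    then show thesis by (intro old) (auto simp: le_fun_def)
  next
    case 2
    \<comment> \<open>\<open>put_vertex\<close> overwrites factor \<open>i\<close>, so any nonempty
      subset of \<open>\<tau> i\<close> could stand there.\<close>
    define \<gamma>' where "\<gamma>' = \<gamma>(i := \<tau> i)"
    have "\<gamma>' l \<subseteq> \<tau> l" for l using le[of l] by (cases "l = i") (auto simp: \<gamma>'_def)
    then have le': "\<gamma>' \<le> \<tau>" by (auto simp: le_fun_def)
    have "\<gamma>' \<in> cells K UNIV"
      by (rule cells_face[OF \<tau>U le']) (use ne und assms(2) in \<open>auto simp: \<gamma>'_def\<close>)
    moreover have "\<gamma> = put_vertex v i \<gamma>'"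
      by (simp add: \<gamma>'_def put_vertex_def fun_upd_idem[of \<gamma> i, OF 2])
    ultimately show thesis using le' by (intro put)
  next
    case 3
    define \<gamma>' where "\<gamma>' = \<gamma>(i := \<gamma> i - {v})"
    have "\<gamma>' l \<subseteq> \<tau> l" for l using le[of l] lei by (cases "l = i") (auto simp: \<gamma>'_def)
    then have le': "\<gamma>' \<le> \<tau>" by (auto simp: le_fun_def)
    have "\<gamma>' \<in> cells K UNIV"
      by (rule cells_face[OF \<tau>U le']) (use ne und assms(2) 3 in \<open>auto simp: \<gamma>'_def\<close>)
    moreover have "\<gamma> = add_vertex v i \<gamma>'"
      using 3 by (simp add: \<gamma>'_def add_vertex_def insert_absorb)
    ultimately show thesis using le' by (intro add)
  qed
qed

text \<open>By disjointness at most one factor contains \<open>v\<close>; the cases are that none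
  does, that one equals \<open>{v}\<close>, and that one contains \<open>v\<close> properly.\<close>

lemma cells_cases:
  assumes "\<sigma> \<in> cells K V"
  obtains (old) "\<sigma> \<in> cells K (V - {v})"
    | (put) i \<rho> where "i \<in> K" "\<rho> \<in> cells (K - {i}) (V - {v})" "\<sigma> = put_vertex v i \<rho>"
    | (add) i \<tau> where "i \<in> K" "\<tau> \<in> cells K (V - {v})" "\<sigma> = add_vertex v i \<tau>"
proof (cases "\<exists>i\<in>K. v \<in> \<sigma> i")
  case False
  then show thesis using assms by (intro old) (auto simp: cells_iff)
next
  case True
  then obtain i where i: "i \<in> K" "v \<in> \<sigma> i" by blast
  have disj: "v \<notin> \<sigma> l" if "l \<in> K" "l \<noteq> i" for l
  proof -
    have "\<sigma> i \<inter> \<sigma> l = {}" using assms i(1) that by (simp add: cells_iff)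
    then show ?thesis using i(2) by blast
  qed
  show thesis
  proof (cases "\<sigma> i = {v}")
    case True
    have "put_vertex v i \<sigma> = \<sigma>"
      by (simp add: put_vertex_def fun_upd_idem[of \<sigma> i, OF True])
    then show thesis
      using put_vertex_remove[OF assms i(1)] True i(1) by (intro put[of i "\<sigma>(i := undefined)"]) auto
  next
    case False
    define \<tau> where "\<tau> = \<sigma>(i := \<sigma> i - {v})"
    have "\<sigma> l \<noteq> {}" if "l \<in> K" for l using assms that by (auto simp: cells_iff)
    moreover have "\<sigma> l = undefined" if "l \<notin> K" for l using assms that by (auto simp: cells_iff)
    ultimately have "\<tau> \<in> cells K V"
      using False i by (intro cells_face[OF assms]) (auto simp: \<tau>_def le_fun_def)
    moreover have "v \<notin> \<tau> l" if "l \<in> K" for l using disj that by (auto simp: \<tau>_def)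
    ultimately have "\<tau> \<in> cells K (V - {v})" by (auto simp: cells_iff)
    moreover have "\<sigma> = add_vertex v i \<tau>"
      using i by (simp add: \<tau>_def add_vertex_def insert_absorb)
    ultimately show thesis using i by (intro add)
  qed
qed

text \<open>A factor fixed at \<open>{v}\<close> has no proper nonempty subset, so the copy of a
  cell has only the copies of its faces as faces, and the expansion carries over step by
  step.\<close>

lemma expands_put:
  assumes "expands (K - {i}) S L" "i \<in> K" "S \<subseteq> cells (K - {i}) (- {v})"
    and "L \<subseteq> cells (K - {i}) (- {v})"
    and "put_vertex v i ` S \<subseteq> M" "put_vertex v i ` (L - S) \<inter> M = {}"
  shows "expands K M (M \<union> put_vertex v i ` L)"
  using assms
proof (induction rule: expands.induct)
  case start
  then show ?case by (simp add: expands.start Un_absorb2)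
next
  case (expand L \<alpha> \<beta> w j)
  let ?f = "put_vertex v i"
  have SL: "S \<subseteq> L" using expand.hyps(1) by (rule expands_superset)
  have IH: "expands K M (M \<union> ?f ` L)"
    by (rule expand.IH) (use expand.prems in auto)
  have c: "\<alpha> \<in> cells (K - {i}) (- {v})" "\<beta> \<in> cells (K - {i}) (- {v})" "L \<subseteq> cells (K - {i}) (- {v})"
    using expand.prems by auto
  have ji: "j \<noteq> i"
    using added_vertex_factor[OF expand.hyps(2) _ expand.hyps(6)] expand.hyps(3,7) by blast
  have inj: "\<rho> = \<rho>'" if "?f \<rho> = ?f \<rho>'" "\<rho> \<in> cells (K - {i}) (- {v})" "\<rho>' \<in> cells (K - {i}) (- {v})" for \<rho> \<rho>'
    using that put_vertex_eq_iff \<open>i \<in> K\<close> by blast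
  have fc: "?f \<rho> \<in> cells K UNIV" if "\<rho> \<in> cells (K - {i}) (- {v})" for \<rho>
    using put_vertex_in_cells[of \<rho> K i UNIV v] that \<open>i \<in> K\<close> by (simp add: Compl_eq_Diff_UNIV)
  have "expands K M (insert (?f \<alpha>) (insert (?f \<beta>) (M \<union> ?f ` L)))"
  proof (rule expands.expand[OF IH])
    show "?f \<alpha> \<in> cells K UNIV" "?f \<beta> \<in> cells K UNIV" using c fc by auto
    have new: "?f \<sigma> \<notin> M \<union> ?f ` L" if "\<sigma> \<in> {\<alpha>, \<beta>}" for \<sigma>
    proof -
      have "\<sigma> \<in> insert \<alpha> (insert \<beta> L) - S" "\<sigma> \<notin> L" using that expand.hyps(4,5) SL by auto
      then have "?f \<sigma> \<notin> M" using expand.prems(5) by blast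
      moreover have "?f \<sigma> \<noteq> ?f \<rho>" if "\<rho> \<in> L" for \<rho>
        using inj[of \<sigma> \<rho>] that c \<open>\<sigma> \<in> {\<alpha>, \<beta>}\<close> \<open>\<sigma> \<notin> L\<close> by auto
      ultimately show ?thesis by blast
    qed
    show "?f \<alpha> \<notin> M \<union> ?f ` L" "?f \<beta> \<notin> M \<union> ?f ` L"
      by (simp_all only: new insertI1 insertI2 not_False_eq_True)
    show "w \<notin> ?f \<alpha> j" "?f \<beta> = (?f \<alpha>)(j := insert w (?f \<alpha> j))"
      using ji expand.hyps(6,7) by (simp_all add: put_vertex_def fun_upd_twist)
    fix \<gamma> assume \<gamma>: "\<gamma> \<in> cells K UNIV" "\<gamma> \<le> ?f \<beta>" "\<gamma> \<noteq> ?f \<alpha>" "\<gamma> \<noteq> ?f \<beta>"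
    have "\<gamma> i \<subseteq> {v}" using le_funD[OF \<gamma>(2), of i] by (simp add: put_vertex_def)
    moreover have "\<gamma> i \<noteq> {}" using \<gamma>(1) \<open>i \<in> K\<close> by (auto simp: cells_iff)
    ultimately have gi: "\<gamma> i = {v}" by auto
    define \<gamma>' where "\<gamma>' = \<gamma>(i := undefined)"
    have 1: "\<gamma> = ?f \<gamma>'" by (simp add: \<gamma>'_def put_vertex_def fun_upd_idem[of \<gamma> i, OF gi])
    have "\<gamma>' \<in> cells (K - {i}) UNIV"
      using \<gamma>(1) by (auto simp: \<gamma>'_def cells_iff)
    moreover have "\<gamma>' \<le> \<beta>"
    proof (rule le_funI)
      fix l show "\<gamma>' l \<le> \<beta> l"
        using le_funD[OF \<gamma>(2), of l] c(2) by (cases "l = i") (auto simp: \<gamma>'_def put_vertex_def cells_iff)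
    qed
    ultimately have "\<gamma>' \<in> L" using expand.hyps(8) \<gamma>(3,4) 1 by blast
    then show "\<gamma> \<in> M \<union> ?f ` L" using 1 by blast
  qed
  then show ?case by (simp only: image_insert Un_insert_right)
qed

text \<open>Each pair is attached first itself and then, for every colour, as the pair of its
  cylinders. By then the source and side faces of the cylinders are present, and their target faces
  \<open>put_vertex v i \<rho>\<close> are in \<open>M\<close> by assumption.\<close>

lemma expands_add:
  assumes "expands K S L" "finite K" "L \<subseteq> cells K (- {v})"
    and "S \<subseteq> M" "\<And>i. i \<in> K \<Longrightarrow> add_vertex v i ` S \<subseteq> M"
    and "\<And>i \<rho>. i \<in> K \<Longrightarrow> \<rho> \<in> L \<Longrightarrow> put_vertex v i \<rho> \<in> M"
    and "(L - S) \<inter> M = {}" "\<And>i. i \<in> K \<Longrightarrow> add_vertex v i ` (L - S) \<inter> M = {}"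
  shows "expands K M (M \<union> L \<union> (\<Union>i\<in>K. add_vertex v i ` L))"
  using assms
proof (induction rule: expands.induct)
  case start
  then have "M \<union> S \<union> (\<Union>i\<in>K. add_vertex v i ` S) = M" by blast
  then show ?case by (simp add: expands.start)
next
  case (expand L \<alpha> \<beta> w j)
  have SL: "S \<subseteq> L" using expand.hyps(1) by (rule expands_superset)
  define R where "R = M \<union> L \<union> (\<Union>i\<in>K. add_vertex v i ` L)"
  have IH: "expands K M R"
    unfolding R_def
  proof (rule expand.IH)
    show "(L - S) \<inter> M = {}" using expand.prems(6) by blast
    show "add_vertex v i ` (L - S) \<inter> M = {}" if "i \<in> K" for i
      using expand.prems(7)[OF that] by blast
  qed (use expand.prems(1-5) in auto)
  have c: "\<alpha> \<in> cells K (- {v})" "\<beta> \<in> cells K (- {v})" "L \<subseteq> cells K (- {v})"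
    using expand.prems by auto
  have ab: "\<alpha> \<noteq> \<beta>"
    using expand.hyps(6,7) by (metis fun_upd_same insertI1)
  have nov: "\<sigma> \<notin> cells K (- {v})" if "\<sigma> \<in> add_vertex v i ` T" "i \<in> K" for \<sigma> i T
    using that add_vertex_notin by blast
  have ac: "add_vertex v i \<sigma> \<in> cells K UNIV" if "i \<in> K" "\<sigma> \<in> cells K (- {v})" for i \<sigma>
    using add_vertex_in_cells[of \<sigma> K UNIV v i] that by (simp add: Compl_eq_Diff_UNIV)
  have notR: "\<sigma> \<notin> R" "add_vertex v i \<sigma> \<notin> R" if "\<sigma> \<in> {\<alpha>, \<beta>}" "i \<in> K" for \<sigma> i
  proof -
    have s: "\<sigma> \<in> cells K (- {v})" "\<sigma> \<notin> L" "\<sigma> \<notin> M" "add_vertex v i \<sigma> \<notin> M"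
    proof -
      show "\<sigma> \<in> cells K (- {v})" "\<sigma> \<notin> L" using that(1) c expand.hyps(4,5) by auto
      then have "\<sigma> \<in> insert \<alpha> (insert \<beta> L) - S" using that(1) SL by auto
      then show "\<sigma> \<notin> M" "add_vertex v i \<sigma> \<notin> M"
        using expand.prems(6) expand.prems(7)[OF \<open>i \<in> K\<close>] by blast+
    qed
    show "\<sigma> \<notin> R" using s nov unfolding R_def by blast
    have "add_vertex v i \<sigma> \<notin> L" using s nov c that by blast
    moreover have "add_vertex v i \<sigma> \<notin> add_vertex v l ` L" if "l \<in> K" for l
      using add_vertex_eq_iff[OF s(1) _ \<open>i \<in> K\<close> that] c(3) s(2) by blast
    ultimately show "add_vertex v i \<sigma> \<notin> R" using s unfolding R_def by blast
  qed
  \<comment> \<open>Without colours there is only one cell, hence no pair; otherwise there is a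
    colour with which to apply \<open>notR\<close>.\<close>
  show ?case
  proof (cases "K = {}")
    case True
    then have "\<alpha> = \<beta>" using c by (auto simp: cells_iff)
    then show ?thesis using ab by blast
  next
    case False
    have 1: "expands K R (insert \<alpha> (insert \<beta> R))"
      by (rule expands.expand[OF expands.start, where w = w and j = j])
         (use expand.hyps notR False in \<open>auto simp: R_def\<close>)
    have 2: "expands K (insert \<alpha> (insert \<beta> R)) (insert \<alpha> (insert \<beta> R) \<union>
        (\<lambda>i. add_vertex v i \<alpha>) ` K \<union> (\<lambda>i. add_vertex v i \<beta>) ` K)"
    proof (rule expands_family[OF \<open>finite K\<close>])
      show "inj_on (\<lambda>i. add_vertex v i \<alpha>) K" "inj_on (\<lambda>i. add_vertex v i \<beta>) K"
        using c add_vertex_eq_iff by (auto simp: inj_on_def)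
      show "(\<lambda>i. add_vertex v i \<alpha>) ` K \<inter> (\<lambda>i. add_vertex v i \<beta>) ` K = {}"
        using c ab add_vertex_eq_iff by blast
      fix i assume i: "i \<in> K"
      show "add_vertex v i \<alpha> \<in> cells K UNIV" "add_vertex v i \<beta> \<in> cells K UNIV"
        using ac i c by auto
      show "add_vertex v i \<alpha> \<notin> insert \<alpha> (insert \<beta> R)"
        using notR[of \<alpha> i] nov[of _ i "{\<alpha>}"] i c by auto
      show "add_vertex v i \<beta> \<notin> insert \<alpha> (insert \<beta> R)"
        using notR[of \<beta> i] nov[of _ i "{\<beta>}"] i c by auto
      \<comment> \<open>The vertex \<open>w\<close> occurs in \<open>\<beta>\<close>, which avoids
        \<open>v\<close>. Hence the two cylinders still differ by exactly \<open>w\<close> in factor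
        \<open>j\<close>, also when \<open>i = j\<close>.\<close>
      have "v \<noteq> w"
      proof
        assume "v = w"
        have "j \<in> K"
          using added_vertex_factor[OF expand.hyps(2) _ expand.hyps(6)] expand.hyps(3,7) by blast
        then have "v \<notin> \<beta> j" using c(2) by (auto simp: cells_iff)
        then show False using \<open>v = w\<close> expand.hyps(7) by simp
      qed
      then have "w \<notin> add_vertex v i \<alpha> j \<and>
          add_vertex v i \<beta> = (add_vertex v i \<alpha>)(j := insert w (add_vertex v i \<alpha> j))"
        using expand.hyps(6,7)
        by (cases "j = i") (simp_all add: add_vertex_def fun_upd_twist insert_commute)
      then show "\<exists>j w. w \<notin> add_vertex v i \<alpha> j \<and>
          add_vertex v i \<beta> = (add_vertex v i \<alpha>)(j := insert w (add_vertex v i \<alpha> j))"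
        by blast
      fix \<gamma> assume \<gamma>: "\<gamma> \<in> cells K UNIV" "\<gamma> \<le> add_vertex v i \<beta>"
        "\<gamma> \<noteq> add_vertex v i \<alpha>" "\<gamma> \<noteq> add_vertex v i \<beta>"
      have face: "\<gamma>' \<in> insert \<alpha> (insert \<beta> L)" if "\<gamma>' \<in> cells K UNIV" "\<gamma>' \<le> \<beta>" for \<gamma>'
        using expand.hyps(8) that by blast
      from c(2) i \<gamma>(1,2) show "\<gamma> \<in> insert \<alpha> (insert \<beta> R)"
      proof (cases rule: face_of_add_vertex)
        case old
        then show ?thesis using face \<gamma>(1) unfolding R_def by blast
      next
        case (put \<gamma>')
        then show ?thesis using face expand.prems(5)[OF i, of \<gamma>'] unfolding R_def by blast
      next
        case (add \<gamma>')
        then show ?thesis using face[of \<gamma>'] \<gamma>(3,4) i unfolding R_def by blast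
      qed
    qed
    have "insert \<alpha> (insert \<beta> R) \<union> (\<lambda>i. add_vertex v i \<alpha>) ` K \<union> (\<lambda>i. add_vertex v i \<beta>) ` K
        = M \<union> insert \<alpha> (insert \<beta> L) \<union> (\<Union>i\<in>K. add_vertex v i ` insert \<alpha> (insert \<beta> L))"
      unfolding R_def by auto
    then show ?thesis using expands_trans[OF 2 expands_trans[OF 1 IH]] by simp
  qed
qed

section \<open>Inductive construction of the subcomplex with full complement\<close>

definition vertex_cell :: "nat set \<Rightarrow> (nat \<Rightarrow> nat) \<Rightarrow> nat \<Rightarrow> nat set" where
  "vertex_cell K a = (\<lambda>i. if i \<in> K then {a i} else undefined)"

lemma vertex_cell_in_cells: "inj_on a K \<Longrightarrow> a ` K \<subseteq> V \<Longrightarrow> vertex_cell K a \<in> cells K V"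
  by (auto simp: vertex_cell_def cells_iff inj_on_def)

text \<open>With as many vertices as factors, the disjoint nonempty factors have no vertex to spare.
  This is the case of the induction in which no vertex is off the base tuple.\<close>

lemma cells_full:
  assumes "finite V" "inj_on a K" "V = a ` K" "finite K" "\<sigma> \<in> cells K V"
  shows "(\<Union>i\<in>K. \<sigma> i) = V"
proof (rule card_subset_eq[OF \<open>finite V\<close>])
  show sub: "(\<Union>i\<in>K. \<sigma> i) \<subseteq> V" using assms(5) by (auto simp: cells_iff)
  have fin: "finite (\<sigma> i)" "\<sigma> i \<noteq> {}" if "i \<in> K" for i
    using assms(1,5) that by (auto simp: cells_iff intro: finite_subset)
  have "card (\<Union>i\<in>K. \<sigma> i) = (\<Sum>i\<in>K. card (\<sigma> i))"
    by (rule card_UN_disjoint) (use assms fin in \<open>auto simp: cells_iff\<close>)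
  moreover have "(\<Sum>i\<in>K. card (\<sigma> i)) \<ge> (\<Sum>i\<in>K. 1)"
    by (rule sum_mono) (use fin in \<open>auto simp: Suc_le_eq card_gt_0_iff\<close>)
  moreover have "card V = card K" using assms by (simp add: card_image)
  ultimately show "card (\<Union>i\<in>K. \<sigma> i) = card V"
    using card_mono[OF assms(1) sub] by simp
qed

text \<open>That the omitted cells use all vertices makes the projections away from one factor avoid them.\<close>

lemma cells_expand:
  assumes "finite V" "finite K" "inj_on a K" "a ` K \<subseteq> V"
  shows "\<exists>L. expands K {vertex_cell K a} L \<and> L \<subseteq> cells K V \<and> (\<forall>\<sigma>\<in>cells K V - L. (\<Union>i\<in>K. \<sigma> i) = V)"
  using assms
proof (induction "card V" arbitrary: V K)
  case 0
  then have "K = {}" "V = {}" by auto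
  then show ?case
    by (intro exI[of _ "{vertex_cell K a}"]) (auto intro: expands.start simp: cells_iff vertex_cell_def)
next
  case (Suc n)
  let ?p = "vertex_cell K a"
  have pV: "?p \<in> cells K V" using vertex_cell_in_cells Suc.prems by blast
  show ?case
  proof (cases "V = a ` K \<or> K = {}")
    \<comment> \<open>If the base tuple takes up all vertices, every cell is full; without colours
      there is only one cell. Either way the base cell alone is a valid choice.\<close>
    case True
    then have "\<sigma> = ?p \<or> (\<Union>i\<in>K. \<sigma> i) = V" if "\<sigma> \<in> cells K V" for \<sigma>
    proof
      assume "V = a ` K"
      then have "(\<Union>i\<in>K. \<sigma> i) = V" by (rule cells_full[OF Suc.prems(1,3) _ Suc.prems(2) that])
      then show ?thesis ..
    next
      assume "K = {}"
      then show ?thesis using that by (auto simp: cells_iff vertex_cell_def)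
    qed
    then show ?thesis using pV by (intro exI[of _ "{?p}"]) (auto intro: expands.start)
  next
    case False
    \<comment> \<open>Being off the base tuple, \<open>v\<close> can be removed without losing the
      base cell \<open>?p\<close>.\<close>
    then obtain v where v: "v \<in> V" "v \<notin> a ` K" using Suc.prems by blast
    \<comment> \<open>An arbitrary colour, whose cylinders will absorb the cells on \<open>W\<close>
      omitted by \<open>L\<close>.\<close>
    obtain i0 where i0: "i0 \<in> K" using False by blast
    define W where "W = V - {v}"
    have W: "finite W" "n = card W" "a ` K \<subseteq> W" "W \<subseteq> - {v}"
      using Suc.prems Suc.hyps(2) v by (auto simp: W_def)
    have cW: "cells J W \<subseteq> cells J (- {v})" for J using cells_mono W(4) .
    have pW: "?p \<in> cells K W" using vertex_cell_in_cells Suc.prems W by blast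
    let ?q = "\<lambda>i. vertex_cell (K - {i}) a"
    have qW: "?q i \<in> cells (K - {i}) W" for i
      using Suc.prems W by (intro vertex_cell_in_cells) (auto simp: inj_on_def)
    obtain L where L: "expands K {?p} L" "L \<subseteq> cells K W"
        "\<And>\<sigma>. \<sigma> \<in> cells K W \<Longrightarrow> \<sigma> \<notin> L \<Longrightarrow> (\<Union>i\<in>K. \<sigma> i) = W"
      using Suc.hyps(1)[OF W(2,1) Suc.prems(2,3) W(3)] by (metis Diff_iff)
    have "\<forall>i. \<exists>B. expands (K - {i}) {?q i} B \<and> B \<subseteq> cells (K - {i}) W \<and>
        (\<forall>\<sigma>\<in>cells (K - {i}) W - B. (\<Union>l\<in>K - {i}. \<sigma> l) = W)"
    proof
      fix i
      have "finite (K - {i})" "inj_on a (K - {i})" "a ` (K - {i}) \<subseteq> W"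
        using Suc.prems(2,3) W(3) by (auto simp: inj_on_diff)
      then show "\<exists>B. expands (K - {i}) {?q i} B \<and> B \<subseteq> cells (K - {i}) W \<and>
          (\<forall>\<sigma>\<in>cells (K - {i}) W - B. (\<Union>l\<in>K - {i}. \<sigma> l) = W)"
        by (rule Suc.hyps(1)[OF W(2,1)])
    qed
    then obtain B where B: "\<And>i. expands (K - {i}) {?q i} (B i)" "\<And>i. B i \<subseteq> cells (K - {i}) W"
        "\<And>i \<sigma>. \<sigma> \<in> cells (K - {i}) W \<Longrightarrow> \<sigma> \<notin> B i \<Longrightarrow> (\<Union>l\<in>K - {i}. \<sigma> l) = W"
      unfolding Ball_def Diff_iff by metis
    have qB: "?q i \<in> B i" for i using expands_superset[OF B(1)] by blast
    have pL: "?p \<in> L" using expands_superset[OF L(1)] by blast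
    \<comment> \<open>The base cell for \<open>K - {i}\<close> is the projection of
      \<open>?p\<close>, so the copy of \<open>B i\<close> starts at the end of the edge that leaves
      \<open>?p\<close> in direction \<open>i\<close>.\<close>
    have qp: "put_vertex v i (?q i) = put_vertex v i ?p" for i
      by (rule ext) (simp add: put_vertex_def vertex_cell_def)
    \<comment> \<open>Forgetting factor \<open>i\<close> frees the nonempty set
      \<open>\<gamma> i\<close>. The remaining tuple is therefore not full, and the induction
      hypothesis puts it in \<open>B i\<close>.\<close>
    have putW: "put_vertex v i \<gamma> \<in> put_vertex v i ` B i"
      if "\<gamma> \<in> cells K W" "i \<in> K" for i \<gamma>
    proof -
      let ?\<rho> = "\<gamma>(i := undefined)"
      have \<rho>: "?\<rho> \<in> cells (K - {i}) (W - \<gamma> i)" "put_vertex v i ?\<rho> = put_vertex v i \<gamma>"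
        using put_vertex_remove[OF that] by auto
      have "\<gamma> i \<noteq> {}" "\<gamma> i \<subseteq> W" using that by (auto simp: cells_iff)
      then have "(\<Union>l\<in>K - {i}. ?\<rho> l) \<noteq> W" using \<rho>(1) by (auto simp: cells_iff)
      moreover have "?\<rho> \<in> cells (K - {i}) W" using \<rho>(1) cells_mono[of "W - \<gamma> i" W] by blast
      ultimately show ?thesis using B(3) \<rho>(2) by (metis imageI)
    qed
    have cU: "cells J (- {v}) \<subseteq> cells J UNIV" for J by (simp add: cells_mono)
    have acU: "add_vertex v i \<tau> \<in> cells K UNIV" if "i \<in> K" "\<tau> \<in> cells K (- {v})" for i \<tau>
      using add_vertex_in_cells[of \<tau> K UNIV v i] that by (simp add: Compl_eq_Diff_UNIV)
    have pcU: "put_vertex v i \<rho> \<in> cells K UNIV" if "i \<in> K" "\<rho> \<in> cells (K - {i}) (- {v})" for i \<rho>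
      using put_vertex_in_cells[of \<rho> K i UNIV v] that by (simp add: Compl_eq_Diff_UNIV)
    have pc: "?p \<in> cells K (- {v})" and qc: "\<And>i. ?q i \<in> cells (K - {i}) (- {v})"
      and Lc: "L \<subseteq> cells K (- {v})" and Bc: "\<And>i. B i \<subseteq> cells (K - {i}) (- {v})"
      using pW qW L(2) B(2) cW by blast+

    \<comment> \<open>One edge for each colour, from \<open>?p\<close> to its projection. The free
      face is the new endpoint \<open>put_vertex v i ?p\<close>, so the vertex distinguishing the
      pair is \<open>a i\<close> and not \<open>v\<close>.\<close>
    define M1 where "M1 = {?p} \<union> (\<lambda>i. put_vertex v i ?p) ` K \<union> (\<lambda>i. add_vertex v i ?p) ` K"
    have 1: "expands K {?p} M1"
      unfolding M1_def
    proof (rule expands_family[OF \<open>finite K\<close>])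
      show "inj_on (\<lambda>i. put_vertex v i ?p) K"
        using put_vertex_eq_iff[OF qc qc] unfolding qp inj_on_def by blast
      show "inj_on (\<lambda>i. add_vertex v i ?p) K"
        using add_vertex_eq_iff[OF pc pc] unfolding inj_on_def by blast
      show "(\<lambda>i. put_vertex v i ?p) ` K \<inter> (\<lambda>i. add_vertex v i ?p) ` K = {}"
        using add_vertex_neq_put_vertex[OF pc qc] unfolding qp by (blast dest: sym)
      fix i assume i: "i \<in> K"
      show "put_vertex v i ?p \<in> cells K UNIV" using pcU[OF i qc] by (simp add: qp)
      show "add_vertex v i ?p \<in> cells K UNIV" using acU[OF i pc] .
      show "put_vertex v i ?p \<notin> {?p}" using put_vertex_notin[OF i, of v ?p] pc by (metis singletonD)
      show "add_vertex v i ?p \<notin> {?p}" using add_vertex_notin[OF i, of v ?p] pc by (metis singletonD)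
      have "a i \<noteq> v" using i v(2) by blast
      then have "a i \<notin> put_vertex v i ?p i \<and> add_vertex v i ?p = (put_vertex v i ?p)(i := insert (a i) (put_vertex v i ?p i))"
        using i by (simp add: put_vertex_def add_vertex_def vertex_cell_def insert_commute)
      then show "\<exists>j w. w \<notin> put_vertex v i ?p j \<and>
          add_vertex v i ?p = (put_vertex v i ?p)(j := insert w (put_vertex v i ?p j))" by blast
      fix \<gamma> assume \<gamma>: "\<gamma> \<in> cells K UNIV" "\<gamma> \<le> add_vertex v i ?p"
        "\<gamma> \<noteq> put_vertex v i ?p" "\<gamma> \<noteq> add_vertex v i ?p"
      have pface: "\<gamma>' = ?p" if "\<gamma>' \<in> cells K UNIV" "\<gamma>' \<le> ?p" for \<gamma>'
      proof
        fix l show "\<gamma>' l = ?p l"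
          using le_funD[OF that(2), of l] that(1) by (auto simp: cells_iff vertex_cell_def subset_singleton_iff)
      qed
      from pc i \<gamma>(1,2) show "\<gamma> \<in> {?p}"
        by (cases rule: face_of_add_vertex) (use pface \<gamma> in auto)
    qed

    \<comment> \<open>The target ends: a copy of each \<open>B i\<close>, grown from the endpoint of
      its edge.\<close>
    define M2 where "M2 J = M1 \<union> (\<Union>i\<in>J. put_vertex v i ` B i)" for J
    have 2: "expands K M1 (M2 J)" if "finite J" "J \<subseteq> K" for J
      using that
    proof (induction J rule: finite_induct)
      case empty
      then show ?case by (simp add: M2_def expands.start)
    next
      case (insert i J)
      have iK: "i \<in> K" using insert.prems by blast
      have "expands K (M2 J) (M2 J \<union> put_vertex v i ` B i)"
      proof (rule expands_put[OF B(1) iK _ Bc])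
        show "{?q i} \<subseteq> cells (K - {i}) (- {v})" using qc by blast
        show "put_vertex v i ` {?q i} \<subseteq> M2 J" using iK by (auto simp: M2_def M1_def qp)
        have "put_vertex v i \<rho> \<notin> M2 J" if "\<rho> \<in> B i" "\<rho> \<noteq> ?q i" for \<rho>
        proof -
          have \<rho>: "\<rho> \<in> cells (K - {i}) (- {v})" using that Bc by blast
          have "put_vertex v i \<rho> \<noteq> ?p" using put_vertex_notin[OF iK] pc by metis
          moreover have "put_vertex v i \<rho> \<noteq> put_vertex v l ?p" if "l \<in> K" for l
            using put_vertex_eq_iff[OF \<rho> qc iK that] \<open>\<rho> \<noteq> ?q i\<close> by (auto simp: qp)
          moreover have "put_vertex v i \<rho> \<noteq> add_vertex v l ?p" if "l \<in> K" for l
            using add_vertex_neq_put_vertex[OF pc \<rho> that iK] by metis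
          moreover have "put_vertex v i \<rho> \<noteq> put_vertex v l \<rho>'" if "l \<in> J" "\<rho>' \<in> B l" for l \<rho>'
            using put_vertex_eq_iff[OF \<rho> _ iK, of \<rho>' l] that Bc insert.prems insert.hyps by blast
          ultimately show ?thesis unfolding M2_def M1_def by blast
        qed
        then show "put_vertex v i ` (B i - {?q i}) \<inter> M2 J = {}" by blast
      qed
      moreover have "M2 J \<union> put_vertex v i ` B i = M2 (insert i J)" by (auto simp: M2_def)
      ultimately show ?case using insert expands_trans by auto
    qed

    define M where "M = M2 K"
    have Mcases: "\<sigma> = ?p \<or> (\<exists>i\<in>K. \<exists>\<rho>\<in>B i. \<sigma> = put_vertex v i \<rho>) \<or> (\<exists>i\<in>K. \<sigma> = add_vertex v i ?p)"
      if "\<sigma> \<in> M" for \<sigma>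
      using that qB unfolding M_def M2_def M1_def by (auto simp flip: qp)
    have Mnew: "\<sigma> \<notin> M" "add_vertex v i \<sigma> \<notin> M" if "\<sigma> \<in> cells K W" "\<sigma> \<noteq> ?p" "i \<in> K" for \<sigma> i
    proof -
      have \<sigma>: "\<sigma> \<in> cells K (- {v})" using that cW by blast
      show "\<sigma> \<notin> M"
        using Mcases[of \<sigma>] that(2) \<sigma> put_vertex_notin add_vertex_notin by blast
      have "add_vertex v i \<sigma> \<noteq> ?p" using add_vertex_notin[OF that(3)] pc by metis
      moreover have "add_vertex v i \<sigma> \<noteq> put_vertex v l \<rho>" if "l \<in> K" "\<rho> \<in> B l" for l \<rho>
        using add_vertex_neq_put_vertex[OF \<sigma> _ \<open>i \<in> K\<close> that(1)] that Bc by blast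
      moreover have "add_vertex v i \<sigma> \<noteq> add_vertex v l ?p" if "l \<in> K" for l
        using add_vertex_eq_iff[OF \<sigma> pc \<open>i \<in> K\<close> that] \<open>\<sigma> \<noteq> ?p\<close> by blast
      ultimately show "add_vertex v i \<sigma> \<notin> M" using Mcases by blast
    qed
    \<comment> \<open>The cylinders over \<open>L\<close>. Their target faces are already present by
      \<open>putW\<close>, also for cells whose projections have lower dimension.\<close>
    define M3 where "M3 = M \<union> L \<union> (\<Union>i\<in>K. add_vertex v i ` L)"
    have 3: "expands K M M3"
      unfolding M3_def
    proof (rule expands_add[OF L(1) \<open>finite K\<close> Lc])
      show "{?p} \<subseteq> M" "\<And>i. i \<in> K \<Longrightarrow> add_vertex v i ` {?p} \<subseteq> M"
        unfolding M_def M2_def M1_def by blast+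
      show "put_vertex v i \<rho> \<in> M" if "i \<in> K" "\<rho> \<in> L" for i \<rho>
        using putW[of \<rho> i] that L(2) unfolding M_def M2_def by blast
      show "(L - {?p}) \<inter> M = {}" using Mnew(1) L(2) i0 by blast
      show "add_vertex v i ` (L - {?p}) \<inter> M = {}" if "i \<in> K" for i
        using Mnew(2) L(2) that by blast
    qed

    define R where "R = cells K W - L"
    have Rc: "\<tau> \<in> cells K (- {v})" if "\<tau> \<in> R" for \<tau> using that cW by (auto simp: R_def)
    have M3new: "\<tau> \<notin> M3" "add_vertex v i0 \<tau> \<notin> M3" if "\<tau> \<in> R" for \<tau>
    proof -
      have \<tau>: "\<tau> \<in> cells K W" "\<tau> \<noteq> ?p" "\<tau> \<notin> L" using that pL by (auto simp: R_def)
      show "\<tau> \<notin> M3"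
      proof
        assume "\<tau> \<in> M3"
        then obtain i \<sigma> where "i \<in> K" "\<tau> = add_vertex v i \<sigma>"
          using Mnew(1)[OF \<tau>(1,2) i0] \<tau>(3) unfolding M3_def by blast
        then show False using add_vertex_notin[of i K v \<sigma>] Rc[OF that] by simp
      qed
      have "add_vertex v i0 \<tau> \<notin> L" using add_vertex_notin[OF i0] Lc by blast
      moreover have "add_vertex v i0 \<tau> \<noteq> add_vertex v l \<sigma>" if "l \<in> K" "\<sigma> \<in> L" for l \<sigma>
        using add_vertex_eq_iff[OF Rc[OF \<open>\<tau> \<in> R\<close>] _ i0 that(1)] that Lc \<tau>(3) by blast
      ultimately show "add_vertex v i0 \<tau> \<notin> M3"
        using Mnew(2)[OF \<tau>(1,2) i0] unfolding M3_def by blast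
    qed
    \<comment> \<open>An omitted cell \<open>\<tau>\<close> enters together with its cylinder for
      colour \<open>i0\<close>, of which it is the free face: the other faces are cylinders over
      proper faces, which lie in \<open>L\<close>, and target faces, which lie in the copy of
      \<open>B i0\<close>.\<close>
    define M4 where "M4 = M3 \<union> (\<lambda>\<tau>. \<tau>) ` R \<union> add_vertex v i0 ` R"
    have 4: "expands K M3 M4"
      unfolding M4_def
    proof (rule expands_family)
      show "finite R" using finite_cells Suc.prems W by (simp add: R_def)
      show "inj_on (\<lambda>\<tau>. \<tau>) R" by simp
      show "inj_on (add_vertex v i0) R"
        using add_vertex_eq_iff[OF Rc Rc i0 i0] by (simp add: inj_on_def)
      show "(\<lambda>\<tau>. \<tau>) ` R \<inter> add_vertex v i0 ` R = {}"
        using add_vertex_notin[OF i0] Rc by blast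
      fix \<tau> assume \<tau>: "\<tau> \<in> R"
      have \<tau>W: "\<tau> \<in> cells K W" using \<tau> by (simp add: R_def)
      show "\<tau> \<in> cells K UNIV" "add_vertex v i0 \<tau> \<in> cells K UNIV"
        using Rc[OF \<tau>] cU acU[OF i0] by auto
      show "\<tau> \<notin> M3" "add_vertex v i0 \<tau> \<notin> M3" using M3new \<tau> by auto
      have "v \<notin> \<tau> i0" using Rc[OF \<tau>] i0 by (auto simp: cells_iff)
      then show "\<exists>j w. w \<notin> \<tau> j \<and> add_vertex v i0 \<tau> = \<tau>(j := insert w (\<tau> j))"
        unfolding add_vertex_def by blast
      fix \<gamma> assume \<gamma>: "\<gamma> \<in> cells K UNIV" "\<gamma> \<le> add_vertex v i0 \<tau>" "\<gamma> \<noteq> \<tau>" "\<gamma> \<noteq> add_vertex v i0 \<tau>"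
      have faceW: "\<gamma>' \<in> cells K W" if "\<gamma>' \<in> cells K UNIV" "\<gamma>' \<le> \<tau>" for \<gamma>'
        using cells_face[OF \<tau>W that(2)] that(1) by (auto simp: cells_iff)
      have faceL: "\<gamma>' \<in> L" if "\<gamma>' \<in> cells K UNIV" "\<gamma>' \<le> \<tau>" "\<gamma>' \<noteq> \<tau>" for \<gamma>'
        using L(3)[OF faceW[OF that(1,2)]] proper_face_not_full[OF \<tau>W that] by blast
      from \<tau>W i0 \<gamma>(1,2) show "\<gamma> \<in> M3"
      proof (cases rule: face_of_add_vertex)
        case old
        then show ?thesis using faceL \<gamma> by (simp add: M3_def)
      next
        case (put \<gamma>')
        then have "\<gamma> \<in> put_vertex v i0 ` B i0" using putW[OF faceW[OF put(1,2)] i0] by simp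
        then show ?thesis using i0 unfolding M3_def M_def M2_def by blast
      next
        case (add \<gamma>')
        then have "\<gamma>' \<in> L" using faceL[OF add(1,2)] \<gamma>(4) by blast
        then show ?thesis using add(3) i0 unfolding M3_def by blast
      qed
    qed
    have M4: "expands K {?p} M4"
      using 1 2[OF \<open>finite K\<close> order_refl] 3 4 expands_trans unfolding M_def by blast
    have Wv: "cells K W \<subseteq> cells K V" by (simp add: cells_mono W_def Diff_subset)
    have aV: "add_vertex v i \<tau> \<in> cells K V" if "i \<in> K" "\<tau> \<in> cells K W" for i \<tau>
      using add_vertex_in_cells that v(1) unfolding W_def by blast
    have "M4 \<subseteq> cells K V"
    proof
      fix \<sigma> assume "\<sigma> \<in> M4"
      then consider "\<sigma> \<in> cells K W" | i \<rho> where "i \<in> K" "\<rho> \<in> B i" "\<sigma> = put_vertex v i \<rho>"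
        | i \<tau> where "i \<in> K" "\<tau> \<in> cells K W" "\<sigma> = add_vertex v i \<tau>"
        unfolding M4_def M3_def R_def using Mcases pW L(2) i0 by blast
      then show "\<sigma> \<in> cells K V"
      proof cases
        case (2 i \<rho>)
        then show ?thesis using put_vertex_in_cells B(2) v(1) unfolding W_def by blast
      qed (use Wv aV in auto)
    qed
    \<comment> \<open>What is still missing comes from a cell omitted by some \<open>B i\<close> or
      by \<open>L\<close>. Such a cell uses all of \<open>W\<close>, and the new cell uses
      \<open>v\<close> in addition.\<close>
    moreover have "(\<Union>i\<in>K. \<sigma> i) = V" if "\<sigma> \<in> cells K V" "\<sigma> \<notin> M4" for \<sigma>
      using that(1)
    proof (cases rule: cells_cases[where v = v])
      case old
      then show ?thesis using that(2) by (auto simp: M4_def M3_def R_def W_def)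
    next
      case (put i \<rho>)
      then have "\<rho> \<notin> B i" using that(2) by (auto simp: M4_def M3_def M_def M2_def)
      then have "(\<Union>l\<in>K - {i}. \<rho> l) = W" using B(3) put by (simp add: W_def)
      moreover have "(\<Union>l\<in>K. \<sigma> l) = insert v (\<Union>l\<in>K - {i}. \<rho> l)"
        using put by (auto simp: put_vertex_def)
      ultimately show ?thesis using v(1) by (auto simp: W_def)
    next
      case (add i \<tau>)
      then have "\<tau> \<notin> L" using that(2) by (auto simp: M4_def M3_def)
      then have "(\<Union>l\<in>K. \<tau> l) = W" using L(3) add by (simp add: W_def)
      moreover have "(\<Union>l\<in>K. \<sigma> l) = insert v (\<Union>l\<in>K. \<tau> l)"
        using add by (auto simp: add_vertex_def split: if_splits)
      ultimately show ?thesis using v(1) by (auto simp: W_def)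
    qed
    ultimately show ?thesis using M4 by blast
  qed
qed


section \<open>Euler characteristics\<close>

definition cell_deg :: "nat set \<Rightarrow> (nat \<Rightarrow> nat set) \<Rightarrow> nat" where
  "cell_deg K \<sigma> = (\<Sum>i\<in>K. card (\<sigma> i) - 1)"

definition euler_char :: "nat set \<Rightarrow> (nat \<Rightarrow> nat set) set \<Rightarrow> int" where
  "euler_char K L = (\<Sum>\<sigma>\<in>L. (- 1) ^ cell_deg K \<sigma>)"

lemma cell_deg_upd:
  assumes "finite K" "i \<in> K"
  shows "cell_deg K (\<sigma>(i := A)) = (card A - 1) + cell_deg (K - {i}) \<sigma>"
  using assms by (simp add: cell_deg_def sum.remove[of K i])

lemma cell_deg_remove:
  assumes "finite K" "i \<in> K"
  shows "cell_deg K \<sigma> = (card (\<sigma> i) - 1) + cell_deg (K - {i}) \<sigma>"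
  using cell_deg_upd[OF assms, of \<sigma> "\<sigma> i"] by simp

lemma cell_deg_insert_vertex:
  assumes "finite K" "i \<in> K" "finite (\<sigma> i)" "\<sigma> i \<noteq> {}" "w \<notin> \<sigma> i"
  shows "cell_deg K (\<sigma>(i := insert w (\<sigma> i))) = Suc (cell_deg K \<sigma>)"
proof -
  have "card (\<sigma> i) > 0" using assms by (simp add: card_gt_0_iff)
  then show ?thesis using assms(3,5) unfolding cell_deg_upd[OF assms(1,2)] cell_deg_remove[OF assms(1,2), of \<sigma>]
    by (simp del: card_gt_0_iff)
qed

lemma cells_insert:
  assumes "v \<notin> W"
  shows "cells K (insert v W) = cells K W \<union> (\<Union>i\<in>K. add_vertex v i ` cells K W)
    \<union> (\<Union>i\<in>K. put_vertex v i ` cells (K - {i}) W)"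
proof -
  have W: "insert v W - {v} = W" using assms by blast
  have "\<sigma> \<in> cells K W \<union> (\<Union>i\<in>K. add_vertex v i ` cells K W)
    \<union> (\<Union>i\<in>K. put_vertex v i ` cells (K - {i}) W)" if "\<sigma> \<in> cells K (insert v W)" for \<sigma>
    using that by (cases rule: cells_cases[where v = v]) (auto simp: W)
  moreover have "cells K W \<subseteq> cells K (insert v W)" by (simp add: cells_mono subset_insertI)
  moreover have "add_vertex v i ` cells K W \<subseteq> cells K (insert v W)" if "i \<in> K" for i
    using add_vertex_in_cells[of _ K "insert v W" v i] that by (auto simp: W)
  moreover have "put_vertex v i ` cells (K - {i}) W \<subseteq> cells K (insert v W)" if "i \<in> K" for i
    using put_vertex_in_cells[of _ K i "insert v W" v] that by (auto simp: W)
  ultimately show ?thesis by blast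
qed

text \<open>Each old cell has \<open>card K\<close> cylinders of one dimension more, whence the
  coefficient \<open>1 - card K\<close>. The cells with a factor \<open>{v}\<close> are those for
  one colour fewer, in the same dimension.\<close>

lemma euler_char_insert:
  assumes "finite K" "finite W" "v \<notin> W"
  shows "euler_char K (cells K (insert v W)) =
    (1 - int (card K)) * euler_char K (cells K W) + (\<Sum>i\<in>K. euler_char (K - {i}) (cells (K - {i}) W))"
proof -
  have cW: "cells J W \<subseteq> cells J (- {v})" for J using assms(3) by (intro cells_mono) blast
  have fin: "finite (cells J W)" if "J \<subseteq> K" for J
    using assms that by (auto intro: finite_cells finite_subset)
  let ?A = "\<lambda>i. add_vertex v i ` cells K W" and ?P = "\<lambda>i. put_vertex v i ` cells (K - {i}) W"
  have "sum f (cells K (insert v W)) = sum f (cells K W) + (\<Sum>i\<in>K. sum f (?A i)) + (\<Sum>i\<in>K. sum f (?P i))"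
    for f :: "(nat \<Rightarrow> nat set) \<Rightarrow> int"
  proof -
    have d1: "cells K W \<inter> (\<Union>i\<in>K. ?A i) = {}"
      using cW add_vertex_notin by blast
    have d2: "(cells K W \<union> (\<Union>i\<in>K. ?A i)) \<inter> (\<Union>i\<in>K. ?P i) = {}"
    proof -
      have "put_vertex v i \<rho> \<notin> cells K W" if "i \<in> K" for i \<rho>
        using cW put_vertex_notin[OF that] by blast
      moreover have "?A i \<inter> ?P j = {}" if "i \<in> K" "j \<in> K" for i j
        using add_vertex_neq_put_vertex[OF _ _ that] cW by (fastforce simp: disjoint_iff)
      ultimately show ?thesis by blast
    qed
    have "?A i \<inter> ?A j = {}" if "i \<in> K" "j \<in> K" "i \<noteq> j" for i j
      using add_vertex_eq_iff[OF _ _ that(1,2)] cW that(3) by (fastforce simp: disjoint_iff)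
    then have sA: "sum f (\<Union>i\<in>K. ?A i) = (\<Sum>i\<in>K. sum f (?A i))"
      using assms(1) fin by (intro sum.UNION_disjoint) auto
    have "?P i \<inter> ?P j = {}" if "i \<in> K" "j \<in> K" "i \<noteq> j" for i j
      using put_vertex_eq_iff[OF _ _ that(1,2)] cW that(3) by (fastforce simp: disjoint_iff)
    then have sP: "sum f (\<Union>i\<in>K. ?P i) = (\<Sum>i\<in>K. sum f (?P i))"
      using assms(1) fin by (intro sum.UNION_disjoint) auto
    have f1: "finite (cells K W)" "finite (\<Union>i\<in>K. ?A i)" "finite (\<Union>i\<in>K. ?P i)"
      using fin assms(1) by auto
    show ?thesis
      unfolding cells_insert[OF assms(3)] using d1 d2 sA sP f1 by (simp add: sum.union_disjoint)
  qed
  moreover have "(\<Sum>\<sigma>\<in>?A i. (- 1) ^ cell_deg K \<sigma>) = - euler_char K (cells K W)" if "i \<in> K" for i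
  proof -
    have "inj_on (add_vertex v i) (cells K W)"
      using add_vertex_eq_iff[OF _ _ that that] cW by (meson inj_onI subsetD)
    moreover have "cell_deg K (add_vertex v i \<tau>) = Suc (cell_deg K \<tau>)" if "\<tau> \<in> cells K W" for \<tau>
      unfolding add_vertex_def using that assms \<open>i \<in> K\<close>
      by (intro cell_deg_insert_vertex) (auto simp: cells_iff intro: finite_subset)
    ultimately show ?thesis by (simp add: sum.reindex euler_char_def sum_negf)
  qed
  moreover have "(\<Sum>\<sigma>\<in>?P i. (- 1) ^ cell_deg K \<sigma>) = euler_char (K - {i}) (cells (K - {i}) W)" if "i \<in> K" for i
  proof -
    have "inj_on (put_vertex v i) (cells (K - {i}) W)"
      using put_vertex_eq_iff[OF _ _ that that] cW by (meson inj_onI subsetD)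
    moreover have "cell_deg K (put_vertex v i \<rho>) = cell_deg (K - {i}) \<rho>" for \<rho>
      using that assms(1) by (simp add: put_vertex_def cell_deg_upd)
    ultimately show ?thesis by (simp add: sum.reindex euler_char_def)
  qed
  ultimately show ?thesis by (simp add: euler_char_def algebra_simps)
qed

text \<open>The recursion of \<open>euler_char_insert\<close> for the closed form. It holds term by
  term: \<open>k * (k - 1 choose j) = (k - j) * (k choose j)\<close>, and
  \<open>(1 - k) + (k - j) = 1 - j\<close>. At \<open>k = 0\<close> the truncated
  \<open>k - 1\<close> is multiplied by 0.\<close>

lemma alternating_binomial_rec:
  fixes k n :: nat
  defines "E \<equiv> \<lambda>k n. \<Sum>j\<le>k. (- 1) ^ j * int (k choose j) * (1 - int j) ^ n"
  shows "E k (Suc n) = (1 - int k) * E k n + int k * E (k - 1) n"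
proof (cases k)
  case (Suc l)
  have "int k * E l n = (\<Sum>j\<le>k. (- 1) ^ j * (int k * int (l choose j)) * (1 - int j) ^ n)"
    unfolding E_def Suc by (simp add: sum_distrib_left binomial_eq_0 algebra_simps)
  moreover have "int k * int (l choose j) = (int k - int j) * int (k choose j)" if "j \<le> k" for j
  proof -
    have "(k - j) * (k choose j) = k * (l choose j)"
      using binomial_absorb_comp[of k j] Suc by simp
    then have "int ((k - j) * (k choose j)) = int (k * (l choose j))" by (simp only:)
    then show ?thesis using that by (simp only: of_nat_mult of_nat_diff)
  qed
  ultimately have *: "int k * E (k - 1) n = (\<Sum>j\<le>k. (- 1) ^ j * ((int k - int j) * int (k choose j)) * (1 - int j) ^ n)"
    using Suc by simp
  have "(1 - int k) * E k n + int k * E (k - 1) n =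
      (\<Sum>j\<le>k. (1 - int k) * ((- 1) ^ j * int (k choose j) * (1 - int j) ^ n) +
        (- 1) ^ j * ((int k - int j) * int (k choose j)) * (1 - int j) ^ n)"
    unfolding * by (simp only: E_def sum_distrib_left sum.distrib)
  also have "\<dots> = E k (Suc n)"
    unfolding E_def by (rule sum.cong) (simp_all add: algebra_simps)
  finally show ?thesis by simp
qed (simp add: E_def)

lemma euler_char_cells:
  assumes "finite V" "finite K"
  shows "euler_char K (cells K V) =
    (\<Sum>j\<le>card K. (- 1) ^ j * int (card K choose j) * (1 - int j) ^ card V)"
  using assms
proof (induction V arbitrary: K rule: finite_induct)
  case empty
  \<comment> \<open>Without vertices there is only the empty tuple if \<open>K\<close> is empty, and
    no cell otherwise. All powers have exponent 0 and equal 1, also at \<open>j = 1\<close>, so the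
    closed form is a plain alternating sum of binomials.\<close>
  show ?case
  proof (cases "K = {}")
    case True
    then have "cells K {} = {\<lambda>_. undefined}" by (auto simp: cells_iff)
    then show ?thesis using True by (simp add: euler_char_def cell_deg_def)
  next
    case False
    then have "cells K {} = {}" by (auto simp: cells_iff)
    moreover have "(\<Sum>j\<le>card K. (- 1) ^ j * int (card K choose j)) = 0"
      using choose_alternating_sum[of "card K"] False empty by (simp add: card_gt_0_iff)
    ultimately show ?thesis by (simp add: euler_char_def)
  qed
next
  case (insert v W)
  have "euler_char (K - {i}) (cells (K - {i}) W) =
      (\<Sum>j\<le>card K - 1. (- 1) ^ j * int (card K - 1 choose j) * (1 - int j) ^ card W)" if "i \<in> K" for i
    using insert.IH[of "K - {i}"] insert.prems that by simp
  then have "(\<Sum>i\<in>K. euler_char (K - {i}) (cells (K - {i}) W)) = int (card K) *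
      (\<Sum>j\<le>card K - 1. (- 1) ^ j * int (card K - 1 choose j) * (1 - int j) ^ card W)"
    by (simp only: sum_constant cong: sum.cong)
  then show ?case
    unfolding euler_char_insert[OF insert.prems insert.hyps] insert.IH[OF insert.prems]
      card_insert_disjoint[OF insert.hyps] by (simp only: alternating_binomial_rec[of "card K" "card W"])
qed

text \<open>The two cells of a pair have consecutive dimensions, so their contributions
  cancel.\<close>

lemma euler_char_expands:
  assumes "expands K S L" "L \<subseteq> cells K V" "finite K" "finite V"
  shows "euler_char K L = euler_char K S"
  using assms
proof (induction rule: expands.induct)
  case (expand L \<alpha> \<beta> w j)
  have fin: "finite L" 
    by (rule finite_subset[OF _ finite_cells[OF expand.prems(2,3)]]) (use expand.prems(1) in blast)
  have c: "\<alpha> \<in> cells K V" "\<beta> \<in> cells K V" using expand.prems(1) by blast+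
  have jK: "j \<in> K"
    using added_vertex_factor[OF expand.hyps(2) _ expand.hyps(6)] expand.hyps(3,7) by blast
  have "\<alpha> j \<noteq> {}" "finite (\<alpha> j)"
    using c jK expand.prems(3) by (auto simp: cells_iff intro: finite_subset)
  then have d: "cell_deg K \<beta> = Suc (cell_deg K \<alpha>)"
    unfolding expand.hyps(7) using expand.hyps(6) jK expand.prems(2) by (intro cell_deg_insert_vertex)
  have "\<alpha> \<noteq> \<beta>" using d by auto
  then have "euler_char K (insert \<alpha> (insert \<beta> L)) = euler_char K L"
    using expand.hyps(4,5) fin d by (simp add: euler_char_def)
  moreover have "euler_char K L = euler_char K S"
    by (rule expand.IH[OF _ expand.prems(2,3)]) (use expand.prems(1) in blast)
  ultimately show ?case by simp
qed simp

lemma cell_deg_full: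
  assumes "finite V" "finite K" "\<sigma> \<in> cells K V" "(\<Union>i\<in>K. \<sigma> i) = V"
  shows "cell_deg K \<sigma> + card K = card V"
proof -
  have fin: "finite (\<sigma> i)" "\<sigma> i \<noteq> {}" if "i \<in> K" for i
    using assms(1,3) that by (auto simp: cells_iff intro: finite_subset)
  have "card V = (\<Sum>i\<in>K. card (\<sigma> i))"
    unfolding assms(4)[symmetric] using assms fin by (intro card_UN_disjoint) (auto simp: cells_iff)
  also have "\<dots> = (\<Sum>i\<in>K. (card (\<sigma> i) - 1) + 1)"
  proof (rule sum.cong[OF refl])
    fix i assume "i \<in> K"
    then show "card (\<sigma> i) = (card (\<sigma> i) - 1) + 1"
      using fin[of i] card_gt_0_iff[of "\<sigma> i"] by linarith
  qed
  finally show ?thesis unfolding cell_deg_def by (simp only: sum.distrib) simp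
qed

text \<open>\<open>L\<close> has the Euler characteristic 1 of its base vertex and all omitted cells
  count with the same sign, so the closed form for the whole complex determines their
  number.\<close>

lemma card_full_cells:
  assumes "finite V" "finite K" "expands K {p} L" "L \<subseteq> cells K V"
    and "\<forall>\<sigma>\<in>cells K V - L. (\<Union>i\<in>K. \<sigma> i) = V" and "cell_deg K p = 0" "card K \<le> card V" "K \<noteq> {}"
  shows "int (card (cells K V - L)) =
    (\<Sum>i=0..card K. (- 1) ^ (i + card K + 1) * int (card K choose (i + 1)) * int i ^ card V)"
proof -
  let ?k = "card K" and ?N = "card V" and ?R = "cells K V - L"
  have fin: "finite (cells K V)" using assms by (simp add: finite_cells)
  have "cell_deg K \<sigma> = ?N - ?k" if "\<sigma> \<in> ?R" for \<sigma>
    using cell_deg_full[OF assms(1,2), of \<sigma>] assms(5) that by force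
  then have R: "euler_char K ?R = (- 1) ^ (?N - ?k) * int (card ?R)"
    by (simp add: euler_char_def)
  have "euler_char K L = 1"
    using euler_char_expands[OF assms(3,4,2,1)] assms(6) by (simp add: euler_char_def)
  moreover have "euler_char K (cells K V) = euler_char K L + euler_char K ?R"
    unfolding euler_char_def using fin assms(4) by (simp add: sum.subset_diff)
  ultimately have "(- 1) ^ (?N - ?k) * int (card ?R) = euler_char K (cells K V) - 1"
    using R by simp
  \<comment> \<open>The term at \<open>j = 0\<close> is the 1 contributed by
    \<open>L\<close>.\<close>
  also have "\<dots> = (\<Sum>j=1..?k. (- 1) ^ j * int (?k choose j) * (1 - int j) ^ ?N)"
    unfolding euler_char_cells[OF assms(1,2)]
    by (simp add: atMost_atLeast0 sum.atLeast_Suc_atMost)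
  also have "\<dots> = (\<Sum>i=0..<?k. (- 1) ^ (i + 1) * int (?k choose (i + 1)) * (- int i) ^ ?N)"
    by (rule sum.reindex_bij_witness[of _ Suc "\<lambda>j. j - 1"]) (auto simp: of_nat_diff)
  \<comment> \<open>After the shift \<open>j = i + 1\<close>, the additional term at
    \<open>i = ?k\<close> has binomial coefficient 0.\<close>
  also have "\<dots> = (\<Sum>i=0..?k. (- 1) ^ (i + 1) * int (?k choose (i + 1)) * (- int i) ^ ?N)"
    by (simp flip: atLeastLessThanSuc_atLeastAtMost add: binomial_eq_0)
  finally have *: "(- 1) ^ (?N - ?k) * int (card ?R) =
      (\<Sum>i=0..?k. (- 1) ^ (i + 1) * int (?k choose (i + 1)) * (- int i) ^ ?N)" .
  have "int (card ?R) = (- 1) ^ (?N - ?k) * ((- 1) ^ (?N - ?k) * int (card ?R))"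
    by (simp only: left_minus_one_mult_self)
  also have "\<dots> = (\<Sum>i=0..?k. (- 1) ^ (i + ?k + 1) * int (?k choose (i + 1)) * int i ^ ?N)"
    unfolding * sum_distrib_left
  proof (rule sum.cong[OF refl])
    fix i
    have "(- 1 :: int) ^ (?N - ?k) * (- 1) ^ ?N = (- 1) ^ ?k"
    proof -
      obtain d where "?N = ?k + d" using assms(7) le_Suc_ex by blast
      then show ?thesis by (simp add: power_add mult.left_commute)
    qed
    then have "(- 1 :: int) ^ (i + ?k + 1) = (- 1) ^ (i + 1) * ((- 1) ^ (?N - ?k) * (- 1) ^ ?N)"
      by (simp add: power_add)
    moreover have "(- int i) ^ ?N = (- 1) ^ ?N * int i ^ ?N" by (rule power_minus)
    ultimately show "(- 1) ^ (?N - ?k) * ((- 1) ^ (i + 1) * int (?k choose (i + 1)) * (- int i) ^ ?N) =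
        (- 1) ^ (i + ?k + 1) * int (?k choose (i + 1)) * int i ^ ?N"
      by (simp only: mult_ac)
  qed
  finally show ?thesis .
qed

lemma conf_euler_char_eq: "conf_euler_char k {1..n} =
    (\<Sum>j\<le>k. (- 1) ^ j * int (k choose j) * (1 - int j) ^ n)"
proof -
  have "conf_euler_char k {1..n} = euler_char {1..k} (cells {1..k} {1..n})"
    unfolding conf_euler_char_def euler_char_def cell_deg_def cell_dim_def
    by (simp only: conf_cells_eq finite_atLeastAtMost)
  then show ?thesis by (simp only: euler_char_cells finite_atLeastAtMost card_atLeastAtMost) simp
qed


section \<open>Bivariate exponential generating functions\<close>

lemma fps2_exp_neg_y: "fps2_exp (- fps2_y) = fps_const (fps_exp (- 1))"
proof (rule fps_ext, rule fps_ext)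
  fix k n
  have pow: "(- fps2_y) ^ j = fps_const ((- fps_X) ^ j)" for j
    unfolding fps2_y_def by simp
  have "fps_nth (fps_nth ((- fps2_y) ^ j) k) n = (if k = 0 \<and> n = j then (- 1) ^ j else 0)" for j
  proof -
    have "(- fps_X :: real fps) ^ j = fps_const ((- 1) ^ j) * fps_X ^ j"
      by (simp add: power_minus[of fps_X] flip: fps_const_power fps_const_neg)
    then show ?thesis by (simp add: pow fps_X_power_iff)
  qed
  then have "fps_nth (fps_nth (fps2_exp (- fps2_y)) k) n =
      (\<Sum>j\<le>k+n. (if k = 0 \<and> n = j then (- 1) ^ j else 0) / fact j)"
    by (subst fps2_exp_nth) (simp_all add: fps2_y_def)
  also have "\<dots> = (\<Sum>j\<le>k+n. if j = n then (if k = 0 then (- 1) ^ n / fact n else 0) else 0)"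
    by (rule sum.cong) auto
  also have "\<dots> = (if k = 0 then (- 1) ^ n / fact n else 0)"
    by (simp add: sum.delta)
  finally show "fps_nth (fps_nth (fps2_exp (- fps2_y)) k) n =
      fps_nth (fps_nth (fps_const (fps_exp (- 1))) k) n"
    by simp
qed

text \<open>By the binomial theorem the coefficient of \<open>x^k\<close> in
  \<open>(y + x a)^j\<close> is \<open>(j choose k) y^(j-k) a^k\<close>. Division by
  \<open>j!\<close> leaves \<open>a^k y^(j-k) / (k! (j-k)!)\<close>, and summation over
  \<open>j\<close> gives \<open>a^k e^y / k!\<close>. The series \<open>a\<close> may have a
  constant term, as it is multiplied by \<open>x\<close>.\<close>

lemma fps2_exp_y_plus_x:
  fixes a :: "real fps"
  shows "fps_nth (fps2_exp (fps2_y + fps2_x * fps_const a)) k = a ^ k * fps_exp 1 / fps_const (fact k)"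
proof (rule fps_ext)
  fix n
  let ?F = "fps2_y + fps2_x * fps_const a"
  have coeff: "fps_nth (?F ^ j) k = (if k \<le> j then of_nat (j choose k) * fps_X ^ (j - k) * a ^ k else 0)" for j
  proof -
    have nth: "fps_nth (fps_X ^ i * fps_const c) k = (if i = k then c else 0)" for i and c :: "real fps"
      by (auto simp: fps_X_power_mult_nth)
    have "?F ^ j = (\<Sum>i\<le>j. of_nat (j choose i) * (fps2_x * fps_const a) ^ i * fps2_y ^ (j - i))"
      by (subst add.commute, rule binomial_ring)
    also have "\<dots> = (\<Sum>i\<le>j. fps_X ^ i * fps_const (of_nat (j choose i) * fps_X ^ (j - i) * a ^ i))"
      by (rule sum.cong) (simp_all add: fps2_x_def fps2_y_def power_mult_distrib fps_of_nat[symmetric] algebra_simps)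
    finally have "fps_nth (?F ^ j) k =
        (\<Sum>i\<le>j. if i = k then of_nat (j choose i) * fps_X ^ (j - i) * a ^ i else 0)"
      by (simp only: fps_sum_nth nth)
    then show ?thesis by (simp add: sum.delta)
  qed
  have "fps_nth (fps_nth (fps2_exp ?F) k) n = (\<Sum>j\<le>k+n. fps_nth (fps_nth (?F ^ j) k) n / fact j)"
    by (rule fps2_exp_nth) (simp add: fps2_x_def fps2_y_def)
  also have "\<dots> = (\<Sum>j\<in>{k..k+n}. fps_nth (fps_nth (?F ^ j) k) n / fact j)"
    by (rule sum.mono_neutral_right) (auto simp: coeff)
  also have "\<dots> = (\<Sum>l\<le>n. fps_nth (fps_nth (?F ^ (k + l)) k) n / fact (k + l))"
    by (rule sum.reindex_bij_witness[of _ "\<lambda>l. k + l" "\<lambda>j. j - k"]) auto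
  also have "\<dots> = (\<Sum>l\<le>n. fps_nth (a ^ k) (n - l) / (fact k * fact l))"
  proof (rule sum.cong[OF refl])
    fix l assume "l \<in> {..n}"
    then have l: "l \<le> n" by simp
    have "fps_nth (of_nat (k + l choose k) * fps_X ^ l * a ^ k) n
        = real (k + l choose k) * fps_nth (fps_X ^ l * a ^ k) n"
      by (simp add: fps_of_nat[symmetric] mult.assoc)
    also have "\<dots> = real (k + l choose k) * fps_nth (a ^ k) (n - l)"
      using l by (simp add: fps_X_power_mult_nth)
    finally show "fps_nth (fps_nth (?F ^ (k + l)) k) n / fact (k + l) =
        fps_nth (a ^ k) (n - l) / (fact k * fact l)"
      by (simp add: coeff binomial_fact[of k "k + l"])
  qed
  also have "\<dots> = fps_nth (fps_exp 1 * a ^ k) n / fact k"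
    by (simp add: fps_mult_nth sum_divide_distrib atMost_atLeast0 mult.commute[of "fact k"])
  finally show "fps_nth (fps_nth (fps2_exp ?F) k) n = fps_nth (a ^ k * fps_exp 1 / fps_const (fact k)) n"
    by (simp add: fps_divide_unit fps_const_inverse mult.commute divide_inverse)
qed

text \<open>Expanding the power gives a combination of the exponentials \<open>e^((1-j)y)\<close>,
  whose coefficients are the powers in the closed form of the Euler characteristic.\<close>

lemma binomial_fps_exp:
  "fps_nth ((1 - fps_exp (- 1)) ^ k * fps_exp 1) n =
    (\<Sum>j\<le>k. (- 1) ^ j * real (k choose j) * (1 - real j) ^ n) / fact n"
proof -
  have "(1 - fps_exp (- 1 :: real)) ^ k = (- fps_exp (- 1) + 1) ^ k" by simp
  also have "\<dots> = (\<Sum>j\<le>k. of_nat (k choose j) * (- fps_exp (- 1)) ^ j * 1 ^ (k - j))"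
    by (rule binomial_ring)
  also have "\<dots> = (\<Sum>j\<le>k. fps_const ((- 1) ^ j * real (k choose j)) * fps_exp (- real j))"
  proof (rule sum.cong[OF refl])
    fix j
    have "(- fps_exp (- 1 :: real)) ^ j = fps_const ((- 1) ^ j) * fps_exp (- real j)"
      by (simp add: power_minus[of "fps_exp (-1)"] fps_exp_power_mult flip: fps_const_power fps_const_neg)
    then show "of_nat (k choose j) * (- fps_exp (- 1)) ^ j * 1 ^ (k - j) =
        fps_const ((- 1) ^ j * real (k choose j)) * fps_exp (- real j)"
      by (simp add: fps_of_nat[symmetric] algebra_simps flip: fps_const_mult)
  qed
  finally have "(1 - fps_exp (- 1 :: real)) ^ k * fps_exp 1 =
      (\<Sum>j\<le>k. fps_const ((- 1) ^ j * real (k choose j)) * fps_exp (1 - real j))"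
    by (simp add: sum_distrib_right mult.assoc flip: fps_exp_add_mult)
  then show ?thesis by (simp add: fps_sum_nth sum_divide_distrib)
qed


section \<open>Geometric realization\<close>

text \<open>The end of \<open>F\<close> is constant on the fibres of \<open>q\<close> and factors
  through a map \<open>g\<close> from \<open>W\<close> to \<open>X\<close>. Then \<open>F\<close>
  joins the identity to \<open>g \<circ> q\<close>, and the homotopy that \<open>F\<close> induces
  on \<open>W\<close> joins the identity to \<open>q \<circ> g\<close>.\<close>

lemma quotient_homotopy_equivalent_space:
  assumes q: "quotient_map X W q"
    and F: "continuous_map (prod_topology (top_of_set {0..1::real}) X) X F"
    and F0: "\<And>x. x \<in> topspace X \<Longrightarrow> F (0, x) = x"
    and Fq: "\<And>t x y. \<lbrakk>t \<in> {0..1}; x \<in> topspace X; y \<in> topspace X; q x = q y\<rbrakk> \<Longrightarrow> q (F (t, x)) = q (F (t, y))"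
    and F1: "\<And>x y. \<lbrakk>x \<in> topspace X; y \<in> topspace X; q x = q y\<rbrakk> \<Longrightarrow> F (1, x) = F (1, y)"
  shows "X homotopy_equivalent_space W"
proof -
  let ?I = "top_of_set {0..1::real}"
  have qc: "continuous_map X W q" using q by (rule quotient_imp_continuous_map)
  have "continuous_map X (prod_topology ?I X) (\<lambda>x. (1, x))"
    by (intro continuous_map_pairedI) auto
  then have F1c: "continuous_map X X (\<lambda>x. F (1, x))"
    using continuous_map_compose[OF _ F] by (auto simp: o_def)
  obtain g where g: "continuous_map W X g" "\<And>x. x \<in> topspace X \<Longrightarrow> g (q x) = F (1, x)"
    using quotient_map_lift_exists[OF q F1c] F1 by metis
  \<comment> \<open>The interval is locally compact and Hausdorff, so the product with it is again a
    quotient map; this lets \<open>F\<close> descend to \<open>W\<close>.\<close>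
  have qI: "quotient_map (prod_topology ?I X) (prod_topology ?I W) (\<lambda>(t, x). (t, q x))"
    by (rule quotient_map_prod_right[OF _ _ q])
       (auto intro!: compact_imp_locally_compact_space simp: Hausdorff_space_subtopology compact_space_subtopology)
  have qF: "continuous_map (prod_topology ?I X) W (q \<circ> F)"
    using F qc by (rule continuous_map_compose)
  obtain G where G: "continuous_map (prod_topology ?I W) W G"
    "\<And>z. z \<in> topspace (prod_topology ?I X) \<Longrightarrow> G ((\<lambda>(t, x). (t, q x)) z) = (q \<circ> F) z"
  proof (rule quotient_map_lift_exists[OF qI qF])
    fix y z assume "y \<in> topspace (prod_topology ?I X)" "z \<in> topspace (prod_topology ?I X)"
      "(\<lambda>(t, x). (t, q x)) y = (\<lambda>(t, x). (t, q x)) z"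
    then show "(q \<circ> F) y = (q \<circ> F) z"
      using Fq[of "fst y" "snd y" "snd z"] by (cases y, cases z) (simp add: o_def)
  qed (use that in blast)
  have surj: "\<exists>x\<in>topspace X. w = q x" if "w \<in> topspace W" for w
    using quotient_imp_surjective_map[OF q] that by auto
  have "homotopic_with (\<lambda>x. True) W W id (q \<circ> g)"
    unfolding homotopic_with[where P = "\<lambda>_. True", OF refl]
  proof (intro exI[of _ G] conjI ballI)
    show "continuous_map (prod_topology ?I W) W G" by (rule G)
    show "G (0, w) = id w" if "w \<in> topspace W" for w
      using surj[OF that] G(2)[of "(0, _)"] F0 by auto
    show "G (1, w) = (q \<circ> g) w" if "w \<in> topspace W" for w
      using surj[OF that] G(2)[of "(1, _)"] g(2) by auto
  qed auto
  moreover have "homotopic_with (\<lambda>x. True) X X id (g \<circ> q)"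
    unfolding homotopic_with[where P = "\<lambda>_. True", OF refl]
    using F F0 g(2) by (intro exI[of _ F]) auto
  ultimately have "homotopic_with (\<lambda>x. True) X X (g \<circ> q) id" "homotopic_with (\<lambda>x. True) W W (q \<circ> g) id"
    by (simp_all add: homotopic_with_symD)
  then show ?thesis
    unfolding homotopy_equivalent_space_def using qc g(1) by blast
qed

section \<open>Points, cells and subcomplexes in the euclidean function space\<close>

definition product_cell :: "nat set \<Rightarrow> (nat \<Rightarrow> nat set) \<Rightarrow> (nat \<Rightarrow> nat \<Rightarrow> real) set" where
  "product_cell K \<sigma> = (\<Pi>\<^sub>E i\<in>K. open_face (\<sigma> i))"

definition closed_cell :: "nat set \<Rightarrow> (nat \<Rightarrow> nat set) \<Rightarrow> (nat \<Rightarrow> nat \<Rightarrow> real) set" where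
  "closed_cell K \<sigma> = (\<Pi>\<^sub>E i\<in>K. closed_face (\<sigma> i))"

definition realization :: "nat set \<Rightarrow> (nat \<Rightarrow> nat set) set \<Rightarrow> (nat \<Rightarrow> nat \<Rightarrow> real) set" where
  "realization K L = (\<Union>\<sigma>\<in>L. product_cell K \<sigma>)"

text \<open>The supports of the factors: for a point of the realization, the unique cell whose open
  product cell contains it.\<close>

definition carrier_cell :: "nat set \<Rightarrow> (nat \<Rightarrow> nat \<Rightarrow> real) \<Rightarrow> nat \<Rightarrow> nat set" where
  "carrier_cell K x = (\<lambda>i. if i \<in> K then {v. x i v \<noteq> 0} else undefined)"

lemma closed_cell_iff:
  "x \<in> closed_cell K \<sigma> \<longleftrightarrow> (\<forall>i\<in>K. (\<forall>v. 0 \<le> x i v) \<and> (\<forall>v. v \<notin> \<sigma> i \<longrightarrow> x i v = 0) \<and> (\<Sum>v\<in>\<sigma> i. x i v) = 1)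
    \<and> (\<forall>i. i \<notin> K \<longrightarrow> x i = undefined)"
proof -
  have "(\<forall>v\<in>S. 0 \<le> y v) \<and> (\<forall>v. v \<notin> S \<longrightarrow> y v = 0) \<and> Q \<longleftrightarrow>
      (\<forall>v. 0 \<le> y v) \<and> (\<forall>v. v \<notin> S \<longrightarrow> y v = 0) \<and> Q" for S :: "nat set" and y :: "nat \<Rightarrow> real" and Q
    by (metis order_refl)
  then show ?thesis
    unfolding closed_cell_def closed_face_def PiE_iff extensional_def by simp
qed

lemma product_cell_iff:
  "x \<in> product_cell K \<sigma> \<longleftrightarrow> x \<in> closed_cell K \<sigma> \<and> (\<forall>i\<in>K. \<forall>v\<in>\<sigma> i. 0 < x i v)"
  unfolding closed_cell_def product_cell_def closed_face_def open_face_def PiE_iff mem_Collect_eq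
  using less_imp_le by blast

lemma carrier_product_cell:
  assumes "x \<in> product_cell K \<sigma>" "\<sigma> \<in> cells K V"
  shows "carrier_cell K x = \<sigma>"
proof
  fix i show "carrier_cell K x i = \<sigma> i"
  proof (cases "i \<in> K")
    case True
    then have "{v. x i v \<noteq> 0} = \<sigma> i"
      using assms(1) unfolding product_cell_iff closed_cell_iff by force
    then show ?thesis using True by (simp add: carrier_cell_def)
  next
    case False
    then show ?thesis using assms(2) by (simp add: carrier_cell_def cells_iff)
  qed
qed

lemma carrier_closed_cell:
  assumes "x \<in> closed_cell K \<sigma>" "\<sigma> \<in> cells K V" "finite V"
  shows "carrier_cell K x \<in> cells K V" "carrier_cell K x \<le> \<sigma>" "x \<in> product_cell K (carrier_cell K x)"
proof -
  have x: "\<And>v. 0 \<le> x i v" "\<And>v. v \<notin> \<sigma> i \<Longrightarrow> x i v = 0" "(\<Sum>v\<in>\<sigma> i. x i v) = 1" if "i \<in> K" for i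
    using assms(1) that unfolding closed_cell_iff by auto
  have fin: "finite (\<sigma> i)" if "i \<in> K" for i
    using assms(2,3) that by (auto simp: cells_iff intro: finite_subset)
  have sub: "{v. x i v \<noteq> 0} \<subseteq> \<sigma> i" if "i \<in> K" for i using x(2)[OF that] by blast
  show le: "carrier_cell K x \<le> \<sigma>"
  proof (rule le_funI)
    fix i show "carrier_cell K x i \<le> \<sigma> i"
      using sub[of i] assms(2) by (cases "i \<in> K") (auto simp: carrier_cell_def cells_iff)
  qed
  have ne: "{v. x i v \<noteq> 0} \<noteq> {}" if "i \<in> K" for i
  proof
    assume "{v. x i v \<noteq> 0} = {}"
    then have "(\<Sum>v\<in>\<sigma> i. x i v) = 0" by (intro sum.neutral) auto
    then show False using x(3)[OF that] by simp
  qed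
  show "carrier_cell K x \<in> cells K V"
    by (rule cells_face[OF assms(2) le]) (use ne in \<open>auto simp: carrier_cell_def\<close>)
  have "(\<Sum>v\<in>{v. x i v \<noteq> 0}. x i v) = 1" if "i \<in> K" for i
    using sum.mono_neutral_left[OF fin[OF that] sub[OF that], of "x i"] x(3)[OF that] by simp
  then show "x \<in> product_cell K (carrier_cell K x)"
    unfolding product_cell_iff closed_cell_iff
    using assms(1) x(1) by (auto simp: carrier_cell_def closed_cell_iff less_le)
qed

lemma product_cell_face:
  assumes "\<gamma> \<le> \<sigma>" "\<sigma> \<in> cells K V" "finite V"
  shows "product_cell K \<gamma> \<subseteq> closed_cell K \<sigma>"
proof
  fix x assume "x \<in> product_cell K \<gamma>"
  then have x: "\<And>v. 0 \<le> x i v" "\<And>v. v \<notin> \<gamma> i \<Longrightarrow> x i v = 0" "(\<Sum>v\<in>\<gamma> i. x i v) = 1" if "i \<in> K" for i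
    using that unfolding product_cell_iff closed_cell_iff by auto
  have und: "x i = undefined" if "i \<notin> K" for i
    using \<open>x \<in> product_cell K \<gamma>\<close> that unfolding product_cell_iff closed_cell_iff by auto
  have fin: "finite (\<sigma> i)" if "i \<in> K" for i
    using assms(2,3) that by (auto simp: cells_iff intro: finite_subset)
  have sub: "\<gamma> i \<subseteq> \<sigma> i" for i using le_funD[OF assms(1), of i] by simp
  have "(\<Sum>v\<in>\<sigma> i. x i v) = 1" if "i \<in> K" for i
    using sum.mono_neutral_left[OF fin[OF that] sub, of "x i"] x(2,3)[OF that] by auto
  then show "x \<in> closed_cell K \<sigma>"
    unfolding closed_cell_iff using x und sub by blast
qed

lemma closed_cell_eq:
  assumes "\<sigma> \<in> cells K V" "finite V"
  shows "closed_cell K \<sigma> = realization K {\<gamma> \<in> cells K UNIV. \<gamma> \<le> \<sigma>}"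
proof
  show "closed_cell K \<sigma> \<subseteq> realization K {\<gamma> \<in> cells K UNIV. \<gamma> \<le> \<sigma>}"
    using carrier_closed_cell[OF _ assms] cells_mono[of V UNIV K] unfolding realization_def by blast
  show "realization K {\<gamma> \<in> cells K UNIV. \<gamma> \<le> \<sigma>} \<subseteq> closed_cell K \<sigma>"
    using product_cell_face[OF _ assms] unfolding realization_def by blast
qed

lemma continuous_on_coord:
  fixes f :: "'a::topological_space \<Rightarrow> nat \<Rightarrow> nat \<Rightarrow> real"
  assumes "continuous_on S f"
  shows "continuous_on S (\<lambda>x. f x i v)"
  using continuous_on_product_then_coordinatewise[OF continuous_on_product_then_coordinatewise[OF assms]] .

lemmas continuous_on_coords [continuous_intros] =
  continuous_on_coord[OF continuous_on_id] continuous_on_coord[OF continuous_on_snd[OF continuous_on_id]]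

lemma compact_closed_cell:
  assumes "\<sigma> \<in> cells K V" "finite V"
  shows "compact (closed_cell K \<sigma>)"
proof -
  \<comment> \<open>A product of compact sets over all coordinates, with singletons at the colours
    outside \<open>K\<close>. The closed cell is cut out of it by closed conditions.\<close>
  define D :: "(nat \<Rightarrow> nat \<Rightarrow> real) set" where "D = {x. \<forall>i. \<forall>v. x i v \<in> (if i \<in> K then {0..1} else {undefined v :: real})}"
  have "compactin (product_topology (\<lambda>_. euclidean) UNIV)
      (\<Pi>\<^sub>E i\<in>UNIV. {y. \<forall>v. y v \<in> (if i \<in> K then {0..1} else {undefined v :: real})})"
  proof (subst compactin_PiE, intro disjI2 ballI)
    fix i
    have "compactin (product_topology (\<lambda>_. euclidean) UNIV)
      (\<Pi>\<^sub>E v\<in>UNIV. (if i \<in> K then {0..1} else {undefined v :: real}))"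
      by (subst compactin_PiE) auto
    then show "compactin euclidean {y. \<forall>v. y v \<in> (if i \<in> K then {0..1} else {undefined v :: real})}"
      unfolding euclidean_product_topology by (simp add: PiE_UNIV_domain Pi_def)
  qed
  then have "compact D"
    unfolding euclidean_product_topology D_def by (simp add: PiE_UNIV_domain Pi_def)
  moreover have "closed {x :: nat \<Rightarrow> nat \<Rightarrow> real. \<forall>i\<in>K. (\<forall>v. 0 \<le> x i v) \<and> (\<forall>v. v \<notin> \<sigma> i \<longrightarrow> x i v = 0) \<and> (\<Sum>v\<in>\<sigma> i. x i v) = 1}"
    unfolding Ball_def
    by (intro closed_Collect_all closed_Collect_imp closed_Collect_conj closed_Collect_le closed_Collect_eq
        continuous_intros) auto
  moreover have "closed_cell K \<sigma> = D \<inter>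
      {x. \<forall>i\<in>K. (\<forall>v. 0 \<le> x i v) \<and> (\<forall>v. v \<notin> \<sigma> i \<longrightarrow> x i v = 0) \<and> (\<Sum>v\<in>\<sigma> i. x i v) = 1}"
    (is "_ = D \<inter> ?E")
  proof -
    have inD: "x \<in> D" if x: "x \<in> closed_cell K \<sigma>" for x
    proof -
      have "x i v \<le> 1" if "i \<in> K" for i v
      proof (cases "v \<in> \<sigma> i")
        case True
        have "finite (\<sigma> i)" using assms that by (auto simp: cells_iff intro: finite_subset)
        then have "x i v \<le> (\<Sum>v\<in>\<sigma> i. x i v)"
          using True x that by (intro member_le_sum) (auto simp: closed_cell_iff)
        then show ?thesis using x that by (simp add: closed_cell_iff)
      qed (use x that in \<open>auto simp: closed_cell_iff\<close>)
      then show ?thesis using x by (auto simp: D_def closed_cell_iff)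
    qed
    have und: "x i = undefined" if "x \<in> D" "i \<notin> K" for x i
    proof (rule ext)
      fix v
      have "x i v \<in> (if i \<in> K then {0..1} else {undefined v})"
        using that(1) unfolding D_def by blast
      then show "x i v = undefined v" using that(2) by simp
    qed
    show ?thesis
    proof (rule set_eqI)
      fix x
      have "x \<in> closed_cell K \<sigma> \<longleftrightarrow> x \<in> ?E \<and> (\<forall>i. i \<notin> K \<longrightarrow> x i = undefined)"
        by (simp only: closed_cell_iff mem_Collect_eq)
      then show "x \<in> closed_cell K \<sigma> \<longleftrightarrow> x \<in> D \<inter> ?E" using inD[of x] und[of x] by blast
    qed
  qed
  ultimately show ?thesis by (simp add: compact_Int_closed)
qed

definition subcomplex :: "nat set \<Rightarrow> nat set \<Rightarrow> (nat \<Rightarrow> nat set) set \<Rightarrow> bool" where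
  "subcomplex K V L \<longleftrightarrow> finite K \<and> finite V \<and> L \<subseteq> cells K V \<and> (\<forall>\<sigma>\<in>L. \<forall>\<gamma>\<in>cells K UNIV. \<gamma> \<le> \<sigma> \<longrightarrow> \<gamma> \<in> L)"

lemma realization_eq_closed:
  assumes "subcomplex K V L"
  shows "realization K L = (\<Union>\<sigma>\<in>L. closed_cell K \<sigma>)"
proof
  show "realization K L \<subseteq> (\<Union>\<sigma>\<in>L. closed_cell K \<sigma>)"
    unfolding realization_def using product_cell_iff by blast
  have "closed_cell K \<sigma> \<subseteq> realization K L" if "\<sigma> \<in> L" for \<sigma>
  proof -
    have "closed_cell K \<sigma> = realization K {\<gamma> \<in> cells K UNIV. \<gamma> \<le> \<sigma>}"
      using assms that unfolding subcomplex_def by (intro closed_cell_eq[of \<sigma> K V]) auto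
    moreover have "{\<gamma> \<in> cells K UNIV. \<gamma> \<le> \<sigma>} \<subseteq> L"
      using assms that unfolding subcomplex_def by blast
    ultimately show ?thesis unfolding realization_def by blast
  qed
  then show "(\<Union>\<sigma>\<in>L. closed_cell K \<sigma>) \<subseteq> realization K L" by blast
qed

lemma subcomplex_cells:
  assumes "finite K" "finite V"
  shows "subcomplex K V (cells K V)"
  using assms cells_face by (auto simp: subcomplex_def cells_iff)

lemma realization_cells_decomp:
  assumes L: "subcomplex K V L"
  shows "realization K (cells K V) = realization K L \<union> (\<Union>\<sigma>\<in>cells K V - L. closed_cell K \<sigma>)"
proof -
  have fin: "finite K" "finite V" "L \<subseteq> cells K V" using L by (auto simp: subcomplex_def)
  have "realization K (cells K V) = (\<Union>\<sigma>\<in>L \<union> (cells K V - L). closed_cell K \<sigma>)"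
    unfolding realization_eq_closed[OF subcomplex_cells[OF fin(1,2)]] using fin(3) by (simp add: Un_absorb1)
  then show ?thesis unfolding realization_eq_closed[OF L] by blast
qed

lemma finite_subcomplex: "subcomplex K V L \<Longrightarrow> finite L"
  unfolding subcomplex_def using finite_cells[of K V] finite_subset[of L "cells K V"] by simp

lemma compact_realization:
  assumes "subcomplex K V L"
  shows "compact (realization K L)"
  unfolding realization_eq_closed[OF assms]
proof (intro compact_UN finite_subcomplex[OF assms])
  fix \<sigma> assume "\<sigma> \<in> L"
  then show "compact (closed_cell K \<sigma>)"
    using assms unfolding subcomplex_def by (intro compact_closed_cell[of \<sigma> K V]) auto
qed

lemma carrier_realization:
  "L \<subseteq> cells K V \<Longrightarrow> x \<in> realization K L \<Longrightarrow> carrier_cell K x \<in> L"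
  unfolding realization_def using carrier_product_cell by blast

text \<open>The space is defined with the product topology over \<open>{1..k}\<close>, whereas the
  proof uses the euclidean topology on all functions. Tuples are extensional, so the further
  coordinates are constant and the topologies agree.\<close>

lemma disc_conf_space_eq:
  assumes "finite V"
  shows "disc_conf_space k V = top_of_set (realization {1..k} (cells {1..k} V))"
proof -
  let ?S = "realization {1..k} (cells {1..k} V)"
  have S: "(\<Union>\<sigma>\<in>conf_cells k V. open_cell k \<sigma>) = ?S"
    unfolding conf_cells_eq[OF assms] realization_def product_cell_def open_cell_def ..
  let ?T = "product_topology (\<lambda>_. powertop_real UNIV) {1..k} :: (nat \<Rightarrow> nat \<Rightarrow> real) topology"
  have ext: "?S \<subseteq> (\<Pi>\<^sub>E i\<in>{1..k}. UNIV)"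
    unfolding realization_def product_cell_def by (auto simp: PiE_iff)
  have "continuous_map (subtopology ?T ?S) euclidean (\<lambda>x. x)"
  proof -
    have "continuous_map (subtopology ?T ?S) euclideanreal (\<lambda>x. x i v)" for i v
    proof (cases "i \<in> {1..k}")
      case True
      have "continuous_map ?T (powertop_real UNIV) (\<lambda>x. x i)"
        using True by (rule continuous_map_product_projection)
      then have "continuous_map ?T euclideanreal (\<lambda>x. x i v)"
        using continuous_map_compose[OF _ continuous_map_product_projection[of v UNIV "\<lambda>_. euclideanreal"], of ?T "\<lambda>x. x i"]
        unfolding o_def by blast
      then show ?thesis by (rule continuous_map_from_subtopology)
    next
      case False
      then have "x i v = undefined v" if "x \<in> ?S" for x
        using ext that by (auto simp: PiE_iff extensional_def)
      then have "undefined v = x i v" if "x \<in> topspace (subtopology ?T ?S)" for x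
        using that by auto
      moreover have "continuous_map (subtopology ?T ?S) euclideanreal (\<lambda>x. undefined v)" by simp
      ultimately show ?thesis by (rule continuous_map_eq[rotated])
    qed
    then have "continuous_map (subtopology ?T ?S) (powertop_real UNIV) (\<lambda>x. x i)" for i
      by (simp add: continuous_map_componentwise_UNIV)
    then have "continuous_map (subtopology ?T ?S) (product_topology (\<lambda>_. powertop_real UNIV) UNIV) (\<lambda>x. x)"
      by (simp add: continuous_map_componentwise_UNIV)
    then show ?thesis by (simp add: euclidean_product_topology)
  qed
  moreover have "continuous_on ?S (\<lambda>x. x i)" for i
    by (rule continuous_on_product_then_coordinatewise[OF continuous_on_id])
  then have "continuous_map (top_of_set ?S) ?T (\<lambda>x. x)"
    using ext
    by (simp add: continuous_map_componentwise euclidean_product_topology PiE_iff subset_iff)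
  ultimately have "homeomorphic_maps (subtopology ?T ?S) (top_of_set ?S) id id"
    using ext by (auto simp: homeomorphic_maps_def continuous_map_in_subtopology id_def)
  then have "subtopology ?T ?S = top_of_set ?S"
    by (simp add: homeomorphic_maps_id)
  then show ?thesis unfolding disc_conf_space_def S .
qed

section \<open>Elementary expansions as deformation retractions\<close>

lemma attach_deformation_homotopy_equivalent:
  fixes A D :: "'a::topological_space set" and H :: "real \<times> 'a \<Rightarrow> 'a"
  assumes "closed A" "closed D" and H: "continuous_on ({0..1} \<times> D) H"
    and H0: "\<And>x. x \<in> D \<Longrightarrow> H (0, x) = x"
    and HD: "\<And>s x. s \<in> {0..1} \<Longrightarrow> x \<in> D \<Longrightarrow> H (s, x) \<in> D"
    and H1: "\<And>x. x \<in> D \<Longrightarrow> H (1, x) \<in> A"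
    and HA: "\<And>s x. s \<in> {0..1} \<Longrightarrow> x \<in> A \<Longrightarrow> x \<in> D \<Longrightarrow> H (s, x) = x"
  shows "top_of_set (A \<union> D) homotopy_equivalent_space top_of_set A"
proof (rule deformation_retract_imp_homotopy_equivalent_space)
  \<comment> \<open>\<open>H\<close> on \<open>D\<close> and the identity on \<open>A\<close>; they
    agree on the overlap, where \<open>H\<close> is stationary.\<close>
  define G where "G = (\<lambda>z. if snd z \<in> D then H z else snd z)"
  have "continuous_on ({0..1} \<times> D \<union> {0..1} \<times> A) G"
    unfolding G_def
    by (rule continuous_on_cases) (use assms in \<open>auto intro: closed_Times continuous_on_snd\<close>)
  moreover have "{0..1::real} \<times> D \<union> {0..1} \<times> A = {0..1} \<times> (A \<union> D)" by auto
  ultimately have G: "continuous_on ({0..1} \<times> (A \<union> D)) G" by (simp only:)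
  define r where "r = (\<lambda>x. G (1, x))"
  have GX: "G (s, x) \<in> A \<union> D" if "s \<in> {0..1}" "x \<in> A \<union> D" for s x
    using that HD by (auto simp: G_def)
  have "continuous_on (A \<union> D) (\<lambda>x. G (1, x))"
    by (rule continuous_on_compose2[OF G]) (auto intro!: continuous_intros)
  then have r: "continuous_on (A \<union> D) r" by (simp add: r_def)
  have rA: "r x \<in> A" if "x \<in> A \<union> D" for x using that H1 by (auto simp: r_def G_def)
  have ri: "r x = x" if "x \<in> A" for x using that HA by (auto simp: r_def G_def)
  show "retraction_maps (top_of_set (A \<union> D)) (top_of_set A) r id"
    using r rA ri by (auto simp: retraction_maps_def continuous_map_in_subtopology)
  have "homotopic_with (\<lambda>x. True) (top_of_set (A \<union> D)) (top_of_set (A \<union> D)) id r"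
    unfolding homotopic_with[where P = "\<lambda>_. True", OF refl]
  proof (intro exI[of _ G] conjI ballI)
    show "continuous_map (prod_topology (top_of_set {0..1}) (top_of_set (A \<union> D))) (top_of_set (A \<union> D)) G"
    proof -
      have "G z \<in> A \<union> D" if "z \<in> {0..1} \<times> (A \<union> D)" for z
        using GX[of "fst z" "snd z"] that by (simp add: mem_Times_iff)
      then have "G \<in> {0..1} \<times> (A \<union> D) \<rightarrow> A \<union> D" by (rule Pi_I)
      then show ?thesis
        using G by (simp add: prod_topology_subtopology_eu continuous_map_subtopology_eu)
    qed
  qed (auto simp: r_def G_def H0)
  then show "homotopic_with (\<lambda>x. True) (top_of_set (A \<union> D)) (top_of_set (A \<union> D)) r id"
    by (rule homotopic_with_symD)
qed

lemma continuous_on_Min_image: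
  fixes f :: "'i \<Rightarrow> 'a::topological_space \<Rightarrow> real"
  assumes "finite I" "I \<noteq> {}" "\<And>i. i \<in> I \<Longrightarrow> continuous_on S (f i)"
  shows "continuous_on S (\<lambda>x. Min ((\<lambda>i. f i x) ` I))"
  using assms by (induction I rule: finite_ne_induct) (auto intro!: continuous_on_min)

lemma subcomplex_insert_pair:
  assumes "subcomplex K V L" "\<alpha> \<in> cells K V" "\<beta> \<in> cells K V" "\<alpha> \<le> \<beta>"
    and "\<And>\<gamma>. \<gamma> \<in> cells K UNIV \<Longrightarrow> \<gamma> \<le> \<beta> \<Longrightarrow> \<gamma> \<noteq> \<alpha> \<Longrightarrow> \<gamma> \<noteq> \<beta> \<Longrightarrow> \<gamma> \<in> L"
  shows "subcomplex K V (insert \<alpha> (insert \<beta> L))"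
  using assms order_trans unfolding subcomplex_def by (metis insert_iff insert_subset)

text \<open>Mass is withdrawn evenly from the vertices of \<open>\<alpha>\<close> until one of these
  coordinates vanishes. In factor \<open>j\<close> it is moved to \<open>w\<close>; in the other
  factors the rest is rescaled to sum 1. The final support lacks a vertex of
  \<open>\<alpha>\<close>, so it is a face of \<open>\<beta>\<close> other than
  \<open>\<alpha>\<close> and \<open>\<beta>\<close>, and lies in \<open>L\<close>.\<close>

lemma realization_expand:
  assumes L: "subcomplex K V L" and \<alpha>: "\<alpha> \<in> cells K V" "\<alpha> \<notin> L" and \<beta>: "\<beta> \<in> cells K V" "\<beta> \<notin> L"
    and w: "w \<notin> \<alpha> j" "\<beta> = \<alpha>(j := insert w (\<alpha> j))"
    and faces: "\<And>\<gamma>. \<gamma> \<in> cells K UNIV \<Longrightarrow> \<gamma> \<le> \<beta> \<Longrightarrow> \<gamma> \<noteq> \<alpha> \<Longrightarrow> \<gamma> \<noteq> \<beta> \<Longrightarrow> \<gamma> \<in> L"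
  shows "top_of_set (realization K (insert \<alpha> (insert \<beta> L))) homotopy_equivalent_space top_of_set (realization K L)"
proof -
  define A where "A = realization K L"
  define D where "D = closed_cell K \<beta>"
  have fin: "finite K" "finite V" and LV: "L \<subseteq> cells K V" using L by (auto simp: subcomplex_def)
  have cA: "closed A" using compact_realization[OF L] by (simp add: A_def compact_imp_closed)
  have cD: "closed D" using compact_closed_cell[OF \<beta>(1) fin(2)] by (simp add: D_def compact_imp_closed)
  have \<alpha>\<beta>: "\<alpha> \<le> \<beta>" using w(2) by (auto simp: le_fun_def)
  have jK: "j \<in> K"
    using added_vertex_factor[OF \<alpha>(1) _ w(1)] \<beta>(1) w(2) by blast
  have X: "realization K (insert \<alpha> (insert \<beta> L)) = A \<union> D"
  proof
    have "product_cell K \<alpha> \<subseteq> D" unfolding D_def by (rule product_cell_face[OF \<alpha>\<beta> \<beta>(1) fin(2)])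
    moreover have "product_cell K \<beta> \<subseteq> D" unfolding D_def by (rule product_cell_face[OF order_refl \<beta>(1) fin(2)])
    ultimately show "realization K (insert \<alpha> (insert \<beta> L)) \<subseteq> A \<union> D"
      unfolding A_def realization_def by blast
    have "D \<subseteq> realization K (insert \<alpha> (insert \<beta> L))"
      unfolding D_def closed_cell_eq[OF \<beta>(1) fin(2)] realization_def using faces by blast
    then show "A \<union> D \<subseteq> realization K (insert \<alpha> (insert \<beta> L))"
      unfolding A_def realization_def by blast
  qed
  have fb: "finite (\<beta> i)" "finite (\<alpha> i)" if "i \<in> K" for i
    using \<alpha>(1) \<beta>(1) that by (auto simp: cells_iff intro!: finite_subset[OF _ fin(2)])
  \<comment> \<open>At least twice the size of every factor, so that the denominators in
    \<open>H\<close> stay above 1/2 while \<open>t\<close> is at most 1. The summand 1 makes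
    \<open>M\<close> positive.\<close>
  define M where "M = 2 * real (card V) + 1"
  have M: "0 < M" by (simp add: M_def)
  have cM: "2 * real (card (\<beta> i)) \<le> M" if "i \<in> K" for i
  proof -
    have "card (\<beta> i) \<le> card V" using \<beta>(1) fin(2) that by (intro card_mono) (auto simp: cells_iff)
    then show ?thesis by (simp add: M_def)
  qed
  define I where "I = Sigma K \<alpha>"
  obtain v0 where v0: "v0 \<in> \<alpha> j" using \<alpha>(1) jK unfolding cells_iff by blast
  have I: "finite I" "I \<noteq> {}"
    using fin(1) fb(2) v0 jK by (auto simp: I_def)
  \<comment> \<open>\<open>H\<close> subtracts up to \<open>t\<close> in factor \<open>j\<close> and
    up to \<open>t / M\<close> in the others. With these weights \<open>t\<close> is the largest
    amount that keeps all those differences nonnegative, and some coordinate then reaches 0.\<close>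
  define c where "c i = (if i = j then 1 else M)" for i
  define t where "t x = Min ((\<lambda>p. c (fst p) * x (fst p) (snd p)) ` I)" for x :: "nat \<Rightarrow> nat \<Rightarrow> real"
  have t_cont: "continuous_on S (\<lambda>z. t (snd z))" for S :: "(real \<times> (nat \<Rightarrow> nat \<Rightarrow> real)) set"
    unfolding t_def by (rule continuous_on_Min_image[OF I]) (intro continuous_intros)
  have t_le: "t x \<le> c i * x i v" if "i \<in> K" "v \<in> \<alpha> i" for x i v
    unfolding t_def using I that by (intro Min_le) (force simp: I_def)+
  have t_attained: "\<exists>i\<in>K. \<exists>v\<in>\<alpha> i. t x = c i * x i v" for x
  proof -
    have "t x \<in> (\<lambda>p. c (fst p) * x (fst p) (snd p)) ` I"
      unfolding t_def using I by (intro Min_in) auto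
    then obtain i v where "i \<in> K" "v \<in> \<alpha> i" "t x = c i * x i v" by (auto simp: I_def)
    then show ?thesis by blast
  qed
  have c0: "c i > 0" for i using M by (simp add: c_def)
  have xD: "0 \<le> x i v" "v \<notin> \<beta> i \<Longrightarrow> x i v = 0" "(\<Sum>v\<in>\<beta> i. x i v) = 1" if "x \<in> D" "i \<in> K" for x i v
    using that unfolding D_def closed_cell_iff by auto
  have t0: "0 \<le> t x" if "x \<in> D" for x
    using t_attained[of x] xD(1)[OF that] c0 by (metis mult_nonneg_nonneg less_imp_le)
  have t1: "t x \<le> 1" if "x \<in> D" for x
  proof -
    have "x j v0 \<le> (\<Sum>v\<in>\<beta> j. x j v)"
      using v0 w(2) fb(1)[OF jK] xD(1)[OF that jK] by (intro member_le_sum) auto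
    then show ?thesis using t_le[OF jK v0, of x] xD(3)[OF that jK] by (simp add: c_def)
  qed
  \<comment> \<open>If \<open>t\<close> were positive, the support would contain all of
    \<open>\<alpha>\<close>. No cell lies strictly between \<open>\<alpha>\<close> and
    \<open>\<beta>\<close>, so the carrier would be one of these two, and neither is in
    \<open>L\<close>.\<close>
  have tA: "t x = 0" if "x \<in> A" "x \<in> D" for x
  proof (rule ccontr)
    assume "t x \<noteq> 0"
    then have pos: "x i v > 0" if "i \<in> K" "v \<in> \<alpha> i" for i v
      using t0[OF \<open>x \<in> D\<close>] t_le[OF that, of x] c0[of i] by (smt (verit) mult_nonneg_nonpos)
    let ?\<gamma> = "carrier_cell K x"
    have g: "?\<gamma> \<in> L" "?\<gamma> \<le> \<beta>"
      using carrier_realization[OF LV, of x] carrier_closed_cell(2)[OF _ \<beta>(1) fin(2), of x] that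
      by (auto simp: A_def D_def)
    have sub: "\<alpha> i \<subseteq> ?\<gamma> i" if "i \<in> K" for i
      using pos[OF that] that by (fastforce simp: carrier_cell_def)
    have eq: "?\<gamma> i = \<alpha> i" if "i \<noteq> j" for i
    proof (cases "i \<in> K")
      case True
      then show ?thesis using sub[OF True] le_funD[OF g(2), of i] w(2) that by auto
    next
      case False
      then show ?thesis using \<alpha>(1) by (simp add: carrier_cell_def cells_iff)
    qed
    have "?\<gamma> j = \<alpha> j \<or> ?\<gamma> j = \<beta> j"
      using sub[OF jK] le_funD[OF g(2), of j] w by auto
    then have "?\<gamma> = \<alpha> \<or> ?\<gamma> = \<beta>"
      using eq w(2) by (auto simp: fun_eq_iff) (metis)+
    then show False using g(1) \<alpha>(2) \<beta>(2) by auto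
  qed
  define H where "H z = (\<lambda>i v. if i \<notin> K \<or> v \<notin> \<beta> i then snd z i v
      else if i = j then (if v = w then snd z i v + fst z * t (snd z) * card (\<alpha> j) else snd z i v - fst z * t (snd z))
      else (snd z i v - fst z * t (snd z) / M) / (1 - fst z * t (snd z) * card (\<beta> i) / M))"
    for z :: "real \<times> (nat \<Rightarrow> nat \<Rightarrow> real)"
  have den: "1 - s * t x * card (\<beta> i) / M \<ge> 1 / 2" if "s \<in> {0..1}" "x \<in> D" "i \<in> K" for s x i
  proof -
    have "s * t x \<le> 1" using that t0[OF that(2)] t1[OF that(2)] by (simp add: mult_le_one)
    then have "s * t x * card (\<beta> i) \<le> 1 * real (card (\<beta> i))" by (intro mult_right_mono) auto
    also have "\<dots> \<le> M / 2" using cM[OF that(3)] by simp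
    finally show ?thesis using M by (simp add: field_simps)
  qed
  have st: "s * t x \<le> c i * x i v" "0 \<le> s * t x" if "s \<in> {0..1}" "x \<in> D" "i \<in> K" "v \<in> \<alpha> i" for s x i v
  proof -
    have "s * t x \<le> 1 * t x" using that t0[OF that(2)] by (intro mult_right_mono) auto
    then show "s * t x \<le> c i * x i v" using t_le[OF that(3,4), of x] by simp
    show "0 \<le> s * t x" using that t0[OF that(2)] by simp
  qed
  have H: "continuous_on ({0..1} \<times> D) H"
  proof (intro continuous_on_coordinatewise_then_product)
    fix i v
    consider "i \<notin> K \<or> v \<notin> \<beta> i" | "i \<in> K" "v \<in> \<beta> i" "i = j" "v = w" | "i \<in> K" "v \<in> \<beta> i" "i = j" "v \<noteq> w"
      | "i \<in> K" "v \<in> \<beta> i" "i \<noteq> j" by blast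
    then show "continuous_on ({0..1} \<times> D) (\<lambda>z. H z i v)"
    proof cases
      case 4
      have "1 - fst z * t (snd z) * card (\<beta> i) / M \<noteq> 0" if "z \<in> {0..1} \<times> D" for z
        using den[of "fst z" "snd z" i] that 4(1) by auto
      then show ?thesis using 4 M by (auto simp: H_def intro!: continuous_intros t_cont)
    qed (auto simp: H_def intro!: continuous_intros t_cont)
  qed
  have HD: "H (s, x) \<in> D" if "s \<in> {0..1}" "x \<in> D" for s x
    unfolding D_def closed_cell_iff
  proof (intro conjI ballI allI impI)
    fix i v assume i: "i \<in> K"
    show "0 \<le> H (s, x) i v"
    proof (cases "v \<in> \<beta> i")
      case v: True
      show ?thesis
      proof (cases "i = j")
        case True
        show ?thesis
        proof (cases "v = w")
          case vw: True
          have "0 \<le> s * t x" using st(2) that jK v0 by blast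
          then show ?thesis using i v xD(1)[OF that(2) i, of v] True vw by (simp add: H_def)
        next
          case False
          then have "v \<in> \<alpha> j" using v True w(2) by simp
          then show ?thesis using st(1)[OF that jK, of v] i v True False by (simp add: H_def c_def)
        qed
      next
        case False
        then have "v \<in> \<alpha> i" using v w(2) by simp
        then have "s * t x / M \<le> x i v"
          using st(1)[OF that i, of v] False M by (simp add: c_def field_simps)
        then have "0 \<le> (x i v - s * t x / M) / (1 - s * t x * card (\<beta> i) / M)"
          using den[OF that i] by (intro divide_nonneg_nonneg) linarith+
        then show ?thesis using i v False by (simp add: H_def)
      qed
    qed (use i xD(1)[OF that(2) i] in \<open>simp add: H_def\<close>)
    show "H (s, x) i v = 0" if "v \<notin> \<beta> i"
      using that xD(2)[OF \<open>x \<in> D\<close> i] by (simp add: H_def)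
    show "(\<Sum>v\<in>\<beta> i. H (s, x) i v) = 1"
    proof (cases "i = j")
      case True
      have bj: "\<beta> j = insert w (\<alpha> j)" using w(2) by simp
      have "(\<Sum>v\<in>\<alpha> j. H (s, x) j v) = (\<Sum>v\<in>\<alpha> j. x j v - s * t x)"
        using w jK by (intro sum.cong refl) (auto simp: H_def)
      moreover have "H (s, x) j w = x j w + s * t x * card (\<alpha> j)"
        using jK bj by (simp add: H_def)
      moreover have "x j w + (\<Sum>v\<in>\<alpha> j. x j v) = 1"
        using xD(3)[OF that(2) jK] fb(2)[OF jK] w(1) bj by simp
      ultimately show ?thesis
        using True fb(2)[OF jK] w(1) bj by (simp add: sum_subtractf algebra_simps)
    next
      case False
      let ?d = "1 - s * t x * card (\<beta> i) / M"
      have "(\<Sum>v\<in>\<beta> i. H (s, x) i v) = (\<Sum>v\<in>\<beta> i. (x i v - s * t x / M) / ?d)"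
        using i False by (intro sum.cong refl) (auto simp: H_def)
      also have "\<dots> = (\<Sum>v\<in>\<beta> i. x i v - s * t x / M) / ?d"
        by (rule sum_divide_distrib[symmetric])
      also have "(\<Sum>v\<in>\<beta> i. x i v - s * t x / M) = ?d"
        using xD(3)[OF that(2) i] by (simp add: sum_subtractf)
      also have "?d / ?d = 1"
        using den[OF that i] by (intro divide_self) linarith
      finally show ?thesis .
    qed
  next
    fix i assume "i \<notin> K"
    then show "H (s, x) i = undefined"
      using that(2) by (simp add: H_def D_def closed_cell_iff)
  qed
  have H1: "H (1, x) \<in> A" if "x \<in> D" for x
  proof -
    obtain i v where iv: "i \<in> K" "v \<in> \<alpha> i" "t x = c i * x i v" using t_attained[of x] by blast
    have "v \<noteq> w" if "i = j" using iv(2) w(1) that by blast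
    then have zero: "H (1, x) i v = 0"
      using iv w(2) M by (auto simp: H_def c_def)
    have y: "H (1, x) \<in> D" using HD[of 1 x] that by simp
    let ?\<gamma> = "carrier_cell K (H (1, x))"
    have g: "?\<gamma> \<in> cells K V" "?\<gamma> \<le> \<beta>" "H (1, x) \<in> product_cell K ?\<gamma>"
      using carrier_closed_cell[OF _ \<beta>(1) fin(2)] y by (auto simp: D_def)
    have "v \<notin> ?\<gamma> i" using zero iv(1) by (simp add: carrier_cell_def)
    moreover have "v \<in> \<beta> i" using iv(2) le_funD[OF \<alpha>\<beta>, of i] by blast
    ultimately have "?\<gamma> \<noteq> \<alpha>" "?\<gamma> \<noteq> \<beta>" using iv(2) by metis+
    moreover have "?\<gamma> \<in> cells K UNIV" using g(1) cells_mono[of V UNIV K] by blast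
    ultimately have "?\<gamma> \<in> L" using faces g(2) by blast
    then show ?thesis using g(3) unfolding A_def realization_def by blast
  qed
  have H_id: "H (s, x) = x" if "s = 0 \<or> t x = 0" for s x
    using that by (intro ext) (auto simp: H_def)
  show ?thesis
    unfolding X A_def[symmetric]
    by (rule attach_deformation_homotopy_equivalent[OF cA cD H]) (use HD H1 H_id tA in auto)
qed

lemma contractible_realization_expands:
  assumes "expands K S L" "subcomplex K V S" "L \<subseteq> cells K V" "contractible (realization K S)"
  shows "subcomplex K V L \<and> contractible (realization K L)"
  using assms
proof (induction rule: expands.induct)
  case (expand L \<alpha> \<beta> w j)
  have IH: "subcomplex K V L" "contractible (realization K L)"
    using expand.IH expand.prems by auto
  have c: "\<alpha> \<in> cells K V" "\<beta> \<in> cells K V" using expand.prems(2) by auto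
  have le: "\<alpha> \<le> \<beta>" unfolding expand.hyps(7) by (auto simp: le_fun_def)
  have "top_of_set (realization K (insert \<alpha> (insert \<beta> L))) homotopy_equivalent_space top_of_set (realization K L)"
    by (rule realization_expand[OF IH(1) c(1) expand.hyps(4) c(2) expand.hyps(5-8)])
  then have "contractible (realization K (insert \<alpha> (insert \<beta> L)))"
    using homotopy_equivalent_space_contractibility IH(2) by fastforce
  moreover have "subcomplex K V (insert \<alpha> (insert \<beta> L))"
    by (rule subcomplex_insert_pair[OF IH(1) c le expand.hyps(8)])
  ultimately show ?case by blast
qed simp


section \<open>Extending homotopies over cells\<close>

text \<open>A gauge on a closed product cell: \<open>0\<close> on the boundary, \<open>1\<close> at the barycenter, and affine on the
  rays from the barycenter, about which \<open>dilate\<close> scales.\<close>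

definition depth :: "nat set \<Rightarrow> (nat \<Rightarrow> nat set) \<Rightarrow> (nat \<Rightarrow> nat \<Rightarrow> real) \<Rightarrow> real" where
  "depth K \<sigma> x = Min ((\<lambda>p. real (card (\<sigma> (fst p))) * x (fst p) (snd p)) ` Sigma K \<sigma>)"

definition dilate :: "nat set \<Rightarrow> (nat \<Rightarrow> nat set) \<Rightarrow> real \<Rightarrow> (nat \<Rightarrow> nat \<Rightarrow> real) \<Rightarrow> nat \<Rightarrow> nat \<Rightarrow> real" where
  "dilate K \<sigma> r x = (\<lambda>i v. if i \<in> K \<and> v \<in> \<sigma> i then 1 / real (card (\<sigma> i)) + r * (x i v - 1 / real (card (\<sigma> i))) else x i v)"

context
  fixes K V :: "nat set" and \<sigma> :: "nat \<Rightarrow> nat set"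
  assumes \<sigma>: "\<sigma> \<in> cells K V" and finV: "finite V" and finK: "finite K" and K: "K \<noteq> {}"
begin

lemma card_factor_pos: "i \<in> K \<Longrightarrow> 0 < card (\<sigma> i)"
  using \<sigma> finite_subset[OF _ finV] by (auto simp: cells_iff card_gt_0_iff)

lemma finite_factor: "i \<in> K \<Longrightarrow> finite (\<sigma> i)"
  using card_factor_pos by (simp add: card_gt_0_iff)

lemma Sigma_factors: "finite (Sigma K \<sigma>)" "Sigma K \<sigma> \<noteq> {}"
proof -
  show "finite (Sigma K \<sigma>)" using finK finite_factor by auto
  obtain i where "i \<in> K" using K by blast
  moreover have "\<sigma> i \<noteq> {}" using card_factor_pos[OF \<open>i \<in> K\<close>] by auto
  ultimately show "Sigma K \<sigma> \<noteq> {}" by auto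
qed

lemma depth_le: "i \<in> K \<Longrightarrow> v \<in> \<sigma> i \<Longrightarrow> depth K \<sigma> x \<le> real (card (\<sigma> i)) * x i v"
  unfolding depth_def using Sigma_factors by (intro Min_le) force+

lemma depth_attained: obtains i v where "i \<in> K" "v \<in> \<sigma> i" "depth K \<sigma> x = real (card (\<sigma> i)) * x i v"
proof -
  have "depth K \<sigma> x \<in> (\<lambda>p. real (card (\<sigma> (fst p))) * x (fst p) (snd p)) ` Sigma K \<sigma>"
    unfolding depth_def using Sigma_factors by (intro Min_in) auto
  then show thesis using that by auto
qed

lemma continuous_on_depth: "continuous_on S (depth K \<sigma>)"
  unfolding depth_def by (intro continuous_on_Min_image Sigma_factors continuous_intros)

lemma depth_nonneg: "x \<in> closed_cell K \<sigma> \<Longrightarrow> 0 \<le> depth K \<sigma> x"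
  by (rule depth_attained[of x]) (auto simp: closed_cell_iff)

text \<open>The affine hull of the cell, where coordinates and depth may be negative. Points outside
  the cell occur when a point of the sphere is pulled back, before a dilation brings them
  inside.\<close>

definition affine_cell :: "(nat \<Rightarrow> nat \<Rightarrow> real) set" where
  "affine_cell = {x. (\<forall>i\<in>K. (\<forall>v. v \<notin> \<sigma> i \<longrightarrow> x i v = 0) \<and> (\<Sum>v\<in>\<sigma> i. x i v) = 1)
    \<and> (\<forall>i. i \<notin> K \<longrightarrow> x i = undefined)}"

lemma closed_cell_affine: "closed_cell K \<sigma> \<subseteq> affine_cell"
  by (auto simp: closed_cell_iff affine_cell_def)

text \<open>Within a factor the numbers \<open>card (\<sigma> i) * x i v\<close> have average 1, so
  their minimum is at most 1.\<close>

lemma depth_le_1: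
  assumes "x \<in> affine_cell"
  shows "depth K \<sigma> x \<le> 1"
proof -
  obtain i where i: "i \<in> K" using K by blast
  have "(\<Sum>v\<in>\<sigma> i. depth K \<sigma> x) \<le> (\<Sum>v\<in>\<sigma> i. real (card (\<sigma> i)) * x i v)"
    using depth_le[OF i] by (intro sum_mono) auto
  also have "\<dots> = real (card (\<sigma> i))"
    using assms i by (simp add: affine_cell_def flip: sum_distrib_left)
  finally show ?thesis using card_factor_pos[OF i] by simp
qed

lemma depth_pos_iff:
  assumes "x \<in> closed_cell K \<sigma>"
  shows "0 < depth K \<sigma> x \<longleftrightarrow> x \<in> product_cell K \<sigma>"
proof
  assume d: "0 < depth K \<sigma> x"
  have "0 < x i v" if "i \<in> K" "v \<in> \<sigma> i" for i v
    using depth_le[OF that, of x] d card_factor_pos[OF that(1)] by (smt (verit) mult_nonneg_nonpos of_nat_0_le_iff)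
  then show "x \<in> product_cell K \<sigma>" using assms by (simp add: product_cell_iff)
next
  assume p: "x \<in> product_cell K \<sigma>"
  obtain i v where "i \<in> K" "v \<in> \<sigma> i" "depth K \<sigma> x = real (card (\<sigma> i)) * x i v"
    by (rule depth_attained)
  then show "0 < depth K \<sigma> x" using p card_factor_pos[of i] by (simp add: product_cell_iff)
qed

lemma depth_eq_0: "x \<in> closed_cell K \<sigma> \<Longrightarrow> x \<notin> product_cell K \<sigma> \<Longrightarrow> depth K \<sigma> x = 0"
  using depth_pos_iff depth_nonneg by force

lemma dilate_1: "dilate K \<sigma> 1 x = x"
  by (intro ext) (simp add: dilate_def)

lemma card_times_dilate:
  assumes "i \<in> K" "v \<in> \<sigma> i"
  shows "real (card (\<sigma> i)) * dilate K \<sigma> r x i v = 1 + r * (real (card (\<sigma> i)) * x i v - 1)"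
  using card_factor_pos[OF assms(1)] assms by (simp add: dilate_def field_simps)

text \<open>On coordinates scaled by the factor size, a dilation is one and the same affine map,
  nondecreasing since \<open>r\<close> is nonnegative, and so it commutes with the minimum.\<close>

lemma depth_dilate:
  assumes "0 \<le> r"
  shows "depth K \<sigma> (dilate K \<sigma> r x) = 1 + r * (depth K \<sigma> x - 1)"
proof (rule antisym)
  obtain i v where iv: "i \<in> K" "v \<in> \<sigma> i" "depth K \<sigma> x = real (card (\<sigma> i)) * x i v"
    by (rule depth_attained)
  show "depth K \<sigma> (dilate K \<sigma> r x) \<le> 1 + r * (depth K \<sigma> x - 1)"
    using depth_le[OF iv(1,2), of "dilate K \<sigma> r x"] card_times_dilate[OF iv(1,2), of r x] iv(3) by simp
  obtain i v where iv: "i \<in> K" "v \<in> \<sigma> i"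
      "depth K \<sigma> (dilate K \<sigma> r x) = real (card (\<sigma> i)) * dilate K \<sigma> r x i v"
    by (rule depth_attained)
  have "r * (depth K \<sigma> x - 1) \<le> r * (real (card (\<sigma> i)) * x i v - 1)"
    using depth_le[OF iv(1,2), of x] assms by (intro mult_left_mono) auto
  then show "1 + r * (depth K \<sigma> x - 1) \<le> depth K \<sigma> (dilate K \<sigma> r x)"
    unfolding iv(3) card_times_dilate[OF iv(1,2)] by simp
qed

text \<open>The second bound on \<open>r\<close> says that the depth after the dilation is
  nonnegative, hence every coordinate is.\<close>

lemma dilate_closed_cell:
  assumes x: "x \<in> affine_cell" and r: "0 \<le> r" "r * (1 - depth K \<sigma> x) \<le> 1"
  shows "dilate K \<sigma> r x \<in> closed_cell K \<sigma>"
  unfolding closed_cell_iff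
proof (intro conjI ballI allI impI)
  fix i v assume i: "i \<in> K"
  show "0 \<le> dilate K \<sigma> r x i v"
  proof (cases "v \<in> \<sigma> i")
    case True
    have "r * (depth K \<sigma> x - 1) \<le> r * (real (card (\<sigma> i)) * x i v - 1)"
      using depth_le[OF i True, of x] r(1) by (intro mult_left_mono) auto
    then have "0 \<le> real (card (\<sigma> i)) * dilate K \<sigma> r x i v"
      unfolding card_times_dilate[OF i True] using r(2) by (simp add: algebra_simps)
    then show ?thesis using card_factor_pos[OF i] by (simp add: zero_le_mult_iff)
  qed (use x i in \<open>simp add: dilate_def affine_cell_def\<close>)
  show "dilate K \<sigma> r x i v = 0" if "v \<notin> \<sigma> i"
    using x i that by (simp add: dilate_def affine_cell_def)
  have "(\<Sum>v\<in>\<sigma> i. dilate K \<sigma> r x i v) = (\<Sum>v\<in>\<sigma> i. 1 / real (card (\<sigma> i)) + r * (x i v - 1 / real (card (\<sigma> i))))"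
    using i by (intro sum.cong refl) (simp add: dilate_def)
  also have "\<dots> = 1 + r * ((\<Sum>v\<in>\<sigma> i. x i v) - 1)"
    using card_factor_pos[OF i] by (simp add: sum.distrib sum_subtractf flip: sum_distrib_left)
  finally show "(\<Sum>v\<in>\<sigma> i. dilate K \<sigma> r x i v) = 1"
    using x i by (simp add: affine_cell_def)
qed (use x in \<open>auto simp: dilate_def affine_cell_def\<close>)

lemma dilate_boundary:
  assumes "r * (1 - depth K \<sigma> x) = 1"
  shows "dilate K \<sigma> r x \<notin> product_cell K \<sigma>"
proof -
  obtain i v where iv: "i \<in> K" "v \<in> \<sigma> i" "depth K \<sigma> x = real (card (\<sigma> i)) * x i v"
    by (rule depth_attained)
  have "real (card (\<sigma> i)) * dilate K \<sigma> r x i v = 0"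
    unfolding card_times_dilate[OF iv(1,2)] iv(3)[symmetric] using assms by (simp add: algebra_simps)
  then have "dilate K \<sigma> r x i v = 0" using card_factor_pos[OF iv(1)] by simp
  then show ?thesis using iv by (force simp: product_cell_iff)
qed

lemma continuous_on_dilate:
  assumes "continuous_on S f" "continuous_on S g"
  shows "continuous_on S (\<lambda>z. dilate K \<sigma> (f z) (g z))"
proof (intro continuous_on_coordinatewise_then_product)
  fix i v
  show "continuous_on S (\<lambda>z. dilate K \<sigma> (f z) (g z) i v)"
    using assms continuous_on_coord[OF assms(2)]
    by (cases "i \<in> K \<and> v \<in> \<sigma> i") (auto simp: dilate_def intro!: continuous_intros)
qed

text \<open>At time \<open>t\<close> the cell is blown up by the factor \<open>1 + t\<close>; what leaves the cell is projected to the
  boundary and moved along by \<open>H\<close>.\<close>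

definition cell_homotopy ::
    "(real \<times> (nat \<Rightarrow> nat \<Rightarrow> real) \<Rightarrow> nat \<Rightarrow> nat \<Rightarrow> real) \<Rightarrow> real \<times> (nat \<Rightarrow> nat \<Rightarrow> real) \<Rightarrow> nat \<Rightarrow> nat \<Rightarrow> real" where
  "cell_homotopy H z = (let g = 1 - depth K \<sigma> (snd z) in
     if (1 + fst z) * g \<le> 1 then dilate K \<sigma> (1 + fst z) (snd z)
     else H ((1 + fst z) * g - 1, dilate K \<sigma> (1 / g) (snd z)))"

text \<open>Where \<open>(1 + t) * g = 1\<close> both branches give the radial projection to the
  boundary, because \<open>H\<close> starts at the identity. On the boundary \<open>g = 1\<close>,
  so the dilation is trivial and \<open>H\<close> runs at its own time \<open>t\<close>.\<close>

lemma cell_homotopy: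
  assumes C: "\<And>x. x \<in> closed_cell K \<sigma> \<Longrightarrow> x \<notin> product_cell K \<sigma> \<Longrightarrow> x \<in> C"
    and H: "continuous_on ({0..1} \<times> C) H" and H0: "\<And>x. x \<in> C \<Longrightarrow> H (0, x) = x"
    and HC: "\<And>s x. s \<in> {0..1} \<Longrightarrow> x \<in> C \<Longrightarrow> H (s, x) \<in> C"
  shows "continuous_on ({0..1} \<times> closed_cell K \<sigma>) (cell_homotopy H)"
    and "\<And>x. x \<in> closed_cell K \<sigma> \<Longrightarrow> cell_homotopy H (0, x) = x"
    and "\<And>s x. s \<in> {0..1} \<Longrightarrow> x \<in> closed_cell K \<sigma> \<Longrightarrow> x \<notin> product_cell K \<sigma> \<Longrightarrow> cell_homotopy H (s, x) = H (s, x)"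
    and "\<And>s x. s \<in> {0..1} \<Longrightarrow> x \<in> closed_cell K \<sigma> \<Longrightarrow> cell_homotopy H (s, x) \<in> closed_cell K \<sigma> \<union> C"
proof -
  let ?D = "closed_cell K \<sigma>"
  define g where "g z = 1 - depth K \<sigma> (snd z)" for z :: "real \<times> (nat \<Rightarrow> nat \<Rightarrow> real)"
  have g01: "0 \<le> g z" "g z \<le> 1" if "z \<in> {0..1} \<times> ?D" for z
    using that depth_nonneg depth_le_1 closed_cell_affine by (auto simp: g_def)
  have g_cont: "continuous_on S g" for S
    unfolding g_def
    by (intro continuous_intros continuous_on_compose2[OF continuous_on_depth[of UNIV]]) auto
  have proj: "dilate K \<sigma> (1 / g z) (snd z) \<in> C" "(1 + fst z) * g z - 1 \<in> {0..1}" "g z > 0"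
    if "z \<in> {0..1} \<times> ?D" "1 \<le> (1 + fst z) * g z" for z
  proof -
    have fz: "0 \<le> fst z" "fst z \<le> 1" "snd z \<in> ?D" using that(1) by auto
    show gz: "g z > 0"
      using that g01(1)[OF that(1)] by (smt (verit) mult_eq_0_iff)
    then have 1: "1 / g z * (1 - depth K \<sigma> (snd z)) = 1" by (simp add: g_def)
    have "dilate K \<sigma> (1 / g z) (snd z) \<in> ?D"
      using fz gz 1 closed_cell_affine by (intro dilate_closed_cell) auto
    then show "dilate K \<sigma> (1 / g z) (snd z) \<in> C" using C dilate_boundary[OF 1] by blast
    \<comment> \<open>Time and \<open>g\<close> are at most 1; this keeps the time passed to
      \<open>H\<close> in the unit interval.\<close>
    have "(1 + fst z) * g z \<le> 2 * 1"
      using fz g01[OF that(1)] by (intro mult_mono) auto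
    then show "(1 + fst z) * g z - 1 \<in> {0..1}" using that(2) by simp
  qed
  have eq: "cell_homotopy H = (\<lambda>z. if (1 + fst z) * g z \<le> 1 then dilate K \<sigma> (1 + fst z) (snd z)
      else H ((1 + fst z) * g z - 1, dilate K \<sigma> (1 / g z) (snd z)))"
    by (simp add: cell_homotopy_def g_def Let_def fun_eq_iff)
  show "continuous_on ({0..1} \<times> ?D) (cell_homotopy H)"
    unfolding eq
  proof (rule continuous_on_cases_le)
    show "continuous_on {z \<in> {0..1} \<times> ?D. (1 + fst z) * g z \<le> 1} (\<lambda>z. dilate K \<sigma> (1 + fst z) (snd z))"
      by (intro continuous_on_dilate continuous_intros)
    let ?S = "{z \<in> {0..1} \<times> ?D. 1 \<le> (1 + fst z) * g z}"
    have "g z \<noteq> 0" if "z \<in> ?S" for z using proj(3) that by force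
    then show "continuous_on ?S (\<lambda>z. H ((1 + fst z) * g z - 1, dilate K \<sigma> (1 / g z) (snd z)))"
      using proj(1,2)
      by (intro continuous_on_compose2[OF H] continuous_intros continuous_on_dilate g_cont) auto
    show "continuous_on ({0..1} \<times> ?D) (\<lambda>z. (1 + fst z) * g z)"
      by (intro continuous_intros g_cont)
    fix z assume z: "z \<in> {0..1} \<times> ?D" "(1 + fst z) * g z = 1"
    then have "g z > 0" using proj(3)[OF z(1)] by simp
    then have "1 + fst z = 1 / g z" using z(2) by (simp add: field_simps)
    then show "dilate K \<sigma> (1 + fst z) (snd z) = H ((1 + fst z) * g z - 1, dilate K \<sigma> (1 / g z) (snd z))"
      using H0 proj(1)[OF z(1)] z(2) by simp
  qed
  show "cell_homotopy H (0, x) = x" if "x \<in> ?D" for x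
    using depth_nonneg[OF that] by (simp add: cell_homotopy_def Let_def dilate_1)
  show "cell_homotopy H (s, x) = H (s, x)" if "s \<in> {0..1}" "x \<in> ?D" "x \<notin> product_cell K \<sigma>" for s x
    using depth_eq_0[OF that(2,3)] that C H0 by (auto simp: cell_homotopy_def Let_def dilate_1)
  show "cell_homotopy H (s, x) \<in> ?D \<union> C" if "s \<in> {0..1}" "x \<in> ?D" for s x
  proof (cases "(1 + s) * g (s, x) \<le> 1")
    case True
    then show ?thesis
      using that dilate_closed_cell[of x "1 + s"] closed_cell_affine by (auto simp: eq g_def)
  next
    case False
    then show ?thesis
      using that HC proj(1,2)[of "(s, x)"] by (simp add: eq)
  qed
qed

end

lemma closed_cell_realization:
  assumes "subcomplex K V L"
    and faces: "\<And>\<sigma> \<gamma>. \<sigma> \<in> cells K V - L \<Longrightarrow> \<gamma> \<in> cells K UNIV \<Longrightarrow> \<gamma> \<le> \<sigma> \<Longrightarrow> \<gamma> \<noteq> \<sigma> \<Longrightarrow> \<gamma> \<in> L"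
    and \<sigma>: "\<sigma> \<in> cells K V - L" and x: "x \<in> closed_cell K \<sigma>"
  shows "x \<in> realization K L \<longleftrightarrow> x \<notin> product_cell K \<sigma>"
    and "x \<notin> realization K L \<Longrightarrow> carrier_cell K x = \<sigma>"
proof -
  have fin: "finite V" "L \<subseteq> cells K V" using assms(1) by (auto simp: subcomplex_def)
  have c: "carrier_cell K x \<in> cells K UNIV" "carrier_cell K x \<le> \<sigma>" "x \<in> product_cell K (carrier_cell K x)"
    using carrier_closed_cell[OF x _ fin(1)] \<sigma> cells_mono[of V UNIV K] by blast+
  show iff: "x \<in> realization K L \<longleftrightarrow> x \<notin> product_cell K \<sigma>"
  proof
    assume "x \<in> realization K L"
    then have "carrier_cell K x \<in> L" by (rule carrier_realization[OF fin(2)])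
    then show "x \<notin> product_cell K \<sigma>" using carrier_product_cell[of x K \<sigma> V] \<sigma> by auto
  next
    assume "x \<notin> product_cell K \<sigma>"
    then have "carrier_cell K x \<noteq> \<sigma>" using c(3) by auto
    then have "carrier_cell K x \<in> L" using faces[OF \<sigma> c(1,2)] by blast
    then show "x \<in> realization K L" using c(3) unfolding realization_def by blast
  qed
  show "carrier_cell K x = \<sigma>" if "x \<notin> realization K L"
    using that iff carrier_product_cell[of x K \<sigma> V] \<sigma> by blast
qed

text \<open>The homotopy extension property in explicit form. Each omitted closed cell meets the
  subcomplex exactly in its boundary, where \<open>cell_homotopy\<close> agrees with
  \<open>H\<close>, so the finitely many closed pieces fit together.\<close>

lemma extend_homotopy:
  fixes H :: "real \<times> (nat \<Rightarrow> nat \<Rightarrow> real) \<Rightarrow> nat \<Rightarrow> nat \<Rightarrow> real"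
  assumes L: "subcomplex K V L" and K: "K \<noteq> {}"
    and faces: "\<And>\<sigma> \<gamma>. \<sigma> \<in> cells K V - L \<Longrightarrow> \<gamma> \<in> cells K UNIV \<Longrightarrow> \<gamma> \<le> \<sigma> \<Longrightarrow> \<gamma> \<noteq> \<sigma> \<Longrightarrow> \<gamma> \<in> L"
    and H: "continuous_on ({0..1} \<times> realization K L) H"
    and H0: "\<And>x. x \<in> realization K L \<Longrightarrow> H (0, x) = x"
    and HC: "\<And>s x. s \<in> {0..1} \<Longrightarrow> x \<in> realization K L \<Longrightarrow> H (s, x) \<in> realization K L"
  obtains F where "continuous_on ({0..1} \<times> realization K (cells K V)) F"
    and "\<And>x. x \<in> realization K (cells K V) \<Longrightarrow> F (0, x) = x"
    and "\<And>s x. s \<in> {0..1} \<Longrightarrow> x \<in> realization K (cells K V) \<Longrightarrow> F (s, x) \<in> realization K (cells K V)"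
    and "\<And>s x. x \<in> realization K L \<Longrightarrow> F (s, x) = H (s, x)"
proof -
  let ?C = "realization K L" and ?R = "cells K V - L" and ?X = "realization K (cells K V)"
  have fin: "finite K" "finite V" "L \<subseteq> cells K V" using L by (auto simp: subcomplex_def)
  note X = realization_cells_decomp[OF L]
  have decomp: "x \<in> ?C \<longleftrightarrow> x \<notin> product_cell K \<sigma>" "x \<notin> ?C \<Longrightarrow> carrier_cell K x = \<sigma>"
    if "\<sigma> \<in> ?R" "x \<in> closed_cell K \<sigma>" for \<sigma> x
    using closed_cell_realization[OF L _ that] faces by blast+
  define F where "F z = (if snd z \<in> ?C then H z else cell_homotopy K (carrier_cell K (snd z)) H z)" for z
  have cell: "continuous_on ({0..1} \<times> closed_cell K \<sigma>) (cell_homotopy K \<sigma> H)"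
    "\<And>x. x \<in> closed_cell K \<sigma> \<Longrightarrow> cell_homotopy K \<sigma> H (0, x) = x"
    "\<And>s x. s \<in> {0..1} \<Longrightarrow> x \<in> closed_cell K \<sigma> \<Longrightarrow> x \<notin> product_cell K \<sigma> \<Longrightarrow> cell_homotopy K \<sigma> H (s, x) = H (s, x)"
    "\<And>s x. s \<in> {0..1} \<Longrightarrow> x \<in> closed_cell K \<sigma> \<Longrightarrow> cell_homotopy K \<sigma> H (s, x) \<in> closed_cell K \<sigma> \<union> ?C"
    if "\<sigma> \<in> ?R" for \<sigma>
  proof -
    have \<sigma>V: "\<sigma> \<in> cells K V" using that by blast
    have C: "x \<in> ?C" if "x \<in> closed_cell K \<sigma>" "x \<notin> product_cell K \<sigma>" for x
      using decomp(1)[OF \<open>\<sigma> \<in> ?R\<close> that(1)] that(2) by blast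
    note rules = cell_homotopy[where C = ?C and H = H, OF \<sigma>V fin(2,1) K]
    show "continuous_on ({0..1} \<times> closed_cell K \<sigma>) (cell_homotopy K \<sigma> H)"
      by (rule rules(1)) (erule (1) C | rule H | erule H0 | erule (1) HC)+
    show "cell_homotopy K \<sigma> H (0, x) = x" if "x \<in> closed_cell K \<sigma>" for x
      by (rule rules(2)) (erule (1) C | rule H that | erule H0 | erule (1) HC)+
    show "cell_homotopy K \<sigma> H (s, x) = H (s, x)"
      if "s \<in> {0..1}" "x \<in> closed_cell K \<sigma>" "x \<notin> product_cell K \<sigma>" for s x
      by (rule rules(3)) (erule (1) C | rule H that | erule H0 | erule (1) HC)+
    show "cell_homotopy K \<sigma> H (s, x) \<in> closed_cell K \<sigma> \<union> ?C"
      if "s \<in> {0..1}" "x \<in> closed_cell K \<sigma>" for s x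
      by (rule rules(4)) (erule (1) C | rule H that | erule H0 | erule (1) HC)+
  qed
  have F_cell: "F (s, x) = cell_homotopy K \<sigma> H (s, x)" if "s \<in> {0..1}" "\<sigma> \<in> ?R" "x \<in> closed_cell K \<sigma>" for s x \<sigma>
    using decomp[OF that(2,3)] cell(3)[OF that(2,1,3)] by (auto simp: F_def)
  show thesis
  proof (rule that[of F])
    have "continuous_on (\<Union>D\<in>insert ?C (closed_cell K ` ?R). {0..1} \<times> D) F"
    proof (rule continuous_on_closed_Union)
      show "finite (insert ?C (closed_cell K ` ?R))"
        using finite_cells[OF fin(1,2)] by simp
      fix D assume "D \<in> insert ?C (closed_cell K ` ?R)"
      then consider "D = ?C" | \<sigma> where "\<sigma> \<in> ?R" "D = closed_cell K \<sigma>" by blast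
      then have "closed D \<and> continuous_on ({0..1} \<times> D) F"
      proof cases
        case 1
        have "continuous_on ({0..1} \<times> ?C) F"
          using H by (rule continuous_on_eq) (auto simp: F_def)
        then show ?thesis using 1 compact_realization[OF L] by (simp add: compact_imp_closed)
      next
        case (2 \<sigma>)
        have "continuous_on ({0..1} \<times> closed_cell K \<sigma>) F"
          using cell(1)[OF 2(1)] by (rule continuous_on_eq) (use F_cell 2(1) in auto)
        moreover have "compact (closed_cell K \<sigma>)"
          using 2(1) fin(2) by (intro compact_closed_cell[of \<sigma> K V]) auto
        ultimately show ?thesis using 2 by (simp add: compact_imp_closed)
      qed
      then show "closed ({0..1::real} \<times> D)" "continuous_on ({0..1} \<times> D) F"
        by (auto intro: closed_Times)
    qed
    moreover have "(\<Union>D\<in>insert ?C (closed_cell K ` ?R). {0..1} \<times> D) = {0..1::real} \<times> ?X"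
      unfolding X by blast
    ultimately show "continuous_on ({0..1} \<times> ?X) F" by simp
    show "F (0, x) = x" if x: "x \<in> ?X" for x
    proof (cases "x \<in> ?C")
      case True
      then show ?thesis using H0 by (simp add: F_def)
    next
      case False
      then obtain \<sigma> where \<sigma>: "\<sigma> \<in> ?R" "x \<in> closed_cell K \<sigma>" using x unfolding X by blast
      then show ?thesis using F_cell[OF _ \<sigma>, of 0] cell(2)[OF \<sigma>] by simp
    qed
    show "F (s, x) \<in> ?X" if s: "s \<in> {0..1}" and x: "x \<in> ?X" for s x
    proof (cases "x \<in> ?C")
      case True
      then show ?thesis using HC s by (simp add: X F_def)
    next
      case False
      then obtain \<sigma> where \<sigma>: "\<sigma> \<in> ?R" "x \<in> closed_cell K \<sigma>" using x unfolding X by blast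
      then show ?thesis
        using F_cell[OF s \<sigma>] cell(4)[OF \<sigma>(1) s \<sigma>(2)] unfolding X by auto
    qed
  qed (simp add: F_def)
qed


section \<open>Cells as spheres\<close>

definition unit_sphere :: "nat \<Rightarrow> (nat \<Rightarrow> real) set" where
  "unit_sphere d = {x. (\<Sum>i\<le>d. (x i)\<^sup>2) = 1 \<and> (\<forall>i>d. x i = 0)}"

definition pole :: "nat \<Rightarrow> real" where
  "pole = (\<lambda>i. if i = 0 then 1 else 0)"

lemma nsphere_eq: "nsphere d = top_of_set (unit_sphere d)"
  unfolding nsphere unit_sphere_def euclidean_product_topology ..

lemma pole_unique: "s \<in> unit_sphere d \<Longrightarrow> s 0 = 1 \<Longrightarrow> s = pole"
proof
  fix i assume s: "s \<in> unit_sphere d" "s 0 = 1"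
  have "(\<Sum>l\<in>{..d} - {0}. (s l)\<^sup>2) = 0"
    using s by (simp add: unit_sphere_def sum_diff1)
  then have "s l = 0" if "l \<le> d" "l \<noteq> 0" for l
    using that by (auto simp: sum_nonneg_eq_0_iff)
  then show "s i = pole i"
    using s by (cases "i \<le> d") (auto simp: pole_def unit_sphere_def)
qed

lemma pole_in_sphere: "pole \<in> unit_sphere d"
  by (simp add: unit_sphere_def pole_def if_distrib[of "\<lambda>x. x\<^sup>2"] cong: if_cong)

text \<open>Inverse stereographic projection of \<open>y / h\<close>, which extends to \<open>h = 0\<close> by the pole.\<close>

definition stereo :: "nat \<Rightarrow> (nat \<Rightarrow> real) \<Rightarrow> real \<Rightarrow> nat \<Rightarrow> real" where
  "stereo d y h = (\<lambda>l. if l = 0 then ((\<Sum>j<d. (y j)\<^sup>2) - h\<^sup>2) / ((\<Sum>j<d. (y j)\<^sup>2) + h\<^sup>2)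
     else if l \<le> d then 2 * h * y (l - 1) / ((\<Sum>j<d. (y j)\<^sup>2) + h\<^sup>2) else 0)"

lemma stereo_in_sphere:
  assumes "(\<Sum>j<d. (y j)\<^sup>2) + h\<^sup>2 \<noteq> 0"
  shows "stereo d y h \<in> unit_sphere d"
proof -
  let ?N = "\<Sum>j<d. (y j)\<^sup>2"
  have "(\<Sum>l\<le>d. (stereo d y h l)\<^sup>2) = ((?N - h\<^sup>2) / (?N + h\<^sup>2))\<^sup>2 + (\<Sum>j<d. (2 * h / (?N + h\<^sup>2))\<^sup>2 * (y j)\<^sup>2)"
    unfolding sum.atMost_shift
    by (intro arg_cong2[of _ _ _ _ "(+)"] sum.cong) (auto simp: stereo_def power_mult_distrib power_divide)
  also have "\<dots> = ((?N - h\<^sup>2)\<^sup>2 + 4 * h\<^sup>2 * ?N) / (?N + h\<^sup>2)\<^sup>2"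
    by (simp add: power_divide power_mult_distrib add_divide_distrib flip: sum_distrib_left sum_divide_distrib)
  also have "(?N - h\<^sup>2)\<^sup>2 + 4 * h\<^sup>2 * ?N = (?N + h\<^sup>2)\<^sup>2"
    by (simp add: power2_eq_square algebra_simps)
  finally show ?thesis using assms by (simp add: unit_sphere_def stereo_def)
qed

lemma stereo_eq_pole_iff:
  assumes "(\<Sum>j<d. (y j)\<^sup>2) + h\<^sup>2 \<noteq> 0"
  shows "stereo d y h = pole \<longleftrightarrow> h = 0"
proof
  assume "stereo d y h = pole"
  then have "stereo d y h 0 = 1" by (simp add: pole_def)
  then show "h = 0" using assms by (simp add: stereo_def)
next
  assume "h = 0"
  then show "stereo d y h = pole" using assms by (auto simp: stereo_def pole_def)
qed

text \<open>The left side is stereographic projection from the pole.\<close>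

lemma stereo_inverse:
  assumes "h \<noteq> 0" "j < d"
  shows "stereo d y h (Suc j) / (1 - stereo d y h 0) = y j / h"
proof -
  let ?D = "(\<Sum>j<d. (y j)\<^sup>2) + h\<^sup>2"
  have D: "?D > 0" using assms(1) by (simp add: add_nonneg_pos sum_nonneg)
  have "1 - stereo d y h 0 = 2 * h\<^sup>2 / ?D" using D by (simp add: stereo_def field_simps)
  moreover have "stereo d y h (Suc j) = 2 * h * y j / ?D" using assms(2) by (simp add: stereo_def)
  ultimately show ?thesis using D assms(1) by (simp add: power2_eq_square)
qed

text \<open>The prescribed \<open>y\<close> is \<open>h\<close> times the stereographic projection
  of \<open>s\<close>. The sphere equation then expresses the sum of squares, and with it every
  numerator and denominator of \<open>stereo\<close>, through \<open>h\<close> and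
  \<open>s 0\<close>.\<close>

lemma stereo_surj:
  assumes s: "s \<in> unit_sphere d" "s \<noteq> pole" and h: "h \<noteq> 0"
    and y: "\<And>j. j < d \<Longrightarrow> y j = h * (s (Suc j) / (1 - s 0))"
  shows "stereo d y h = s"
proof -
  have s1: "(\<Sum>j<d. (s (Suc j))\<^sup>2) = 1 - (s 0)\<^sup>2"
    using s(1) unfolding unit_sphere_def sum.atMost_shift by simp
  then have "(s 0)\<^sup>2 \<le> 1" using sum_nonneg[of "{..<d}" "\<lambda>j. (s (Suc j))\<^sup>2"] by simp
  then have "s 0 \<le> 1" by (simp add: abs_le_square_iff[of _ 1, simplified, symmetric] abs_le_iff)
  moreover have "s 0 \<noteq> 1" using pole_unique s by blast
  ultimately have a: "1 - s 0 > 0" by simp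
  have "(\<Sum>j<d. (y j)\<^sup>2) = (\<Sum>j<d. (h / (1 - s 0))\<^sup>2 * (s (Suc j))\<^sup>2)"
    using y by (intro sum.cong refl) (simp add: power_mult_distrib power_divide)
  also have "\<dots> = (h / (1 - s 0))\<^sup>2 * (1 - (s 0)\<^sup>2)"
    unfolding sum_distrib_left[symmetric] s1 ..
  also have "\<dots> = h\<^sup>2 * (1 + s 0) / (1 - s 0)"
  proof -
    have "1 - (s 0)\<^sup>2 = (1 - s 0) * (1 + s 0)" by (simp add: power2_eq_square algebra_simps)
    then show ?thesis using a by (simp add: power2_eq_square)
  qed
  finally have N: "(\<Sum>j<d. (y j)\<^sup>2) = h\<^sup>2 * (1 + s 0) / (1 - s 0)" .
  have D: "(\<Sum>j<d. (y j)\<^sup>2) + h\<^sup>2 = 2 * h\<^sup>2 / (1 - s 0)"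
    unfolding N using a by (simp add: field_simps)
  have E: "(\<Sum>j<d. (y j)\<^sup>2) - h\<^sup>2 = 2 * h\<^sup>2 * s 0 / (1 - s 0)"
    unfolding N using a by (simp add: field_simps)
  show ?thesis
  proof
    fix l
    consider "l = 0" | j where "l = Suc j" "j < d" | "l > d"
      by (metis Suc_lessE Suc_lessI gr0_implies_Suc linorder_not_le not_gr_zero not_less_eq)
    then show "stereo d y h l = s l"
    proof cases
      case 1
      then show ?thesis unfolding stereo_def D E using a h by simp
    next
      case (2 j)
      then show ?thesis unfolding stereo_def D using a h y[of j] by (simp add: power2_eq_square)
    next
      case 3
      then show ?thesis using s(1) by (simp add: stereo_def unit_sphere_def)
    qed
  qed
qed

text \<open>Coordinates centred at the barycenter are divided by the depth, which opens the cell up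
  to a euclidean space with its boundary at infinity; inverse stereographic projection then sends
  the boundary to the pole.\<close>

lemma cell_sphere_map:
  assumes \<sigma>: "\<sigma> \<in> cells K V" and fin: "finite V" "finite K" and K: "K \<noteq> {}"
    and d: "cell_deg K \<sigma> = d"
  obtains f where "continuous_on (closed_cell K \<sigma>) f"
    and "f ` closed_cell K \<sigma> \<subseteq> unit_sphere d"
    and "\<And>x. x \<in> closed_cell K \<sigma> \<Longrightarrow> f x = pole \<longleftrightarrow> x \<notin> product_cell K \<sigma>"
    and "inj_on f (product_cell K \<sigma>)"
    and "unit_sphere d - {pole} \<subseteq> f ` product_cell K \<sigma>"
proof -
  note card_pos = card_factor_pos[OF \<sigma> fin K] and fin\<sigma> = finite_factor[OF \<sigma> fin K]
  let ?h = "depth K \<sigma>"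
  \<comment> \<open>One vertex of each factor is dropped, since the coordinates of a factor sum to
    1. Exactly \<open>d\<close> coordinates remain.\<close>
  define z where "z i = (SOME v. v \<in> \<sigma> i)" for i
  have z: "z i \<in> \<sigma> i" if "i \<in> K" for i
  proof -
    have "\<sigma> i \<noteq> {}" using card_pos[OF that] by auto
    then show ?thesis unfolding z_def by (simp add: some_in_eq)
  qed
  define P where "P = Sigma K (\<lambda>i. \<sigma> i - {z i})"
  have "finite P" using fin(2) fin\<sigma> by (auto simp: P_def)
  moreover have "card P = d"
    using fin(2) fin\<sigma> z by (simp add: P_def card_SigmaI flip: d) (simp add: cell_deg_def)
  ultimately obtain e where e: "bij_betw e {..<d} P"
    using ex_bij_betw_nat_finite[of P] by (auto simp: atLeast0LessThan)
  define y where "y x l = x (fst (e l)) (snd (e l)) - 1 / card (\<sigma> (fst (e l)))" for x :: "nat \<Rightarrow> nat \<Rightarrow> real" and l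
  define f where "f x = stereo d (y x) (?h x)" for x
  let ?D = "closed_cell K \<sigma>" and ?O = "product_cell K \<sigma>"
  have OD: "?O \<subseteq> ?D" by (auto simp: product_cell_iff)
  \<comment> \<open>Proportionality of the retained centred coordinates extends to the dropped one,
    because centred coordinates sum to 0 in every factor.\<close>
  have coord: "x i v = 1 / card (\<sigma> i) + r * (x' i v - 1 / card (\<sigma> i))"
    if yr: "\<And>l. l < d \<Longrightarrow> y x l = r * y x' l" and x: "x \<in> ?D" "x' \<in> affine_cell K \<sigma>"
      and iv: "i \<in> K" "v \<in> \<sigma> i" for x x' r i v
  proof -
    let ?c = "1 / real (card (\<sigma> i))"
    have other: "x i u - ?c = r * (x' i u - ?c)" if u: "u \<in> \<sigma> i - {z i}" for u
    proof -
      have "(i, u) \<in> P" using u \<open>i \<in> K\<close> by (simp add: P_def)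
      then obtain l where "l < d" "e l = (i, u)" using e by (force simp: bij_betw_def)
      then show ?thesis using yr[of l] by (simp add: y_def)
    qed
    have xx: "(\<Sum>u\<in>\<sigma> i. x i u) = 1" "(\<Sum>u\<in>\<sigma> i. x' i u) = 1"
      using x iv(1) by (auto simp: closed_cell_iff affine_cell_def[OF \<sigma> fin K])
    have c1: "(\<Sum>u\<in>\<sigma> i. ?c) = 1" using card_pos[OF \<open>i \<in> K\<close>] by simp
    have 0: "(\<Sum>u\<in>\<sigma> i. x i u - ?c) = 0" "(\<Sum>u\<in>\<sigma> i. x' i u - ?c) = 0"
      by (simp_all only: sum_subtractf xx c1 diff_self)
    have "(\<Sum>u\<in>\<sigma> i. (x i u - ?c) - r * (x' i u - ?c)) = 0"
      by (simp only: sum_subtractf[of "\<lambda>u. x i u - ?c"] sum_distrib_left[symmetric] 0 mult_zero_right diff_self)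
    moreover have "(\<Sum>u\<in>\<sigma> i. (x i u - ?c) - r * (x' i u - ?c)) = (x i (z i) - ?c) - r * (x' i (z i) - ?c)"
    proof -
      have "(\<Sum>u\<in>\<sigma> i - {z i}. (x i u - ?c) - r * (x' i u - ?c)) = 0"
        using other by (intro sum.neutral) simp
      then show ?thesis
        using sum.remove[OF fin\<sigma>[OF iv(1)] z[OF iv(1)], of "\<lambda>u. (x i u - ?c) - r * (x' i u - ?c)"]
        by (simp only: add_0_right)
    qed
    ultimately have "x i v - ?c = r * (x' i v - ?c)"
      using other[of v] \<open>v \<in> \<sigma> i\<close> by (cases "v = z i") auto
    then show ?thesis by simp
  qed
  have dil: "x = dilate K \<sigma> r x'"
    if "\<And>l. l < d \<Longrightarrow> y x l = r * y x' l" "x \<in> ?D" "x' \<in> affine_cell K \<sigma>" for x x' r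
  proof (intro ext)
    fix i v
    show "x i v = dilate K \<sigma> r x' i v"
    proof (cases "i \<in> K \<and> v \<in> \<sigma> i")
      case True
      then show ?thesis using coord[OF that] by (simp add: dilate_def)
    next
      case False
      then have "x i v = x' i v"
        using that(2,3) by (cases "i \<in> K") (auto simp: closed_cell_iff affine_cell_def[OF \<sigma> fin K])
      then show ?thesis using False by (auto simp: dilate_def)
    qed
  qed
  \<comment> \<open>If all centred coordinates vanish, the point is the barycenter, that is, its own
    dilation by 0, and there the depth is 1.\<close>
  have den: "(\<Sum>j<d. (y x j)\<^sup>2) + (?h x)\<^sup>2 > 0" if x: "x \<in> ?D" for x
  proof (rule ccontr)
    assume "\<not> ?thesis"
    moreover have "0 \<le> (\<Sum>j<d. (y x j)\<^sup>2)" "0 \<le> (?h x)\<^sup>2" by (simp_all add: sum_nonneg)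
    ultimately have *: "(\<Sum>j<d. (y x j)\<^sup>2) = 0" "(?h x)\<^sup>2 = 0" by linarith+
    then have "?h x = 0" by simp
    have "y x l = 0 * y x l" if "l < d" for l using *(1) that by (simp add: sum_nonneg_eq_0_iff)
    then have "x = dilate K \<sigma> 0 x"
      using dil[of x 0 x] x closed_cell_affine[OF \<sigma> fin K] by blast
    then have "?h x = 1 + 0 * (?h x - 1)" using depth_dilate[OF \<sigma> fin K, of 0 x] by simp
    then show False using \<open>?h x = 0\<close> by simp
  qed
  have y_cont: "continuous_on S (\<lambda>x. y x l)" for S l
    unfolding y_def by (intro continuous_intros)
  show thesis
  proof (rule that[of f])
    have "continuous_on ?D (\<lambda>x. f x l)" for l
    proof -
      have ne: "\<forall>x\<in>?D. (\<Sum>j<d. (y x j)\<^sup>2) + (?h x)\<^sup>2 \<noteq> 0" using den by force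
      consider "l = 0" | "l \<noteq> 0" "l \<le> d" | "l \<noteq> 0" "\<not> l \<le> d" by blast
      then show ?thesis
        by cases (auto simp: f_def stereo_def intro!: continuous_intros y_cont
            continuous_on_depth[OF \<sigma> fin K] ne[rule_format])
    qed
    then show "continuous_on ?D f" by (intro continuous_on_coordinatewise_then_product)
    show "f ` ?D \<subseteq> unit_sphere d"
      using den stereo_in_sphere by (force simp: f_def)
    show "f x = pole \<longleftrightarrow> x \<notin> ?O" if "x \<in> ?D" for x
    proof -
      have "f x = pole \<longleftrightarrow> ?h x = 0"
        unfolding f_def using den[OF that] by (intro stereo_eq_pole_iff) simp
      then show ?thesis
        using depth_eq_0[OF \<sigma> fin K that] depth_pos_iff[OF \<sigma> fin K that] by auto
    qed
    show "inj_on f ?O"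
    proof (rule inj_onI)
      fix x x' assume x: "x \<in> ?O" "x' \<in> ?O" "f x = f x'"
      have D: "x \<in> ?D" "x' \<in> ?D" using x OD by auto
      have h: "?h x > 0" "?h x' > 0"
        using depth_pos_iff[OF \<sigma> fin K] D x by auto
      \<comment> \<open>Equal images mean equal quotients of \<open>y\<close> by depth, so
        \<open>x\<close> is the dilation of \<open>x'\<close> by \<open>?r\<close>. Comparing
        depths, \<open>?h x = 1 + ?h x - ?r\<close>, which forces \<open>?r = 1\<close>.\<close>
      let ?r = "?h x / ?h x'"
      have "y x l = ?r * y x' l" if "l < d" for l
      proof -
        have "y x l / ?h x = y x' l / ?h x'"
          using stereo_inverse[OF _ that, of "?h x" "y x"] stereo_inverse[OF _ that, of "?h x'" "y x'"] h x(3)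
          by (simp add: f_def)
        then show ?thesis using h by (simp add: field_simps)
      qed
      then have eq: "x = dilate K \<sigma> ?r x'"
        using dil D closed_cell_affine[OF \<sigma> fin K] by blast
      then have "?h x = 1 + ?r * (?h x' - 1)"
        using depth_dilate[OF \<sigma> fin K, of ?r x'] h by simp
      then have "?r = 1" using h by (simp add: field_simps)
      then show "x = x'" using eq dilate_1[OF \<sigma> fin K] by simp
    qed
    show "unit_sphere d - {pole} \<subseteq> f ` ?O"
    proof
      fix s assume "s \<in> unit_sphere d - {pole}"
      then have s: "s \<in> unit_sphere d" "s \<noteq> pole" by auto
      \<comment> \<open>\<open>w\<close> is the stereographic projection of \<open>s\<close>,
        indexed by the retained coordinates. The value of \<open>u\<close> at \<open>z i\<close>
        makes each factor sum to 0, so that \<open>x'\<close> is in the affine hull with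
        \<open>y x'\<close> equal to the projection.\<close>
      define w where "w p = s (Suc (inv_into {..<d} e p)) / (1 - s 0)" for p
      define u where "u i v = (if v = z i then - (\<Sum>v\<in>\<sigma> i - {z i}. w (i, v)) else w (i, v))" for i v
      define x' where "x' i = (if i \<in> K then (\<lambda>v. if v \<in> \<sigma> i then 1 / card (\<sigma> i) + u i v else 0) else undefined)" for i
      have "(\<Sum>v\<in>\<sigma> i. x' i v) = 1" if "i \<in> K" for i
      proof -
        have "(\<Sum>v\<in>\<sigma> i. u i v) = u i (z i) + (\<Sum>v\<in>\<sigma> i - {z i}. u i v)"
          using fin\<sigma>[OF that] z[OF that] by (rule sum.remove)
        also have "(\<Sum>v\<in>\<sigma> i - {z i}. u i v) = (\<Sum>v\<in>\<sigma> i - {z i}. w (i, v))"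
          by (intro sum.cong) (auto simp: u_def)
        finally have "(\<Sum>v\<in>\<sigma> i. u i v) = 0" by (simp add: u_def)
        then show ?thesis using that card_pos[OF that] by (simp add: x'_def sum.distrib)
      qed
      then have x': "x' \<in> affine_cell K \<sigma>" unfolding affine_cell_def[OF \<sigma> fin K] by (simp add: x'_def)
      have y': "y x' l = s (Suc l) / (1 - s 0)" if "l < d" for l
      proof -
        obtain i v where iv: "e l = (i, v)" by (cases "e l")
        then have "(i, v) \<in> P" using e that by (force simp: bij_betw_def)
        moreover have "inv_into {..<d} e (e l) = l"
          using e that by (intro inv_into_f_f) (auto simp: bij_betw_def)
        ultimately show ?thesis using iv by (simp add: y_def x'_def u_def w_def P_def)
      qed
      \<comment> \<open>The solution of \<open>r = 1 + r * (?h x' - 1)\<close>: after dilation by it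
        the depth is \<open>r\<close> itself, so the quotient of \<open>y\<close> by depth is the
        original \<open>y x'\<close>.\<close>
      let ?r = "1 / (2 - ?h x')"
      have h1: "?h x' \<le> 1" using depth_le_1[OF \<sigma> fin K x'] .
      define x where "x = dilate K \<sigma> ?r x'"
      have hx: "?h x = ?r"
        unfolding x_def using depth_dilate[OF \<sigma> fin K, of ?r x'] h1 by (simp add: field_simps)
      have "x \<in> ?D"
        unfolding x_def using h1 by (intro dilate_closed_cell[OF \<sigma> fin K x']) (auto simp: field_simps)
      moreover have "?h x > 0" using hx h1 by simp
      ultimately have xO: "x \<in> ?O" using depth_pos_iff[OF \<sigma> fin K] by blast
      have "y x l = ?h x * (s (Suc l) / (1 - s 0))" if "l < d" for l
      proof -
        have "e l \<in> P" using e that by (force simp: bij_betw_def)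
        then have "y x l = ?r * y x' l"
          by (auto simp: y_def x_def dilate_def P_def)
        then show ?thesis using y'[OF that] hx by simp
      qed
      then have "f x = s"
        unfolding f_def using \<open>?h x > 0\<close> by (intro stereo_surj[OF s]) auto
      then show "s \<in> f ` ?O" using xO by blast
    qed
  qed
qed


section \<open>Collapsing to a wedge of spheres\<close>

lemma wedge_of_spheres_eq: "wedge_of_spheres m d = wedge_topology (\<lambda>_. nsphere d) (\<lambda>_. pole) {..<m}"
  unfolding wedge_of_spheres_def pole_def ..

lemma topspace_wedge_of_spheres:
  "topspace (wedge_of_spheres m d) = insert None (Some ` ({..<m} \<times> (unit_sphere d - {pole})))"
proof -
  have sub1: "wedge_map (\<lambda>_. pole) ` (SIGMA i:{..<m}. unit_sphere d) \<subseteq>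
      insert None (Some ` ({..<m} \<times> (unit_sphere d - {pole})))"
  proof
    fix w assume "w \<in> wedge_map (\<lambda>_. pole) ` (SIGMA i:{..<m}. unit_sphere d)"
    then obtain i s where "i < m" "s \<in> unit_sphere d" "w = wedge_map (\<lambda>_. pole) (i, s)" by auto
    then show "w \<in> insert None (Some ` ({..<m} \<times> (unit_sphere d - {pole})))"
      by (cases "s = pole") (auto simp: wedge_map_def)
  qed
  have 1: "Some (i, s) \<in> wedge_map (\<lambda>_. pole) ` (SIGMA i:{..<m}. unit_sphere d)"
    if "i < m" "s \<in> unit_sphere d - {pole}" for i s
    by (rule image_eqI[of _ _ "(i, s)"]) (use that in \<open>simp_all add: wedge_map_def\<close>)
  have sub2: "Some ` ({..<m} \<times> (unit_sphere d - {pole})) \<subseteq> wedge_map (\<lambda>_. pole) ` (SIGMA i:{..<m}. unit_sphere d)"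
  proof (rule image_subsetI)
    fix p assume "p \<in> {..<m} \<times> (unit_sphere d - {pole})"
    then show "Some p \<in> wedge_map (\<lambda>_. pole) ` (SIGMA i:{..<m}. unit_sphere d)"
      using 1[of "fst p" "snd p"] by (simp add: mem_Times_iff)
  qed
  have "insert None A = insert None B" if "A \<subseteq> insert None B" "B \<subseteq> A" for A B :: "(nat \<times> (nat \<Rightarrow> real)) option set"
    using that by blast
  from this[OF sub1 sub2] show ?thesis
    unfolding wedge_of_spheres_eq topspace_wedge_topology nsphere_eq topspace_euclidean_subtopology .
qed

lemma continuous_map_wedge_inclusion:
  assumes "i < m"
  shows "continuous_map (top_of_set (unit_sphere d)) (wedge_of_spheres m d) (\<lambda>s. wedge_map (\<lambda>_. pole) (i, s))"
  unfolding continuous_map_def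
proof (intro conjI allI impI Pi_I)
  fix s assume "s \<in> topspace (top_of_set (unit_sphere d))"
  then show "wedge_map (\<lambda>_. pole) (i, s) \<in> topspace (wedge_of_spheres m d)"
    using assms by (simp add: topspace_wedge_of_spheres wedge_map_def)
next
  fix U assume "openin (wedge_of_spheres m d) U"
  then show "openin (top_of_set (unit_sphere d))
      {x \<in> topspace (top_of_set (unit_sphere d)). wedge_map (\<lambda>_. pole) (i, x) \<in> U}"
    unfolding wedge_of_spheres_eq openin_wedge_topology nsphere_eq using assms by blast
qed

lemma closedin_wedge_of_spheres:
  assumes "T \<subseteq> topspace (wedge_of_spheres m d)"
    and "\<And>i. i < m \<Longrightarrow> closedin (top_of_set (unit_sphere d)) {s \<in> unit_sphere d. wedge_map (\<lambda>_. pole) (i, s) \<in> T}"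
  shows "closedin (wedge_of_spheres m d) T"
  unfolding closedin_def
proof (intro conjI assms(1))
  let ?W = "topspace (wedge_of_spheres m d)"
  have "openin (top_of_set (unit_sphere d)) {s \<in> unit_sphere d. wedge_map (\<lambda>_. pole) (i, s) \<in> ?W - T}"
    if "i < m" for i
  proof -
    have "wedge_map (\<lambda>_. pole) (i, s) \<in> ?W" if "s \<in> unit_sphere d" for s
      using \<open>i < m\<close> that by (simp add: topspace_wedge_of_spheres wedge_map_def)
    then have "{s \<in> unit_sphere d. wedge_map (\<lambda>_. pole) (i, s) \<in> ?W - T} =
        topspace (top_of_set (unit_sphere d)) - {s \<in> unit_sphere d. wedge_map (\<lambda>_. pole) (i, s) \<in> T}"
      by auto
    then show ?thesis using assms(2)[OF that] by (simp add: openin_diff)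
  qed
  then show "openin (wedge_of_spheres m d) (?W - T)"
    unfolding wedge_of_spheres_eq openin_wedge_topology nsphere_eq topspace_wedge_topology by auto
qed

text \<open>The fibres of \<open>q\<close> are single points and the realization of
  \<open>L\<close>. The extended contraction keeps the latter inside itself and ends constant on it,
  as \<open>quotient_homotopy_equivalent_space\<close> requires.\<close>

lemma realization_homotopy_equivalent_wedge:
  assumes L: "subcomplex K V L" and K: "K \<noteq> {}"
    and faces: "\<And>\<sigma> \<gamma>. \<sigma> \<in> cells K V - L \<Longrightarrow> \<gamma> \<in> cells K UNIV \<Longrightarrow> \<gamma> \<le> \<sigma> \<Longrightarrow> \<gamma> \<noteq> \<sigma> \<Longrightarrow> \<gamma> \<in> L"
    and deg: "\<And>\<sigma>. \<sigma> \<in> cells K V - L \<Longrightarrow> cell_deg K \<sigma> = d"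
    and contr: "contractible (realization K L)" and ne: "realization K L \<noteq> {}"
  shows "top_of_set (realization K (cells K V)) homotopy_equivalent_space
    wedge_of_spheres (card (cells K V - L)) d"
proof -
  let ?C = "realization K L" and ?R = "cells K V - L" and ?X = "realization K (cells K V)"
  let ?m = "card (cells K V - L)"
  let ?W = "wedge_of_spheres ?m d"
  have fin: "finite K" "finite V" "L \<subseteq> cells K V" using L by (auto simp: subcomplex_def)
  have finR: "finite ?R" using finite_cells[OF fin(1,2)] by simp
  note sub = subcomplex_cells[OF fin(1,2)]
  note X = realization_cells_decomp[OF L]
  have decomp: "x \<in> ?C \<longleftrightarrow> x \<notin> product_cell K \<sigma>" "x \<notin> ?C \<Longrightarrow> carrier_cell K x = \<sigma>"
    if "\<sigma> \<in> ?R" "x \<in> closed_cell K \<sigma>" for \<sigma> x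
    using closed_cell_realization[OF L _ that] faces by blast+
  have cell: "\<exists>\<sigma>\<in>?R. x \<in> closed_cell K \<sigma> \<and> x \<in> product_cell K \<sigma> \<and> carrier_cell K x = \<sigma>"
    if "x \<in> ?X" "x \<notin> ?C" for x
    using that decomp unfolding X by blast

  obtain e where e: "bij_betw e ?R {..<?m}"
    using ex_bij_betw_finite_nat[OF finR] by (auto simp: atLeast0LessThan)
  have e_lt: "e \<sigma> < ?m" if "\<sigma> \<in> ?R" for \<sigma> using e that by (auto simp: bij_betw_def)
  have e_inj: "\<sigma> = \<tau>" if "e \<sigma> = e \<tau>" "\<sigma> \<in> ?R" "\<tau> \<in> ?R" for \<sigma> \<tau>
    using e that by (auto simp: bij_betw_def inj_on_def)
  have e_surj: "\<exists>\<sigma>\<in>?R. i = e \<sigma>" if "i < ?m" for i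
    using e that unfolding bij_betw_def by (metis imageE lessThan_iff)
  have "\<forall>\<sigma>\<in>?R. \<exists>f. continuous_on (closed_cell K \<sigma>) f \<and> f ` closed_cell K \<sigma> \<subseteq> unit_sphere d \<and>
      (\<forall>x\<in>closed_cell K \<sigma>. f x = pole \<longleftrightarrow> x \<notin> product_cell K \<sigma>) \<and> inj_on f (product_cell K \<sigma>) \<and>
      unit_sphere d - {pole} \<subseteq> f ` product_cell K \<sigma>"
  proof
    fix \<sigma> assume \<sigma>: "\<sigma> \<in> ?R"
    have "\<sigma> \<in> cells K V" using \<sigma> by blast
    from cell_sphere_map[OF this fin(2,1) K deg[OF \<sigma>]]
    show "\<exists>f. continuous_on (closed_cell K \<sigma>) f \<and> f ` closed_cell K \<sigma> \<subseteq> unit_sphere d \<and>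
      (\<forall>x\<in>closed_cell K \<sigma>. f x = pole \<longleftrightarrow> x \<notin> product_cell K \<sigma>) \<and> inj_on f (product_cell K \<sigma>) \<and>
      unit_sphere d - {pole} \<subseteq> f ` product_cell K \<sigma>" by metis
  qed
  then obtain f where f: "\<And>\<sigma>. \<sigma> \<in> ?R \<Longrightarrow> continuous_on (closed_cell K \<sigma>) (f \<sigma>)"
    "\<And>\<sigma>. \<sigma> \<in> ?R \<Longrightarrow> f \<sigma> ` closed_cell K \<sigma> \<subseteq> unit_sphere d"
    "\<And>\<sigma> x. \<sigma> \<in> ?R \<Longrightarrow> x \<in> closed_cell K \<sigma> \<Longrightarrow> f \<sigma> x = pole \<longleftrightarrow> x \<notin> product_cell K \<sigma>"
    "\<And>\<sigma>. \<sigma> \<in> ?R \<Longrightarrow> inj_on (f \<sigma>) (product_cell K \<sigma>)"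
    "\<And>\<sigma>. \<sigma> \<in> ?R \<Longrightarrow> unit_sphere d - {pole} \<subseteq> f \<sigma> ` product_cell K \<sigma>"
    unfolding bchoice_iff by blast
  define q where "q x = (if x \<in> ?C then None else Some (e (carrier_cell K x), f (carrier_cell K x) x))" for x
  have q_cell: "q x = wedge_map (\<lambda>_. pole) (e \<sigma>, f \<sigma> x)" if "\<sigma> \<in> ?R" "x \<in> closed_cell K \<sigma>" for \<sigma> x
    using decomp[OF that] f(3)[OF that] by (auto simp: q_def wedge_map_def)

  have q_cont: "continuous_map (top_of_set ?X) ?W q"
  proof (rule pasting_lemma_closed[where I = "insert ?C (closed_cell K ` ?R)" and T = id and f = "\<lambda>_. q"])
    show "finite (insert ?C (closed_cell K ` ?R))" using finR by simp
    fix D assume "D \<in> insert ?C (closed_cell K ` ?R)"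
    then consider "D = ?C" | \<sigma> where "\<sigma> \<in> ?R" "D = closed_cell K \<sigma>" by blast
    then have "closed D \<and> D \<subseteq> ?X \<and> continuous_map (top_of_set D) ?W q"
    proof cases
      case 1
      have "continuous_map (top_of_set ?C) ?W (\<lambda>_. None)"
        by (simp add: topspace_wedge_of_spheres)
      then have "continuous_map (top_of_set ?C) ?W q"
        by (rule continuous_map_eq) (simp add: q_def)
      then show ?thesis using 1 compact_realization[OF L] X by (auto simp: compact_imp_closed)
    next
      case (2 \<sigma>)
      have "continuous_map (top_of_set (closed_cell K \<sigma>)) (top_of_set (unit_sphere d)) (f \<sigma>)"
        using f(1,2)[OF 2(1)] by (auto simp: continuous_map_in_subtopology)
      from continuous_map_compose[OF this continuous_map_wedge_inclusion[OF e_lt[OF 2(1)]]]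
      have "continuous_map (top_of_set (closed_cell K \<sigma>)) ?W q"
        by (rule continuous_map_eq) (use q_cell[OF 2(1)] in auto)
      moreover have "compact (closed_cell K \<sigma>)"
        using 2(1) fin(2) by (intro compact_closed_cell[of \<sigma> K V]) auto
      ultimately show ?thesis using 2 X by (auto simp: compact_imp_closed)
    qed
    then show "closedin (top_of_set ?X) (id D)" "continuous_map (subtopology (top_of_set ?X) (id D)) ?W q"
      by (auto simp: subtopology_subtopology Int_absorb1 closed_subset)
  next
    fix x assume "x \<in> topspace (top_of_set ?X)"
    then show "\<exists>D. D \<in> insert ?C (closed_cell K ` ?R) \<and> x \<in> id D \<and> q x = q x"
      using X by auto
  qed simp

  have q_surj: "q ` ?X = topspace ?W"
  proof
    show "q ` ?X \<subseteq> topspace ?W"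
      using continuous_map_image_subset_topspace[OF q_cont] by simp
    show "topspace ?W \<subseteq> q ` ?X"
    proof
      fix w assume "w \<in> topspace ?W"
      then consider "w = None" | i s where "w = Some (i, s)" "i < ?m" "s \<in> unit_sphere d" "s \<noteq> pole"
        unfolding topspace_wedge_of_spheres by blast
      then show "w \<in> q ` ?X"
      proof cases
        case 1
        then show ?thesis using ne X by (force simp: q_def)
      next
        case (2 i s)
        obtain \<sigma> where \<sigma>: "\<sigma> \<in> ?R" "i = e \<sigma>" using e_surj[OF 2(2)] by blast
        obtain x where x: "x \<in> product_cell K \<sigma>" "s = f \<sigma> x" using f(5)[OF \<sigma>(1)] 2(3,4) by blast
        have "x \<in> closed_cell K \<sigma>" using x(1) by (simp add: product_cell_iff)
        then have "q x = w" "x \<in> ?X"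
          using q_cell[OF \<sigma>(1)] 2 \<sigma> x(2) X by (auto simp: wedge_map_def)
        then show ?thesis by blast
      qed
    qed
  qed

  \<comment> \<open>Closedness in the wedge is tested on each sphere. There the trace of the image
    of \<open>T\<close> is the compact image of the part of \<open>T\<close> in one closed cell,
    together with the pole whenever \<open>T\<close> meets the subcomplex, possibly outside that
    cell.\<close>
  have q_closed: "closed_map (top_of_set ?X) ?W q"
    unfolding closed_map_def
  proof (intro allI impI closedin_wedge_of_spheres)
    fix T assume "closedin (top_of_set ?X) T"
    then have T: "compact T" "T \<subseteq> ?X"
      using compact_realization[OF sub] by (auto simp: closedin_compact_eq)
    show "q ` T \<subseteq> topspace ?W" using T(2) q_surj by blast
    fix i assume "i < ?m"
    then obtain \<sigma> where \<sigma>: "\<sigma> \<in> ?R" "i = e \<sigma>" using e_surj by blast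
    have cD: "compact (closed_cell K \<sigma>)"
      using \<sigma>(1) fin(2) by (intro compact_closed_cell[of \<sigma> K V]) auto
    let ?P = "if T \<inter> ?C = {} then {} else {pole}"
    have "{s \<in> unit_sphere d. wedge_map (\<lambda>_. pole) (i, s) \<in> q ` T} = f \<sigma> ` (T \<inter> closed_cell K \<sigma>) \<union> ?P"
      (is "?A = ?B")
    proof
      have "f \<sigma> x \<in> ?A" if "x \<in> T \<inter> closed_cell K \<sigma>" for x
      proof -
        have "wedge_map (\<lambda>_. pole) (i, f \<sigma> x) = q x" using q_cell[OF \<sigma>(1)] \<sigma>(2) that by simp
        then show ?thesis using f(2)[OF \<sigma>(1)] that by auto
      qed
      moreover have "pole \<in> ?A" if "x \<in> T" "x \<in> ?C" for x
      proof -
        have "wedge_map (\<lambda>_. pole) (i, pole) = q x" using that(2) by (simp add: q_def wedge_map_def)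
        then show ?thesis using that(1) pole_in_sphere[of d] by auto
      qed
      ultimately show "?B \<subseteq> ?A" by (auto simp only: Un_subset_iff image_subset_iff split: if_splits)
      show "?A \<subseteq> ?B"
      proof
        fix s assume "s \<in> ?A"
        then obtain x where x: "x \<in> T" "wedge_map (\<lambda>_. pole) (i, s) = q x" by blast
        show "s \<in> ?B"
        proof (cases "x \<in> ?C")
          case True
          then have "s = pole" using x(2) by (simp add: q_def wedge_map_def split: if_splits)
          then show ?thesis using True x(1) by auto
        next
          case False
          then obtain \<tau> where \<tau>: "\<tau> \<in> ?R" "x \<in> closed_cell K \<tau>" "carrier_cell K x = \<tau>"
            using cell[of x] x(1) T(2) by blast
          then have "i = e \<tau>" "s = f \<tau> x"
            using x(2) False by (simp_all add: q_def wedge_map_def split: if_splits)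
          then show ?thesis using e_inj[OF _ \<sigma>(1) \<tau>(1)] \<sigma>(2) \<tau>(2) x(1) by auto
        qed
      qed
    qed
    moreover have "compact (f \<sigma> ` (T \<inter> closed_cell K \<sigma>))"
      using T(1) cD f(1)[OF \<sigma>(1)]
      by (intro compact_continuous_image compact_Int) (auto intro: continuous_on_subset)
    then have "closed ?B" by (intro closed_Un compact_imp_closed) auto
    moreover have "?A \<subseteq> unit_sphere d" by blast
    ultimately show "closedin (top_of_set (unit_sphere d)) ?A"
      by (metis closed_subset)
  qed
  have quot: "quotient_map (top_of_set ?X) ?W q"
    using q_cont q_closed q_surj by (intro continuous_closed_imp_quotient_map) auto

  obtain a H where H: "continuous_on ({0..1} \<times> ?C) H" "\<And>x. x \<in> ?C \<Longrightarrow> H (0, x) = x"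
    "\<And>s x. s \<in> {0..1} \<Longrightarrow> x \<in> ?C \<Longrightarrow> H (s, x) \<in> ?C" "\<And>x. H (1::real, x) = a"
  proof -
    obtain a where "homotopic_with_canon (\<lambda>x. True) ?C ?C id (\<lambda>x. a)"
      using contr unfolding contractible_def by blast
    then obtain h where h: "continuous_map (prod_topology (top_of_set {0..1::real}) (top_of_set ?C)) (top_of_set ?C) h"
      "\<And>x. h (0, x) = x" "\<And>x. h (1, x) = a"
      unfolding homotopic_with_def by auto
    have c: "continuous_map (top_of_set ({0..1} \<times> ?C)) (top_of_set ?C) h"
      using h(1) by (simp only: prod_topology_subtopology_eu)
    then have "continuous_on ({0..1} \<times> ?C) h" "h ` ({0..1} \<times> ?C) \<subseteq> ?C"
      using continuous_map_image_subset_topspace[OF c] by (auto simp: continuous_map_in_subtopology)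
    then show thesis using h(2,3) by (intro that[of h a]) auto
  qed
  obtain F where F: "continuous_on ({0..1} \<times> ?X) F" "\<And>x. x \<in> ?X \<Longrightarrow> F (0, x) = x"
    "\<And>s x. s \<in> {0..1} \<Longrightarrow> x \<in> ?X \<Longrightarrow> F (s, x) \<in> ?X" "\<And>s x. x \<in> ?C \<Longrightarrow> F (s, x) = H (s, x)"
  proof (rule extend_homotopy[OF L K _ H(1)])
    show "\<gamma> \<in> L" if "\<sigma> \<in> ?R" "\<gamma> \<in> cells K UNIV" "\<gamma> \<le> \<sigma>" "\<gamma> \<noteq> \<sigma>" for \<sigma> \<gamma>
      using that by (rule faces)
    show "H (0, x) = x" if "x \<in> ?C" for x using that by (rule H(2))
    show "H (s, x) \<in> ?C" if "s \<in> {0..1}" "x \<in> ?C" for s x using that by (rule H(3))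
  qed (rule that)
  have same: "x = y \<or> (x \<in> ?C \<and> y \<in> ?C)" if xy: "x \<in> ?X" "y \<in> ?X" "q x = q y" for x y
  proof (cases "x \<in> ?C \<or> y \<in> ?C")
    case True
    then show ?thesis using xy(3) by (auto simp: q_def split: if_splits)
  next
    case False
    then obtain \<sigma> \<tau> where "\<sigma> \<in> ?R" "x \<in> product_cell K \<sigma>" "carrier_cell K x = \<sigma>"
      "\<tau> \<in> ?R" "y \<in> product_cell K \<tau>" "carrier_cell K y = \<tau>"
      using cell[OF xy(1)] cell[OF xy(2)] by blast
    then show ?thesis
      using xy(3) False e_inj[of \<sigma> \<tau>] f(4)[of \<sigma>] by (auto simp: q_def dest: inj_onD)
  qed
  show ?thesis
  proof (rule quotient_homotopy_equivalent_space[OF quot])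
    have "F z \<in> ?X" if "z \<in> {0..1} \<times> ?X" for z
      using F(3)[of "fst z" "snd z"] that by (simp add: mem_Times_iff)
    then have "F \<in> {0..1} \<times> ?X \<rightarrow> ?X" by (rule Pi_I)
    then show "continuous_map (prod_topology (top_of_set {0..1}) (top_of_set ?X)) (top_of_set ?X) F"
      using F(1) by (simp add: prod_topology_subtopology_eu continuous_map_subtopology_eu)
    show "F (0, x) = x" if "x \<in> topspace (top_of_set ?X)" for x
      using that F(2) by simp
    fix x y assume xy: "x \<in> topspace (top_of_set ?X)" "y \<in> topspace (top_of_set ?X)" "q x = q y"
    then have s: "x = y \<or> (x \<in> ?C \<and> y \<in> ?C)" using same by simp
    show "F (1, x) = F (1, y)" using s F(4) H(4) by auto
    show "q (F (t, x)) = q (F (t, y))" if "t \<in> {0..1}" for t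
      using s F(4) H(3)[OF that] by (auto simp: q_def)
  qed
qed

text \<open>The base vertex is the tuple \<open>(1,...,k)\<close>, a cell because
  \<open>k \<le> N\<close>. For \<open>k = 1\<close> the sum is 0 and the wedge a point, in
  accordance with the contractibility of the simplex.\<close>

lemma disc_conf_space_homotopy_equivalent_wedge:
  assumes k: "1 \<le> k" "k \<le> N"
  shows "\<exists>m::nat. int m = (\<Sum>i=0..k. (- 1) ^ (i + k + 1) * int (k choose (i + 1)) * int i ^ N) \<and>
    disc_conf_space k {1..N} homotopy_equivalent_space wedge_of_spheres m (N - k)"
proof -
  let ?K = "{1..k}" and ?V = "{1..N}"
  let ?p = "vertex_cell ?K id"
  obtain L where L: "expands ?K {?p} L" "L \<subseteq> cells ?K ?V"
      "\<And>\<sigma>. \<sigma> \<in> cells ?K ?V - L \<Longrightarrow> (\<Union>i\<in>?K. \<sigma> i) = ?V"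
    using cells_expand[of ?V ?K id] k by auto
  have p: "?p \<in> cells ?K ?V" using k by (intro vertex_cell_in_cells) auto
  have pd: "cell_deg ?K ?p = 0" by (simp add: cell_deg_def vertex_cell_def)
  have "subcomplex ?K ?V {?p}"
    unfolding subcomplex_def
  proof (intro conjI ballI impI)
    fix \<sigma> \<gamma> assume \<gamma>: "\<sigma> \<in> {?p}" "\<gamma> \<in> cells ?K UNIV" "\<gamma> \<le> \<sigma>"
    have "\<gamma> l = ?p l" for l
      using le_funD[OF \<gamma>(3), of l] \<gamma>(1,2) by (auto simp: cells_iff vertex_cell_def subset_singleton_iff)
    then show "\<gamma> \<in> {?p}" by auto
  qed (use p in auto)
  moreover have "\<exists>x. realization ?K {?p} = {x}"
  proof -
    have open_face: "open_face {v} = {(\<lambda>u. if u = v then 1 else 0)}" for v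
      by (auto simp: open_face_def fun_eq_iff)
    define x where "x = restrict (\<lambda>i u. if u = i then 1 else 0 :: real) ?K"
    have "product_cell ?K ?p = (\<Pi>\<^sub>E i\<in>?K. {x i})"
      unfolding product_cell_def by (intro PiE_cong) (simp add: vertex_cell_def x_def open_face)
    also have "\<dots> = {x}" unfolding x_def by (rule PiE_singleton) (rule restrict_extensional)
    finally show ?thesis by (simp add: realization_def)
  qed
  then have "contractible (realization ?K {?p})" and ne: "realization ?K {?p} \<noteq> {}"
    by (auto simp flip: contractible_space_top_of_set)
  ultimately have sub: "subcomplex ?K ?V L" and contr: "contractible (realization ?K L)"
    using contractible_realization_expands[OF L(1) _ L(2)] by blast+
  have "{?p} \<subseteq> L" using expands_superset[OF L(1)] .
  then have ne: "realization ?K L \<noteq> {}" using ne unfolding realization_def by blast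
  have K: "?K \<noteq> {}" using k by simp
  have "top_of_set (realization ?K (cells ?K ?V)) homotopy_equivalent_space
      wedge_of_spheres (card (cells ?K ?V - L)) (N - k)"
  proof (rule realization_homotopy_equivalent_wedge[OF sub K _ _ contr ne])
    fix \<sigma> assume \<sigma>: "\<sigma> \<in> cells ?K ?V - L"
    show "cell_deg ?K \<sigma> = N - k" using cell_deg_full[of ?V ?K \<sigma>] \<sigma> L(3)[OF \<sigma>] by simp
    fix \<gamma> assume \<gamma>: "\<gamma> \<in> cells ?K UNIV" "\<gamma> \<le> \<sigma>" "\<gamma> \<noteq> \<sigma>"
    have "(\<Union>i\<in>?K. \<gamma> i) \<noteq> ?V" using proper_face_not_full[OF _ \<gamma>] \<sigma> by blast
    moreover have "\<gamma> \<in> cells ?K ?V"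
      using cells_face[OF _ \<gamma>(2), of ?K ?V] \<sigma> \<gamma>(1) by (auto simp: cells_iff)
    ultimately show "\<gamma> \<in> L" using L(3) by blast
  qed
  moreover have "int (card (cells ?K ?V - L)) =
      (\<Sum>i=0..k. (- 1) ^ (i + k + 1) * int (k choose (i + 1)) * int i ^ N)"
    using card_full_cells[OF _ _ L(1,2) _ pd] L(3) k K by simp
  ultimately show ?thesis
    unfolding disc_conf_space_eq[OF finite_atLeastAtMost] by blast
qed

lemma conf_euler_char_egf:
  "Abs_fps (\<lambda>k. Abs_fps (\<lambda>n. real_of_int (conf_euler_char k {1..n}) / (fact k * fact n)))
    = fps2_exp (fps2_x + fps2_y - fps2_x * fps2_exp (- fps2_y))"
proof -
  \<comment> \<open>Written as \<open>y + x (1 - e^(-y))\<close>, the exponent has the shape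
    \<open>y + x a\<close> with \<open>a\<close> a series in \<open>y\<close> alone.\<close>
  have arg: "fps2_x + fps2_y - fps2_x * fps2_exp (- fps2_y) = fps2_y + fps2_x * fps_const (1 - fps_exp (- 1))"
    unfolding fps2_exp_neg_y by (simp add: algebra_simps flip: fps_const_sub)
  show ?thesis
    unfolding arg
  proof (rule fps_ext, rule fps_ext)
    fix k n
    have "fps_nth (fps_nth (fps2_exp (fps2_y + fps2_x * fps_const (1 - fps_exp (- 1)))) k) n
        = fps_nth ((1 - fps_exp (- 1)) ^ k * fps_exp 1) n / fact k"
      unfolding fps2_exp_y_plus_x by (simp add: fps_divide_unit fps_const_inverse divide_inverse)
    also have "\<dots> = real_of_int (conf_euler_char k {1..n}) / (fact k * fact n)"
      unfolding binomial_fps_exp conf_euler_char_eq by (simp add: mult.commute)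
    finally show "fps_nth (fps_nth (Abs_fps (\<lambda>k. Abs_fps (\<lambda>n. real_of_int (conf_euler_char k {1..n}) / (fact k * fact n)))) k) n
        = fps_nth (fps_nth (fps2_exp (fps2_y + fps2_x * fps_const (1 - fps_exp (- 1)))) k) n"
      by simp
  qed
qed

theorem theorem1p2:
  shows "(\<forall>n k :: nat. n \<ge> 1 \<and> 2 \<le> k \<and> k \<le> n + 1 \<longrightarrow>
           (\<exists>m :: nat.
              int m = (\<Sum>i=0..k. (- 1) ^ (i + k + 1) * int (k choose (i + 1)) * int i ^ (n + 1)) \<and>
              disc_conf_space k {1..n+1} homotopy_equivalent_space wedge_of_spheres m (n + 1 - k)))
       \<and> Abs_fps (\<lambda>k. Abs_fps (\<lambda>n. real_of_int (conf_euler_char k {1..n}) / (fact k * fact n)))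
           = fps2_exp (fps2_x + fps2_y - fps2_x * fps2_exp (- fps2_y))"
proof (intro conjI allI impI)
  fix n k :: nat assume "n \<ge> 1 \<and> 2 \<le> k \<and> k \<le> n + 1"
  then show "\<exists>m :: nat.
      int m = (\<Sum>i=0..k. (- 1) ^ (i + k + 1) * int (k choose (i + 1)) * int i ^ (n + 1)) \<and>
      disc_conf_space k {1..n+1} homotopy_equivalent_space wedge_of_spheres m (n + 1 - k)"
    by (intro disc_conf_space_homotopy_equivalent_wedge) auto
qed (rule conf_euler_char_egf)

end
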